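(* Let $c>0$ and let $V\in C^2(\mathbb{R}^n)$ satisfy $\nabla^2V(x)-cI_n\ge 0$ for all $x\in\mathbb{R}^n$, with $\mathrm{d}\mu_V=e^{-V}\,\mathrm{d}x$ a probability measure on $\mathbb{R}^n$. Let $q:[0,\infty)\to(0,\infty)$ be a non-decreasing $C^1$-function such that $q'\le c$. (i) For every $t>0$ and every smooth function $u:\mathbb{R}^n\to\mathbb{R}$ for which there exist constants $C_1,C_2>0$ and $\theta\in(0,2)$ with $|u(x)|\le C_1+C_2|x|^\theta$ for all $x\in\mathbb{R}^n$, one has $$\delta^{\sf HC}_t(u)\ge c\int_0^t\frac{1}{q^2(\tau)}\,\delta^{\sf LSI}_{\mu_V}\left(e^{\frac{q(\tau)}{2}\mathbf{Q}_\tau u}\right)\,\mathrm{d}\tau.$$ (ii) Let $t>0$ and let $u:\mathbb{R}^n\to\mathbb{R}$ be a smooth function for which there exist constants $C_1,C_2>0$ and $\theta\in(0,2)$ with $|u(x)|\le C_1+C_2|x|^\theta$ for all $x\in\mathbb{R}^n$. Then equality holds in $$\|e^{\mathbf{Q}_tu}\|_{L^{q(t)}(\mathbb{R}^n,\mathrm{d}\mu_V)}\le\|e^u\|_{L^{q(0)}(\mathbb{R}^n,\mathrm{d}\mu_V)}$$ if and only if there exist $x_0\in\mathrm{Ker}(\nabla^2V-cI_n)$ and $c_0\in\mathbb{R}$ such that $u(x)=\langle x_0,x\rangle+c_0$ for all $x\in\mathbb{R}^n$, and, whenever $x_0\ne 0$, there is some $a>0$ such that $q(\tau)=a+c\tau$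 for every $\tau\in[0,t)$.
   Context: $I_n$ is the $n\times n$ identity matrix, $\nabla^2V$ is the Hessian of $V$, and $A\ge 0$ means that the symmetric matrix $A$ is positive semi-definite. $\mathrm{Ker}(\nabla^2V-cI_n):=\bigcap_{x\in\mathbb{R}^n}\ker(\nabla^2V(x)-cI_n)$, where $\ker(M)$ is the null space of the matrix $M$. For $t>0$ the Hopf--Lax semigroup is $\mathbf{Q}_tu(x)=\inf_{y\in\mathbb{R}^n}\left\{u(y)+\frac{|x-y|^2}{2t}\right\}$, and $\mathbf{Q}_0u=u$. For $p>0$, $\|h\|_{L^p(\mathbb{R}^n,\mathrm{d}\mu_V)}=\left(\int_{\mathbb{R}^n}|h|^p\,\mathrm{d}\mu_V\right)^{1/p}$. The hypercontractivity deficit is $$\delta^{\sf HC}_t(u)=\log\frac{\|e^u\|_{L^{q(0)}(\mathbb{R}^n,\mathrm{d}\mu_V)}}{\|e^{\mathbf{Q}_tu}\|_{L^{q(t)}(\mathbb{R}^n,\mathrm{d}\mu_V)}}.$$ $W^{1,2}(\mathbb{R}^n,\mu_V)$ is the family of functions $f\in L^2(\mathbb{R}^n,\mu_V)$ with $|\nabla f|\in L^2(\mathbb{R}^n,\mu_V)$. With $\mathrm{Ent}_{\mu_V}(f^2)=\int_{\mathbb{R}^n}f^2\log f^2\,\mathrm{d}\mu_V-\left(\int_{\mathbb{R}^n}f^2\,\mathrm{d}\mu_V\right)\log\left(\int_{\mathbb{R}^n}f^2\,\mathrm{d}\mu_V\right)$, the Bakry--Émery log-Sobolev deficit of $f\in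 W^{1,2}(\mathbb{R}^n,\mu_V)\setminus\{0\}$ is $$\delta^{\sf LSI}_{\mu_V}(f)=\frac{\frac2c\int_{\mathbb{R}^n}|\nabla f|^2\,\mathrm{d}\mu_V-\mathrm{Ent}_{\mu_V}(f^2)}{\int_{\mathbb{R}^n}f^2\,\mathrm{d}\mu_V}\ge 0.$$ *)

theory Defs
  imports "HOL-Probability.Probability"
begin

section \<open>Differentiability classes, gradient and Hessian\<close>

text \<open>In finite dimension a map is $C^{k+1}$ iff it is differentiable everywhere and all its
  directional derivatives are $C^k$.\<close>

primrec Ck :: "nat \<Rightarrow> ('a::euclidean_space \<Rightarrow> 'b::real_normed_vector) \<Rightarrow> bool" where
  "Ck 0 f \<longleftrightarrow> continuous_on UNIV f"
| "Ck (Suc k) f \<longleftrightarrow> (\<forall>x. f differentiable (at x)) \<and> (\<forall>v. Ck k (\<lambda>x. frechet_derivative f (at x) v))"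

definition smooth :: "('a::euclidean_space \<Rightarrow> 'b::real_normed_vector) \<Rightarrow> bool" where
  "smooth f \<longleftrightarrow> (\<forall>k. Ck k f)"

definition partial_deriv :: "'n::finite \<Rightarrow> (real^'n \<Rightarrow> real) \<Rightarrow> real^'n \<Rightarrow> real" where
  "partial_deriv i f x = frechet_derivative f (at x) (axis i 1)"

definition grad :: "(real^'n::finite \<Rightarrow> real) \<Rightarrow> real^'n \<Rightarrow> real^'n" where
  "grad f x = (\<chi> i. partial_deriv i f x)"

definition hessian :: "(real^'n::finite \<Rightarrow> real) \<Rightarrow> real^'n \<Rightarrow> real^'n^'n" where
  "hessian f x = jacobian (grad f) (at x)"

definition psd :: "real^'n^'n::finite \<Rightarrow> bool" where
  "psd A \<longleftrightarrow> transpose A = A \<and> (\<forall>v. 0 \<le> v \<bullet> (A *v v))"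

definition Ker_hessian :: "(real^'n::finite \<Rightarrow> real) \<Rightarrow> real \<Rightarrow> (real^'n) set" where
  "Ker_hessian V c = (\<Inter>x. {v. (hessian V x - c *\<^sub>R mat 1) *v v = 0})"

section \<open>The weighted measure and its Lebesgue and Sobolev spaces\<close>

definition mu :: "(real^'n::finite \<Rightarrow> real) \<Rightarrow> (real^'n) measure" where
  "mu V = density lborel (\<lambda>x. ennreal (exp (- V x)))"

definition Lp_space :: "'a measure \<Rightarrow> real \<Rightarrow> ('a \<Rightarrow> real) set" where
  "Lp_space M p = {h \<in> borel_measurable M. integrable M (\<lambda>x. \<bar>h x\<bar> powr p)}"

text \<open>Meaningful for members of \<^term>\<open>Lp_space M p\<close>; otherwise the integral has the junk value 0.\<close>

definition Lp_norm :: "'a measure \<Rightarrow> real \<Rightarrow> ('a \<Rightarrow> real) \<Rightarrow> real" where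
  "Lp_norm M p h = (LINT x|M. \<bar>h x\<bar> powr p) powr (1 / p)"

definition locally_integrable :: "('a::euclidean_space \<Rightarrow> 'b::{banach,second_countable_topology}) \<Rightarrow> bool" where
  "locally_integrable f \<longleftrightarrow> (\<forall>K. compact K \<longrightarrow> set_integrable lborel K f)"

definition test_function :: "('a::euclidean_space \<Rightarrow> real) \<Rightarrow> bool" where
  "test_function \<phi> \<longleftrightarrow> smooth \<phi> \<and> compact (closure {x. \<phi> x \<noteq> 0})"

definition is_weak_gradient :: "(real^'n::finite \<Rightarrow> real) \<Rightarrow> (real^'n \<Rightarrow> real^'n) \<Rightarrow> bool" where
  "is_weak_gradient f g \<longleftrightarrow> locally_integrable f \<and> locally_integrable g \<and>
     (\<forall>\<phi> i. test_function \<phi> \<longrightarrow>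
        (LINT x|lborel. f x * partial_deriv i \<phi> x) = - (LINT x|lborel. g x $ i * \<phi> x))"

text \<open>Weak gradients are unique up to Lebesgue null sets, so integrals of expressions in
  \<^term>\<open>weak_grad f\<close> do not depend on the representative chosen here.\<close>

definition weak_grad :: "(real^'n::finite \<Rightarrow> real) \<Rightarrow> real^'n \<Rightarrow> real^'n" where
  "weak_grad f = (SOME g. is_weak_gradient f g)"

text \<open>The gradient is distributional with respect to Lebesgue measure. For a measure
  \<^term>\<open>mu V\<close> with \<open>V\<close> continuous the local integrability demanded by
  \<^const>\<open>is_weak_gradient\<close> is implied by square integrability.\<close>

definition W12 :: "(real^'n::finite) measure \<Rightarrow> (real^'n \<Rightarrow> real) set" where
  "W12 M = {f \<in> Lp_space M 2. (\<exists>g. is_weak_gradient f g) \<and> (\<lambda>x. norm (weak_grad f x)) \<in> Lp_space M 2}"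

section \<open>Hopf-Lax semigroup, entropy and deficits\<close>

text \<open>The infimum is that of a set bounded below whenever \<open>u\<close> grows less than quadratically.\<close>

definition hopf_lax :: "real \<Rightarrow> (real^'n::finite \<Rightarrow> real) \<Rightarrow> real^'n \<Rightarrow> real" where
  "hopf_lax t u x = (if t = 0 then u x else (INF y. u y + (norm (x - y))\<^sup>2 / (2 * t)))"

definition Ent :: "'a measure \<Rightarrow> ('a \<Rightarrow> real) \<Rightarrow> real" where
  "Ent M h = (LINT x|M. h x * ln (h x)) - (LINT x|M. h x) * ln (LINT x|M. h x)"

definition HC_deficit ::
    "(real^'n::finite) measure \<Rightarrow> (real \<Rightarrow> real) \<Rightarrow> real \<Rightarrow> (real^'n \<Rightarrow> real) \<Rightarrow> real" where
  "HC_deficit M q t u =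
     ln (Lp_norm M (q 0) (\<lambda>x. exp (u x)) / Lp_norm M (q t) (\<lambda>x. exp (hopf_lax t u x)))"

definition LSI_deficit :: "real \<Rightarrow> (real^'n::finite) measure \<Rightarrow> (real^'n \<Rightarrow> real) \<Rightarrow> real" where
  "LSI_deficit c M f =
     (2 / c * (LINT x|M. (norm (weak_grad f x))\<^sup>2) - Ent M (\<lambda>x. (f x)\<^sup>2)) / (LINT x|M. (f x)\<^sup>2)"

end

theory Submission
  imports Defs
begin

text \<open>
  Write \<open>Q\<^sub>\<tau>\<close> for the Hopf--Lax semigroup applied to \<open>u\<close> and \<open>N(\<tau>)\<close> for the logarithm of the
  \<open>L\<^sup>q\<close> norm, with exponent \<open>q(\<tau>)\<close>, of the exponential of \<open>Q\<^sub>\<tau>\<close>. The Hamilton--Jacobi equation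
  \<open>\<partial>\<^sub>\<tau> Q + |\<nabla>Q|\<^sup>2 / 2 = 0\<close> turns the derivative of \<open>N\<close> into
  \<open>- ((c - q') E + c \<delta>) / q\<^sup>2\<close>, where \<open>E \<ge> 0\<close> is a normalised entropy and \<open>\<delta>\<close> is the log-Sobolev
  deficit of \<open>exp (q Q\<^sub>\<tau> / 2)\<close>. Since \<open>q' \<le> c\<close>, integrating over \<open>(0, t)\<close> gives the deficit inequality
  (lemmas \<open>\<Phi>_DERIV\<close>, \<open>log_norm_DERIV\<close>, \<open>\<delta>_flow\<close>).

  The identity rests on first order information on \<open>Q\<^sub>\<tau>\<close>. Every minimiser \<open>y\<close> of
  \<open>u y + |x - y|\<^sup>2 / (2 \<tau>)\<close> gives a smooth function touching \<open>Q\<close> from above at \<open>(\<tau>, x)\<close>; wherever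
  the minimiser is unique, comparing the touching functions of nearby points squeezes the difference
  quotients of \<open>Q\<close> in space and in time. Minimisers are monotone along coordinate lines, so they fail
  to be unique only countably often on each line, hence on a null set. All limits are then taken by
  dominated convergence against Gaussians, which strong convexity of \<open>V\<close> and the subquadratic growth of
  \<open>u\<close> provide.

  The log-Sobolev inequality \<open>\<delta> \<ge> 0\<close> and its equality case come from transporting
  \<open>exp (g - V)\<close> to \<open>exp (- V)\<close> by the triangular Knothe map \<open>T = id + \<theta>\<close> (\<open>knothe_map_exists\<close>,
  \<open>log_sobolev_knothe\<close>). Taking logarithms in the Jacobian equation, bounding
  \<open>V (x + \<theta>)\<close> from below by strong convexity and \<open>ln\<close> by its tangent, and integrating the divergence of
  \<open>exp (g - V) \<theta>\<close> by parts yields the inequality with explicit remainders. If equality holds, all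
  remainders vanish: then \<open>\<partial>\<^sub>i \<theta>\<^sub>i = 0\<close> and \<open>\<nabla>g = - c \<theta>\<close>, and because the map is triangular, symmetry of
  mixed increments of \<open>g\<close> forces \<open>\<theta>\<close> to be constant. So \<open>g\<close> is affine, and equality in the convexity
  estimate for \<open>V\<close> puts \<open>\<theta>\<close> into the common kernel.

  If the two norms agree, then \<open>N\<close>, being non-increasing, is constant on \<open>[0, t]\<close>; so \<open>\<delta> = 0\<close> at every
  intermediate time, every \<open>Q\<^sub>\<tau>\<close> is affine with slope in the kernel, and \<open>\<tau> \<rightarrow> 0\<close> gives the same for
  \<open>u\<close>. For such \<open>u\<close> a translation computes \<open>N\<close> exactly (\<open>affine_log_norm\<close>): the change of \<open>N\<close> is a
  positive multiple of \<open>(q t - q 0 - c t) |x\<^sub>0|\<^sup>2\<close>, which decides both directions of the equivalence.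
\<close>

section \<open>Integrating out one coordinate\<close>

text \<open>Coordinates are integrated out one at a time without leaving \<open>real^'n\<close>: a function from which a
  coordinate has been removed stays a function on the whole space that ignores that coordinate.\<close>

definition upd :: "real^'n \<Rightarrow> 'n \<Rightarrow> real \<Rightarrow> real^'n" where
  "upd x i s = (\<chi> j. if j = i then s else x $ j)"

definition marg :: "'n \<Rightarrow> (real^'n::finite \<Rightarrow> real) \<Rightarrow> real^'n \<Rightarrow> real" where
  "marg i F x = (LINT s|lborel. F (upd x i s))"

text \<open>The unnormalised distribution function of coordinate \<open>i\<close>, the others being held fixed at \<open>x\<close>.\<close>

definition partial_cdf :: "'n \<Rightarrow> (real^'n::finite \<Rightarrow> real) \<Rightarrow> real^'n \<Rightarrow> real" where
  "partial_cdf i F x = (LINT s|lborel. indicator {..x $ i} s * F (upd x i s))"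

text \<open>Positive continuous functions of the coordinates in \<open>S\<close> only, with a Gaussian bound in these
  coordinates. The class is closed under integrating out a coordinate, so that every iterated marginal
  of a Gaussian-dominated density is again continuous and positive.\<close>

definition gauss_dom :: "'n set \<Rightarrow> (real^'n::finite \<Rightarrow> real) \<Rightarrow> bool" where
  "gauss_dom S F \<longleftrightarrow> continuous_on UNIV F \<and> (\<forall>x. F x > 0) \<and>
     (\<forall>x i s. i \<notin> S \<longrightarrow> F (upd x i s) = F x) \<and>
     (\<exists>C a. a > 0 \<and> (\<forall>x. F x \<le> C * exp (- a * (\<Sum>j\<in>S. (x $ j)\<^sup>2))))"

lemma upd_nth [simp]: "upd x i s $ j = (if j = i then s else x $ j)"
  by (simp add: upd_def)

lemma upd_upd [simp]: "upd (upd x i s) i r = upd x i r"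
  by (simp add: vec_eq_iff)

lemma upd_same [simp]: "upd x i (x $ i) = x"
  by (simp add: vec_eq_iff)

lemma upd_swap: "i \<noteq> j \<Longrightarrow> upd (upd x i s) j r = upd (upd x j r) i s"
  by (simp add: vec_eq_iff)

lemma upd_eq: "upd x i s = x + (s - x $ i) *\<^sub>R axis i 1"
  by (simp add: vec_eq_iff axis_def)

lemma add_axis_eq_upd: "x + h *\<^sub>R axis i 1 = upd x i (x $ i + h)"
  by (simp add: vec_eq_iff axis_def)

lemma continuous_upd [continuous_intros]:
  "continuous_on S f \<Longrightarrow> continuous_on S g \<Longrightarrow> continuous_on S (\<lambda>x. upd (f x) i (g x))"
  unfolding upd_eq by (intro continuous_intros)

lemma tendsto_upd [tendsto_intros]:
  "(f \<longlongrightarrow> a) F \<Longrightarrow> (g \<longlongrightarrow> b) F \<Longrightarrow> ((\<lambda>x. upd (f x) i (g x)) \<longlongrightarrow> upd a i b) F"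
  unfolding upd_eq by (intro tendsto_intros)

lemma integrable_gaussian_real:
  assumes "a > 0" shows "integrable lborel (\<lambda>s::real. exp (- a * s\<^sup>2))"
proof -
  have "integrable lborel (normal_density 0 (sqrt (1/(2*a))))"
    using assms by (intro integrable_normal_density) auto
  then have "integrable lborel (\<lambda>s. sqrt (2 * pi * (sqrt (1/(2*a)))\<^sup>2) * normal_density 0 (sqrt (1/(2*a))) s)"
    by auto
  also have "(\<lambda>s. sqrt (2 * pi * (sqrt (1/(2*a)))\<^sup>2) * normal_density 0 (sqrt (1/(2*a))) s) = (\<lambda>s. exp (- a * s\<^sup>2))"
    using assms by (auto simp: normal_density_def fun_eq_iff field_simps real_sqrt_divide)
  finally show ?thesis .
qed

lemma gauss_domD:
  assumes "gauss_dom S F"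
  shows "continuous_on UNIV F" "F x > 0" "i \<notin> S \<Longrightarrow> F (upd x i s) = F x"
  using assms by (auto simp: gauss_dom_def)

lemma gauss_dom_slice_bound:
  assumes "gauss_dom S F" "i \<in> S"
  obtains C a where "a > 0" "C > 0"
    "\<And>x s. F (upd x i s) \<le> C * exp (- a * (\<Sum>j\<in>S-{i}. (x $ j)\<^sup>2)) * exp (- a * s\<^sup>2)"
    "\<And>x s. F (upd x i s) \<le> C * exp (- a * s\<^sup>2)"
proof -
  from assms obtain C a where C: "a > 0" "\<And>x. F x \<le> C * exp (- a * (\<Sum>j\<in>S. (x $ j)\<^sup>2))"
    and pos: "\<And>x. F x > 0"
    by (auto simp: gauss_dom_def)
  have Cpos: "C > 0"
  proof -
    have "0 < C * exp (- a * (\<Sum>j\<in>S. ((0::real^_) $ j)\<^sup>2))" using C(2)[of 0] pos[of 0] by linarith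
    then show ?thesis by simp
  qed
  have 1: "F (upd x i s) \<le> C * exp (- a * (\<Sum>j\<in>S-{i}. (x $ j)\<^sup>2)) * exp (- a * s\<^sup>2)" for x s
  proof -
    have "(\<Sum>j\<in>S. (upd x i s $ j)\<^sup>2) = s\<^sup>2 + (\<Sum>j\<in>S-{i}. (x $ j)\<^sup>2)"
      using assms(2) by (subst sum.remove[of _ i]) (auto intro!: sum.cong)
    then show ?thesis using C(2)[of "upd x i s"]
      by (simp add: exp_add[symmetric] algebra_simps)
  qed
  have 2: "F (upd x i s) \<le> C * exp (- a * s\<^sup>2)" for x s
  proof -
    have "exp (- a * (\<Sum>j\<in>S-{i}. (x $ j)\<^sup>2)) \<le> 1"
      using C(1) by (simp add: sum_nonneg)
    then have "C * exp (- a * (\<Sum>j\<in>S-{i}. (x $ j)\<^sup>2)) * exp (- a * s\<^sup>2) \<le> C * 1 * exp (- a * s\<^sup>2)"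
      using Cpos by (intro mult_right_mono mult_left_mono) auto
    with 1[of x s] show ?thesis by simp
  qed
  show thesis using that[OF C(1) Cpos 1 2] .
qed

lemma gauss_dom_slice_measurable:
  assumes "gauss_dom S F" shows "(\<lambda>s. F (upd x i s)) \<in> borel_measurable borel"
  by (intro borel_measurable_continuous_onI continuous_on_compose2[OF gauss_domD(1)[OF assms]] continuous_intros) auto

lemma gauss_dom_slice_integrable:
  assumes "gauss_dom S F" "i \<in> S" shows "integrable lborel (\<lambda>s. F (upd x i s))"
proof -
  obtain C a where C: "a > 0" "C > 0" "\<And>x s. F (upd x i s) \<le> C * exp (- a * s\<^sup>2)"
    using gauss_dom_slice_bound[OF assms] by metis
  show ?thesis
    by (rule Bochner_Integration.integrable_bound[of _ "\<lambda>s. C * exp (- a * s\<^sup>2)"])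
      (use C integrable_gaussian_real[of a] gauss_dom_slice_measurable[OF assms(1)] gauss_domD(2)[OF assms(1)] in \<open>auto simp: less_imp_le\<close>)
qed

text \<open>Dominated convergence; the jump of the indicator at \<open>x $ i\<close> is a single point.\<close>

lemma continuous_partial_cdf_marg:
  fixes F :: "real^'n::finite \<Rightarrow> real"
  assumes "gauss_dom S F" "i \<in> S"
  shows "continuous_on UNIV (marg i F)" "continuous_on UNIV (partial_cdf i F)"
proof -
  obtain C a where C: "a > 0" "C > 0" "\<And>x s. F (upd x i s) \<le> C * exp (- a * s\<^sup>2)"
    using gauss_dom_slice_bound[OF assms] by metis
  note m[measurable] = gauss_dom_slice_measurable[OF assms(1)]
  have pos: "F x > 0" for x using gauss_domD(2)[OF assms(1)] .
  have int: "integrable lborel (\<lambda>s. C * exp (- a * s\<^sup>2))" using C integrable_gaussian_real[of a] by auto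
  have lim: "(\<lambda>n. F (upd (f n) i s)) \<longlonglongrightarrow> F (upd x i s)" if "f \<longlonglongrightarrow> x" for f x s
    by (rule continuous_on_tendsto_compose[OF gauss_domD(1)[OF assms(1)]]) (auto intro!: tendsto_intros that)
  show "continuous_on UNIV (marg i F)"
    unfolding continuous_on_sequentially marg_def comp_def
  proof safe
    fix f :: "nat \<Rightarrow> real^'n" and x assume f: "f \<longlonglongrightarrow> x"
    show "(\<lambda>n. LINT s|lborel. F (upd (f n) i s)) \<longlonglongrightarrow> (LINT s|lborel. F (upd x i s))"
      by (rule integral_dominated_convergence[OF _ _ int]) (use C lim[OF f] pos in \<open>auto simp: less_imp_le\<close>)
  qed
  show "continuous_on UNIV (partial_cdf i F)"
    unfolding continuous_on_sequentially partial_cdf_def comp_def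
  proof safe
    fix f :: "nat \<Rightarrow> real^'n" and x assume f: "f \<longlonglongrightarrow> x"
    have fi: "(\<lambda>n. f n $ i) \<longlonglongrightarrow> x $ i" using f by (rule tendsto_vec_nth)
    have AE: "AE s in lborel. (\<lambda>n. indicator {..f n $ i} s * F (upd (f n) i s)) \<longlonglongrightarrow> indicator {..x $ i} s * F (upd x i s)"
      using AE_lborel_singleton[of "x $ i"]
    proof eventually_elim
      case (elim s)
      have "(\<lambda>n. indicator {..f n $ i} s :: real) \<longlonglongrightarrow> indicator {..x $ i} s"
      proof (cases "s < x $ i")
        case True
        then have "\<forall>\<^sub>F n in sequentially. s < f n $ i" using fi order_tendstoD(1) by blast
        then have "\<forall>\<^sub>F n in sequentially. (indicator {..f n $ i} s :: real) = 1" by eventually_elim auto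
        then show ?thesis using True by (simp add: tendsto_eventually)
      next
        case False
        with elim have "s > x $ i" by auto
        then have "\<forall>\<^sub>F n in sequentially. s > f n $ i" using fi order_tendstoD(2) by blast
        then have "\<forall>\<^sub>F n in sequentially. (indicator {..f n $ i} s :: real) = 0" by eventually_elim auto
        then show ?thesis using False elim by (simp add: tendsto_eventually)
      qed
      then show ?case by (intro tendsto_intros lim f)
    qed
    show "(\<lambda>n. LINT s|lborel. indicator {..f n $ i} s * F (upd (f n) i s)) \<longlonglongrightarrow> (LINT s|lborel. indicator {..x $ i} s * F (upd x i s))"
      by (rule integral_dominated_convergence[OF _ _ int])
         (use C AE pos in \<open>auto simp: less_imp_le indicator_def\<close>)
  qed
qed

lemma partial_cdf_upd: "partial_cdf i F (upd x i r) = (LINT s|lborel. indicator {..r} s * F (upd x i s))"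
  by (simp add: partial_cdf_def)

lemma partial_cdf_has_derivative:
  assumes "gauss_dom S F" "i \<in> S"
  shows "((\<lambda>r. partial_cdf i F (upd x i r)) has_real_derivative F (upd x i r)) (at r)"
proof -
  let ?h = "\<lambda>s. F (upd x i s)"
  have ch: "continuous_on UNIV ?h"
    by (intro continuous_on_compose2[OF gauss_domD(1)[OF assms(1)]] continuous_intros) auto
  have ih: "integrable lborel ?h" by (rule gauss_dom_slice_integrable[OF assms])
  have si: "set_integrable lborel A ?h" if "A \<in> sets borel" for A
    using ih that unfolding set_integrable_def by (intro integrable_mult_indicator) auto
  have eq: "partial_cdf i F (upd x i t) = partial_cdf i F (upd x i (r - 1)) + integral {r-1..t} ?h" if "t \<ge> r - 1" for t
  proof -
    have "partial_cdf i F (upd x i t) = set_lebesgue_integral lborel ({..r-1} \<union> {r-1<..t}) ?h"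
      using that by (auto simp: partial_cdf_upd set_lebesgue_integral_def indicator_def intro!: Bochner_Integration.integral_cong)
    also have "\<dots> = set_lebesgue_integral lborel {..r-1} ?h + set_lebesgue_integral lborel {r-1<..t} ?h"
      by (rule set_integral_Un) (auto intro!: si)
    also have "set_lebesgue_integral lborel {r-1<..t} ?h = set_lebesgue_integral lborel {r-1..t} ?h"
      unfolding set_lebesgue_integral_def
      by (rule integral_cong_AE) (use AE_lborel_singleton[of "r-1"] gauss_dom_slice_measurable[OF assms(1)] in \<open>auto simp: indicator_def elim!: eventually_mono\<close>)
    also have "\<dots> = integral {r-1..t} ?h"
      by (rule set_borel_integral_eq_integral[OF si]) auto
    finally show ?thesis by (simp add: partial_cdf_upd set_lebesgue_integral_def)
  qed
  have "((\<lambda>t. integral {r-1..t} ?h) has_real_derivative ?h r) (at r within {r-1..r+1})"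
    by (rule integral_has_real_derivative) (auto intro: continuous_on_subset[OF ch])
  then have "((\<lambda>t. partial_cdf i F (upd x i (r - 1)) + integral {r-1..t} ?h) has_real_derivative ?h r) (at r within {r-1..r+1})"
    by (auto intro!: derivative_eq_intros)
  then have "((\<lambda>t. partial_cdf i F (upd x i (r - 1)) + integral {r-1..t} ?h) has_real_derivative ?h r) (at r)"
    by (subst (asm) at_within_interior) auto
  then show ?thesis
  proof (rule has_field_derivative_transform_within_open[where S="{r-1<..}"])
    show "partial_cdf i F (upd x i (r - 1)) + integral {r-1..t} ?h = partial_cdf i F (upd x i t)" if "t \<in> {r-1<..}" for t
      using eq[of t] that by auto
  qed auto
qed

lemma partial_cdf_limits:
  assumes "gauss_dom S F" "i \<in> S"
  shows "((\<lambda>r. partial_cdf i F (upd x i r)) \<longlongrightarrow> marg i F x) at_top" "((\<lambda>r. partial_cdf i F (upd x i r)) \<longlongrightarrow> 0) at_bot"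
proof -
  note [measurable] = gauss_dom_slice_measurable[OF assms(1)]
  have int: "integrable lborel (\<lambda>s. F (upd x i s))" by (rule gauss_dom_slice_integrable[OF assms])
  have pos: "F x > 0" for x using gauss_domD(2)[OF assms(1)] .
  show "((\<lambda>r. partial_cdf i F (upd x i r)) \<longlongrightarrow> marg i F x) at_top"
    unfolding marg_def partial_cdf_upd
  proof (rule integral_dominated_convergence_at_top[OF _ _ int])
    show "AE s in lborel. ((\<lambda>r. indicator {..r} s * F (upd x i s)) \<longlongrightarrow> F (upd x i s)) at_top"
    proof (rule AE_I2)
      fix s
      have "\<forall>\<^sub>F r in at_top. indicator {..r} s * F (upd x i s) = F (upd x i s)"
        using eventually_ge_at_top[of s] by eventually_elim auto
      then show "((\<lambda>r. indicator {..r} s * F (upd x i s)) \<longlongrightarrow> F (upd x i s)) at_top"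
        by (rule tendsto_eventually)
    qed
  qed (auto simp: indicator_def less_imp_le[OF pos])
  have "((\<lambda>r. partial_cdf i F (upd x i (-r))) \<longlongrightarrow> (LINT s|(lborel::real measure). 0)) at_top"
    unfolding partial_cdf_upd
  proof (rule integral_dominated_convergence_at_top[OF _ _ int])
    show "AE s in lborel. ((\<lambda>r. indicator {..-r} s * F (upd x i s)) \<longlongrightarrow> 0) at_top"
    proof (rule AE_I2)
      fix s
      have "\<forall>\<^sub>F r in at_top. indicator {..-r} s * F (upd x i s) = 0"
        using eventually_gt_at_top[of "-s"] by eventually_elim auto
      then show "((\<lambda>r. indicator {..-r} s * F (upd x i s)) \<longlongrightarrow> 0) at_top"
        by (rule tendsto_eventually)
    qed
  qed (auto simp: indicator_def less_imp_le[OF pos])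
  then show "((\<lambda>r. partial_cdf i F (upd x i r)) \<longlongrightarrow> 0) at_bot"
    by (simp add: filterlim_at_bot_mirror)
qed

lemma gauss_dom_marg:
  assumes "gauss_dom S F" "i \<in> S" shows "gauss_dom (S - {i}) (marg i F)"
  unfolding gauss_dom_def
proof (intro conjI allI impI)
  show "continuous_on UNIV (marg i F)" by (rule continuous_partial_cdf_marg[OF assms])
  note int = gauss_dom_slice_integrable[OF assms]
  have pos: "F x > 0" for x using gauss_domD(2)[OF assms(1)] .
  show "marg i F x > 0" for x
  proof -
    have lt: "partial_cdf i F (upd x i 0) < partial_cdf i F (upd x i 1)"
      using partial_cdf_has_derivative[OF assms, of x] pos
      by (intro DERIV_pos_imp_increasing[of 0 1 "\<lambda>r. partial_cdf i F (upd x i r)"]) (auto intro!: exI conjI)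
    have "0 \<le> partial_cdf i F (upd x i 0)" unfolding partial_cdf_upd
      by (intro Bochner_Integration.integral_nonneg) (auto simp: less_imp_le[OF pos])
    moreover have "partial_cdf i F (upd x i 1) \<le> marg i F x" unfolding partial_cdf_upd marg_def
      by (rule integral_mono[OF _ int])
        (use integrable_mult_indicator[of "{..1::real}" lborel, OF _ int] pos in \<open>auto simp: indicator_def less_imp_le\<close>)
    ultimately show ?thesis using lt by linarith
  qed
  show "marg i F (upd x j s) = marg i F x" if "j \<notin> S - {i}" for x j s
  proof (cases "j = i")
    case True then show ?thesis by (simp add: marg_def)
  next
    case False
    with that have "j \<notin> S" by auto
    then have "F (upd (upd x j s) i r) = F (upd x i r)" for r
      using False gauss_domD(3)[OF assms(1)] by (simp add: upd_swap[of j i])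
    then show ?thesis by (simp add: marg_def)
  qed
  obtain C a where C: "a > 0" "C > 0"
    "\<And>x s. F (upd x i s) \<le> C * exp (- a * (\<Sum>j\<in>S-{i}. (x $ j)\<^sup>2)) * exp (- a * s\<^sup>2)"
    using gauss_dom_slice_bound[OF assms] by metis
  have "marg i F x \<le> (C * (LINT s|lborel. exp (- a * s\<^sup>2))) * exp (- a * (\<Sum>j\<in>S-{i}. (x $ j)\<^sup>2))" for x
  proof -
    have "marg i F x \<le> (LINT s|lborel. C * exp (- a * (\<Sum>j\<in>S-{i}. (x $ j)\<^sup>2)) * exp (- a * s\<^sup>2))"
      unfolding marg_def
      by (rule integral_mono[OF int]) (use C integrable_gaussian_real[of a] in auto)
    then show ?thesis by (simp add: mult_ac)
  qed
  then show "\<exists>C a. 0 < a \<and> (\<forall>x. marg i F x \<le> C * exp (- a * (\<Sum>j\<in>S-{i}. (x $ j)\<^sup>2)))"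
    using C(1) by blast
qed

primrec margs :: "'n list \<Rightarrow> (real^'n::finite \<Rightarrow> real) \<Rightarrow> real^'n \<Rightarrow> real" where
  "margs [] F = F"
| "margs (i # l) F = marg i (margs l F)"

lemma gauss_dom_margs:
  assumes "gauss_dom UNIV F" "distinct l" shows "gauss_dom (- set l) (margs l F)"
  using assms(2)
proof (induction l)
  case Nil then show ?case using assms by simp
next
  case (Cons i l)
  then have "gauss_dom (- set l - {i}) (marg i (margs l F))" by (intro gauss_dom_marg) auto
  moreover have "- set l - {i} = - set (i # l)" by auto
  ultimately show ?case by simp
qed

text \<open>Lebesgue measure on \<open>real^'n\<close> is the image of the product measure indexed by \<open>'n\<close> itself, which is
  the form that the iterated marginals need.\<close>

lemma lborel_eq_distr_vec:
  "(lborel :: (real^'n::finite) measure) = distr (PiM UNIV (\<lambda>_. lborel)) borel (\<lambda>w. \<chi> j. w j)"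
proof (rule lborel_eqI)
  interpret product_sigma_finite "\<lambda>_::'n. lborel :: real measure" ..
  have m: "(\<lambda>w. \<chi> j. w j) \<in> measurable (PiM UNIV (\<lambda>_::'n. lborel::real measure)) (borel :: (real^'n) measure)"
    by (subst borel_measurable_euclidean_space) (auto simp: Basis_vec_def inner_axis intro!: measurable_component_singleton)
  fix l u :: "real^'n" assume le: "\<And>b. b \<in> Basis \<Longrightarrow> l \<bullet> b \<le> u \<bullet> b"
  have le': "l $ i \<le> u $ i" for i using le[of "axis i 1"] by (auto simp: inner_axis Basis_vec_def)
  have "emeasure (distr (PiM UNIV (\<lambda>_. lborel)) borel (\<lambda>w. \<chi> j. w j)) (box l u)
     = emeasure (PiM UNIV (\<lambda>_::'n. lborel::real measure)) (PiE UNIV (\<lambda>i. {l $ i <..< u $ i}))"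
    using m by (subst emeasure_distr) (auto intro!: arg_cong2[where f=emeasure] simp: mem_box_cart space_PiM PiE_iff)
  also have "\<dots> = (\<Prod>i\<in>UNIV. emeasure lborel {l $ i <..< u $ i})"
    by (rule emeasure_PiM) auto
  also have "\<dots> = ennreal (\<Prod>i\<in>UNIV. u $ i - l $ i)"
    using le' by (simp add: prod_ennreal)
  also have "(\<Prod>i\<in>UNIV. u $ i - l $ i) = (\<Prod>b\<in>Basis. (u - l) \<bullet> b)"
  proof -
    have B: "(Basis :: (real^'n) set) = (\<lambda>i. axis i 1) ` UNIV" by (auto simp: Basis_vec_def)
    show ?thesis unfolding B
      by (subst prod.reindex) (auto simp: inj_on_def axis_eq_axis inner_axis)
  qed
  finally show "emeasure (distr (PiM UNIV (\<lambda>_. lborel)) borel (\<lambda>w. \<chi> j. w j)) (box l u) = ennreal (\<Prod>b\<in>Basis. (u - l) \<bullet> b)" .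
qed auto

lemma margs_eq_nn_integral:
  assumes F: "gauss_dom UNIV F" and "distinct l"
  shows "ennreal (margs l F x) = (\<integral>\<^sup>+ w. ennreal (F (\<chi> j. if j \<in> set l then w j else x $ j)) \<partial>PiM (set l) (\<lambda>_. lborel))"
  using assms(2)
proof (induction l arbitrary: x)
  case Nil
  show ?case by (simp add: PiM_empty nn_integral_count_space_finite)
next
  case (Cons i l)
  interpret product_sigma_finite "\<lambda>_::'a. lborel :: real measure" ..
  have [measurable]: "F \<in> borel_measurable borel" using gauss_domD(1)[OF F] by (rule borel_measurable_continuous_onI)
  have m[measurable]: "(\<lambda>w. \<chi> j. if j = i \<or> j \<in> set l then w j else x $ j) \<in> borel_measurable (PiM (insert i (set l)) (\<lambda>_. lborel))"
  proof (subst borel_measurable_euclidean_space, intro ballI)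
    fix b :: "real^'a" assume "b \<in> Basis"
    then obtain k where b: "b = axis k 1" by (auto simp: Basis_vec_def)
    show "(\<lambda>w. (\<chi> j. if j = i \<or> j \<in> set l then w j else x $ j) \<bullet> b) \<in> borel_measurable (PiM (insert i (set l)) (\<lambda>_. lborel))"
      by (cases "k = i \<or> k \<in> set l") (auto simp: b inner_axis intro!: measurable_component_singleton)
  qed
  have g: "gauss_dom (- set l) (margs l F)" using gauss_dom_margs[OF F] Cons by auto
  have "ennreal (margs (i # l) F x) = (\<integral>\<^sup>+ s. ennreal (margs l F (upd x i s)) \<partial>lborel)"
    unfolding margs.simps marg_def
    by (rule nn_integral_eq_integral[symmetric])
      (use gauss_dom_slice_integrable[OF g] gauss_domD(2)[OF g] Cons.prems in \<open>auto simp: less_imp_le\<close>)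
  also have "\<dots> = (\<integral>\<^sup>+ s. (\<integral>\<^sup>+ w. ennreal (F (\<chi> j. if j \<in> set l then w j else upd x i s $ j)) \<partial>PiM (set l) (\<lambda>_. lborel)) \<partial>lborel)"
    using Cons by (intro nn_integral_cong) auto
  also have "\<dots> = (\<integral>\<^sup>+ s. (\<integral>\<^sup>+ w. ennreal (F (\<chi> j. if j \<in> set (i#l) then (w(i:=s)) j else x $ j)) \<partial>PiM (set l) (\<lambda>_. lborel)) \<partial>lborel)"
    using Cons.prems by (intro nn_integral_cong arg_cong[where f="\<lambda>v. ennreal (F v)"]) (auto simp: vec_eq_iff)
  also have "\<dots> = (\<integral>\<^sup>+ w. ennreal (F (\<chi> j. if j \<in> set (i#l) then w j else x $ j)) \<partial>PiM (insert i (set l)) (\<lambda>_. lborel))"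
    using Cons.prems by (subst product_nn_integral_insert_rev) auto
  finally show ?case by simp
qed

text \<open>The total mass is the common starting value of the Knothe construction for two densities of equal mass.\<close>

lemma margs_UNIV:
  assumes F: "gauss_dom UNIV F" and "distinct l" "set l = UNIV"
  shows "margs l F x = (LINT y|lborel. F y)" "integrable lborel F"
proof -
  have [measurable]: "F \<in> borel_measurable borel" using gauss_domD(1)[OF F] by (rule borel_measurable_continuous_onI)
  have m: "(\<lambda>w. \<chi> j. w j) \<in> measurable (PiM UNIV (\<lambda>_::'a. lborel::real measure)) (borel :: (real^'a) measure)"
    by (subst borel_measurable_euclidean_space) (auto simp: Basis_vec_def inner_axis intro!: measurable_component_singleton)
  have pos: "F x > 0" for x using gauss_domD(2)[OF F] .
  have "ennreal (margs l F x) = (\<integral>\<^sup>+ w. ennreal (F (\<chi> j. w j)) \<partial>PiM UNIV (\<lambda>_. lborel))"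
    using margs_eq_nn_integral[OF assms(1,2), of x] assms(3) by simp
  also have "\<dots> = (\<integral>\<^sup>+ y. ennreal (F y) \<partial>lborel)"
    by (subst lborel_eq_distr_vec, subst nn_integral_distr) (use m in auto)
  finally have e: "(\<integral>\<^sup>+ y. ennreal (F y) \<partial>lborel) = ennreal (margs l F x)" by simp
  have p: "margs l F x \<ge> 0" using gauss_dom_margs[OF F assms(2)] by (simp add: gauss_dom_def less_imp_le)
  show "integrable lborel F" "margs l F x = (LINT y|lborel. F y)"
    using p e integrableI_nn_integral_finite[of F lborel "margs l F x"]
      integral_eq_nn_integral[of F lborel] by (auto simp: less_imp_le[OF pos])
qed

section \<open>The Knothe map\<close>

text \<open>The quantile functions of the Knothe map are defined implicitly by a strictly monotone equation; a
  strict sign on either side of the root persists for nearby parameters.\<close>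

lemma continuous_implicit_strict_mono:
  fixes H :: "'a::topological_space \<Rightarrow> real \<Rightarrow> real"
  assumes cont: "\<And>s. continuous_on UNIV (\<lambda>x. H x s)" and mono: "\<And>x. strict_mono (H x)"
    and zero: "\<And>x. H x (\<tau> x) = 0"
  shows "continuous_on UNIV \<tau>"
proof -
  have "(\<tau> \<longlongrightarrow> \<tau> x) (at x)" for x
  proof (rule order_tendstoI)
    fix a assume "a < \<tau> x"
    then have "H x a < 0" using mono zero by (metis strict_mono_less)
    moreover have "((\<lambda>y. H y a) \<longlongrightarrow> H x a) (at x)"
      using cont[of a] by (simp add: continuous_on_def)
    ultimately have "\<forall>\<^sub>F y in at x. H y a < 0" by (rule order_tendstoD(2)[rotated])
    then show "\<forall>\<^sub>F y in at x. a < \<tau> y"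
      by eventually_elim (metis mono zero strict_mono_less)
  next
    fix a assume "\<tau> x < a"
    then have "0 < H x a" using mono zero by (metis strict_mono_less)
    moreover have "((\<lambda>y. H y a) \<longlongrightarrow> H x a) (at x)"
      using cont[of a] by (simp add: continuous_on_def)
    ultimately have "\<forall>\<^sub>F y in at x. 0 < H y a" by (rule order_tendstoD(1)[rotated])
    then show "\<forall>\<^sub>F y in at x. \<tau> y < a"
      by eventually_elim (metis mono zero strict_mono_less)
  qed
  then show ?thesis by (simp add: continuous_on_def)
qed

text \<open>Caratheodory's form of the derivative of \<open>A\<close> allows division by its slope function along the continuous
  \<open>\<tau>\<close>, which yields differentiability of \<open>\<tau>\<close> together with its derivative.\<close>

lemma DERIV_implicit:
  fixes A B \<tau> :: "real \<Rightarrow> real"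
  assumes eq: "\<And>r. A (\<tau> r) = B r" and A: "DERIV A (\<tau> r0) :> a" and a: "a \<noteq> 0"
    and B: "DERIV B r0 :> b" and \<tau>: "isCont \<tau> r0"
  shows "DERIV \<tau> r0 :> b / a"
proof -
  obtain g where g: "\<And>z. A z - A (\<tau> r0) = g z * (z - \<tau> r0)" "isCont g (\<tau> r0)" "g (\<tau> r0) = a"
    using A by (auto simp: CARAT_DERIV)
  have "(\<lambda>h. g (\<tau> (r0 + h))) \<midarrow>0\<rightarrow> g (\<tau> r0)"
  proof (rule isCont_tendsto_compose[OF g(2)])
    show "(\<lambda>h. \<tau> (r0 + h)) \<midarrow>0\<rightarrow> \<tau> r0" using \<tau> by (simp add: isCont_iff)
  qed
  then have gl: "(\<lambda>h. g (\<tau> (r0 + h))) \<midarrow>0\<rightarrow> a" using g(3) by simp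
  have Bl: "(\<lambda>h. (B (r0 + h) - B r0) / h) \<midarrow>0\<rightarrow> b" using B by (simp add: DERIV_def)
  have "(\<lambda>h. (B (r0 + h) - B r0) / h / g (\<tau> (r0 + h))) \<midarrow>0\<rightarrow> b / a"
    by (rule tendsto_divide[OF Bl gl a])
  moreover have "\<forall>\<^sub>F h in at 0. (B (r0 + h) - B r0) / h / g (\<tau> (r0 + h)) = (\<tau> (r0 + h) - \<tau> r0) / h"
  proof -
    have "\<forall>\<^sub>F h in at 0. g (\<tau> (r0 + h)) \<noteq> 0"
      using gl a by (rule tendsto_imp_eventually_ne)
    then show ?thesis
    proof eventually_elim
      case (elim h)
      have "B (r0 + h) - B r0 = g (\<tau> (r0 + h)) * (\<tau> (r0 + h) - \<tau> r0)"
        using g(1)[of "\<tau> (r0 + h)"] by (simp add: eq)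
      with elim show ?case by simp
    qed
  qed
  ultimately show ?thesis unfolding DERIV_def by (rule Lim_transform_eventually)
qed

text \<open>The state of the Knothe construction after treating the coordinates \<open>l1\<close>, with \<open>l2\<close> still to come.
  Only the components of \<open>T\<close> in \<open>l1\<close> have their final value, \<open>T\<close> ignores all other coordinates of its
  argument, and the last clause is the Jacobian equation for the marginals in which \<open>l2\<close> has been
  integrated out.\<close>

definition knothe_inv where
  "knothe_inv P R l1 l2 T D \<longleftrightarrow> continuous_on UNIV T \<and>
     (\<forall>i\<in>set l1. continuous_on UNIV (D i) \<and> (\<forall>x. D i x > 0 \<and>
        ((\<lambda>r. T (upd x i r) $ i) has_real_derivative D i x) (at (x $ i)))) \<and>
     (\<forall>x j s. j \<notin> set l1 \<longrightarrow> T (upd x j s) = T x) \<and>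
     (\<forall>m k x s. m < k \<longrightarrow> k < length l1 \<longrightarrow> T (upd x (l1 ! k) s) $ (l1 ! m) = T x $ (l1 ! m)) \<and>
     (\<forall>x. margs l2 P x = margs l2 R (T x) * (\<Prod>i\<in>set l1. D i x))"

lemma strict_mono_partial_cdf:
  assumes "gauss_dom S F" "i \<in> S" shows "strict_mono (\<lambda>s. partial_cdf i F (upd x i s))"
proof (rule strict_monoI)
  fix a b :: real assume "a < b"
  then show "partial_cdf i F (upd x i a) < partial_cdf i F (upd x i b)"
    using partial_cdf_has_derivative[OF assms, of x] gauss_domD(2)[OF assms(1)]
    by (intro DERIV_pos_imp_increasing[of a b "\<lambda>r. partial_cdf i F (upd x i r)"]) (auto intro!: exI conjI)
qed

lemma partial_cdf_bounds:
  assumes "gauss_dom S F" "i \<in> S"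
  shows "0 < partial_cdf i F x" "partial_cdf i F x < marg i F x"
proof -
  have sm: "strict_mono (\<lambda>s. partial_cdf i F (upd x i s))" by (rule strict_mono_partial_cdf[OF assms])
  have m: "mono (\<lambda>s. partial_cdf i F (upd x i s))" using sm by (rule strict_mono_mono)
  have "0 \<le> partial_cdf i F (upd x i (x $ i - 1))" unfolding partial_cdf_upd
    by (intro Bochner_Integration.integral_nonneg) (auto simp: less_imp_le[OF gauss_domD(2)[OF assms(1)]])
  also have "\<dots> < partial_cdf i F (upd x i (x $ i))" using strict_monoD[OF sm, of "x $ i - 1" "x $ i"] by simp
  finally show "0 < partial_cdf i F x" by simp
  have "partial_cdf i F (upd x i (x $ i)) < partial_cdf i F (upd x i (x $ i + 1))"
    using strict_monoD[OF sm, of "x $ i" "x $ i + 1"] by simp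
  also have "\<dots> \<le> marg i F x"
  proof (rule tendsto_lowerbound[OF partial_cdf_limits(1)[OF assms]])
    show "\<forall>\<^sub>F r in at_top. partial_cdf i F (upd x i (x $ i + 1)) \<le> partial_cdf i F (upd x i r)"
      using eventually_ge_at_top[of "x $ i + 1"] by eventually_elim (use m in \<open>auto simp: mono_def\<close>)
  qed simp
  finally show "partial_cdf i F x < marg i F x" by simp
qed

lemma partial_cdf_surj:
  assumes "gauss_dom S F" "i \<in> S" "0 < v" "v < 1"
  obtains s where "partial_cdf i F (upd y i s) / marg i F y = v"
proof -
  have mp: "marg i F y > 0" using gauss_dom_marg[OF assms(1,2)] by (rule gauss_domD(2))
  define w where "w = v * marg i F y"
  have w: "0 < w" "w < marg i F y" using assms mp by (auto simp: w_def)
  obtain a where a: "partial_cdf i F (upd y i a) < w"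
    using order_tendstoD(2)[OF partial_cdf_limits(2)[OF assms(1,2), of y] w(1)]
    by (auto simp: eventually_at_bot_linorder)
  obtain b where b: "partial_cdf i F (upd y i b) > w"
    using order_tendstoD(1)[OF partial_cdf_limits(1)[OF assms(1,2), of y] w(2)]
    by (auto simp: eventually_at_top_linorder)
  have ab: "a \<le> b" using a b strict_mono_partial_cdf[OF assms(1,2), of y]
    by (meson less_le_trans linear order.strict_trans not_less strict_mono_less_eq)
  have "\<exists>s\<ge>a. s \<le> b \<and> partial_cdf i F (upd y i s) = w"
    using a b ab partial_cdf_has_derivative[OF assms(1,2), of y]
    by (intro IVT) (auto intro: DERIV_isCont)
  then obtain s where "partial_cdf i F (upd y i s) = v * marg i F y" by (auto simp: w_def)
  with mp have "partial_cdf i F (upd y i s) / marg i F y = v" by simp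
  then show thesis by (rule that)
qed

text \<open>The next component \<open>\<tau>\<close> matches the conditional distribution functions of coordinate \<open>i\<close>, given the
  coordinates already treated. Differentiating the matching equation produces the new factor \<open>E\<close> of the
  Jacobian, a quotient of conditional densities.\<close>

lemma knothe_step:
  fixes P R :: "real^'n::finite \<Rightarrow> real"
  assumes P: "gauss_dom UNIV P" and R: "gauss_dom UNIV R" and d: "distinct (l1 @ i # l2)" "set (l1 @ i # l2) = UNIV"
    and inv: "knothe_inv P R l1 (i # l2) T D"
  shows "\<exists>T D. knothe_inv P R (l1 @ [i]) l2 T D"
proof -
  define p where "p = margs l2 P"
  define r where "r = margs l2 R"
  define S where "S = - set l2"
  have gp: "gauss_dom S p" and gr: "gauss_dom S r" unfolding p_def r_def S_def using P R d by (auto intro: gauss_dom_margs)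
  have iS: "i \<in> S" using d by (auto simp: S_def)
  have gmp: "gauss_dom (S - {i}) (marg i p)" and gmr: "gauss_dom (S - {i}) (marg i r)"
    using gauss_dom_marg gp gr iS by auto
  have ppos: "p x > 0" "marg i p x > 0" "r x > 0" "marg i r x > 0" for x
    using gauss_domD(2) gp gr gmp gmr by auto
  have Tc: "continuous_on UNIV T"
    and Dc: "\<And>j. j \<in> set l1 \<Longrightarrow> continuous_on UNIV (D j)"
    and Dp: "\<And>j x. j \<in> set l1 \<Longrightarrow> D j x > 0"
    and Dd: "\<And>j x. j \<in> set l1 \<Longrightarrow> ((\<lambda>r. T (upd x j r) $ j) has_real_derivative D j x) (at (x $ j))"
    and Ti: "\<And>x j s. j \<notin> set l1 \<Longrightarrow> T (upd x j s) = T x"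
    and Tt: "\<And>m k x s. m < k \<Longrightarrow> k < length l1 \<Longrightarrow> T (upd x (l1 ! k) s) $ (l1 ! m) = T x $ (l1 ! m)"
    and MA: "\<And>x. marg i p x = marg i r (T x) * (\<Prod>j\<in>set l1. D j x)"
    using inv by (auto simp: knothe_inv_def p_def r_def)
  have i1: "i \<notin> set l1" using d by auto
  define A where "A = (\<lambda>y s. partial_cdf i r (upd y i s) / marg i r y)"
  define B where "B = (\<lambda>x. partial_cdf i p x / marg i p x)"
  define \<tau> where "\<tau> = (\<lambda>x. SOME s. A (T x) s = B x)"
  have B01: "0 < B x" "B x < 1" for x
    using partial_cdf_bounds[OF gp iS, of x] ppos by (auto simp: B_def)
  have \<tau>: "A (T x) (\<tau> x) = B x" for x
    unfolding \<tau>_def by (rule someI_ex) (use partial_cdf_surj[OF gr iS B01(1,2)[of x], of "T x"] in \<open>auto simp: A_def\<close>)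
  have Amono: "strict_mono (A y)" for y
    using strict_mono_partial_cdf[OF gr iS, of y] ppos by (auto simp: A_def strict_mono_def divide_strict_right_mono)
  have cTi: "continuous_on UNIV (\<lambda>x. F (T x))" if "continuous_on UNIV F" for F :: "real^'n \<Rightarrow> real"
    by (rule continuous_on_compose2[OF that Tc]) auto
  have \<tau>c: "continuous_on UNIV \<tau>"
  proof (rule continuous_implicit_strict_mono[where H="\<lambda>x s. A (T x) s - B x"])
    show "continuous_on UNIV (\<lambda>x. A (T x) s - B x)" for s
      unfolding A_def B_def
      using ppos by (intro continuous_intros cTi continuous_partial_cdf_marg[OF gp iS] continuous_partial_cdf_marg[OF gr iS]
          continuous_on_compose2[OF continuous_partial_cdf_marg(2)[OF gr iS]] Tc)
        (auto simp: less_imp_neq[THEN not_sym])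
    show "strict_mono (\<lambda>s. A (T x) s - B x)" for x using Amono[of "T x"] by (auto simp: strict_mono_def)
  qed (simp add: \<tau>)
  define T' where "T' = (\<lambda>x. upd (T x) i (\<tau> x))"
  define E where "E = (\<lambda>x. (p x / marg i p x) / (r (T' x) / marg i r (T x)))"
  define D' where "D' = (\<lambda>j. if j = i then E else D j)"
  have T'c: "continuous_on UNIV T'" unfolding T'_def by (intro continuous_intros Tc \<tau>c)
  have Ec: "continuous_on UNIV E"
    unfolding E_def using ppos
    by (intro continuous_intros continuous_on_compose2[OF gauss_domD(1)[OF gr] T'c] gauss_domD(1)[OF gp]
        gauss_domD(1)[OF gmp] cTi[OF gauss_domD(1)[OF gmr]]) (auto simp: less_imp_neq[THEN not_sym])
  have Ep: "E x > 0" for x using ppos by (auto simp: E_def)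
  have Bi: "B (upd x i t) = partial_cdf i p (upd x i t) / marg i p x" for x t
    using gauss_domD(3)[OF gmp, of i x t] by (simp add: B_def)
  have Ed: "((\<lambda>t. \<tau> (upd x i t)) has_real_derivative E x) (at (x $ i))" for x
    unfolding E_def
  proof (rule DERIV_implicit[where A="A (T x)" and B="\<lambda>t. B (upd x i t)"])
    show "A (T x) (\<tau> (upd x i t)) = B (upd x i t)" for t using \<tau>[of "upd x i t"] Ti[OF i1] by simp
    show "DERIV (A (T x)) (\<tau> (upd x i (x $ i))) :> r (T' x) / marg i r (T x)"
      unfolding A_def T'_def
      using DERIV_cdivide[OF partial_cdf_has_derivative[OF gr iS, of "T x" "\<tau> x"], of "marg i r (T x)"] by simp
    show "r (T' x) / marg i r (T x) \<noteq> 0" using ppos by (simp add: less_imp_neq[THEN not_sym])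
    show "DERIV (\<lambda>t. B (upd x i t)) (x $ i) :> p x / marg i p x"
      unfolding Bi
      using DERIV_cdivide[OF partial_cdf_has_derivative[OF gp iS, of x "x $ i"], of "marg i p x"] by simp
    have "continuous_on UNIV (\<lambda>t. \<tau> (upd x i t))"
      by (intro continuous_on_compose2[OF \<tau>c] continuous_intros) auto
    then show "isCont (\<lambda>t. \<tau> (upd x i t)) (x $ i)" by (simp add: continuous_on_eq_continuous_at)
  qed
  have \<tau>i: "\<tau> (upd x j s) = \<tau> x" if "j \<notin> set l1" "j \<noteq> i" "j \<in> set l2" for x j s
  proof -
    have jS: "j \<notin> S" using that by (auto simp: S_def)
    have "partial_cdf i p (upd x j s) = partial_cdf i p x"
      using gauss_domD(3)[OF gp jS] that(2) by (simp add: partial_cdf_def upd_swap[of j i])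
    moreover have "marg i p (upd x j s) = marg i p x" using gauss_domD(3)[OF gmp] jS by auto
    ultimately have "B (upd x j s) = B x" by (simp add: B_def)
    then show ?thesis using Ti[OF that(1)] by (simp add: \<tau>_def)
  qed
  have "knothe_inv P R (l1 @ [i]) l2 T' D'"
    unfolding knothe_inv_def
  proof (intro conjI ballI allI impI)
    show "continuous_on UNIV T'" by fact
    show "continuous_on UNIV (D' j)" if "j \<in> set (l1 @ [i])" for j
      using that Ec Dc by (auto simp: D'_def)
    show "D' j x > 0" if "j \<in> set (l1 @ [i])" for j x
      using that Ep Dp by (auto simp: D'_def)
    show "((\<lambda>r. T' (upd x j r) $ j) has_real_derivative D' j x) (at (x $ j))" if "j \<in> set (l1 @ [i])" for j x
      using that Ed Dd i1 by (cases "j = i") (auto simp: D'_def T'_def)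
    show "margs l2 P x = margs l2 R (T' x) * (\<Prod>j\<in>set (l1 @ [i]). D' j x)" for x
    proof -
      have "(\<Prod>j\<in>set (l1 @ [i]). D' j x) = E x * (\<Prod>j\<in>set l1. D j x)"
        using i1 by (auto simp: D'_def intro!: prod.cong)
      then have "r (T' x) * (\<Prod>j\<in>set (l1 @ [i]). D' j x) = p x / marg i p x * (marg i r (T x) * (\<Prod>j\<in>set l1. D j x))"
        using ppos(3)[of "T' x"] by (simp add: E_def)
      also have "\<dots> = p x" unfolding MA[symmetric] using ppos(2)[of x] by simp
      finally show ?thesis by (simp add: p_def r_def)
    qed
    show "T' (upd x ((l1 @ [i]) ! k) s) $ ((l1 @ [i]) ! m) = T' x $ ((l1 @ [i]) ! m)"
      if "m < k" "k < length (l1 @ [i])" for m k x s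
    proof (cases "k < length l1")
      case True
      then have "l1 ! m \<noteq> i" "l1 ! k \<noteq> i" using i1 that nth_mem[of m l1] nth_mem[of k l1] by auto
      then show ?thesis using True that Tt[of m k] by (simp add: T'_def nth_append)
    next
      case False
      then have k: "k = length l1" using that by auto
      then have "l1 ! m \<noteq> i" using i1 that nth_mem[of m l1] by auto
      then show ?thesis using that k Ti[OF i1] by (simp add: T'_def nth_append)
    qed
    show "T' (upd x j s) = T' x" if "j \<notin> set (l1 @ [i])" for x j s
    proof -
      have "j \<in> set l2" using that d(2) by auto
      then show ?thesis using that \<tau>i Ti by (auto simp: T'_def)
    qed
  qed
  then show ?thesis by blast
qed

text \<open>The product of the diagonal derivatives \<open>D i\<close> is the Jacobian determinant of a triangular map, so the
  last clause is the Jacobian equation. Triangularity is recorded in a symmetric form that does not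
  mention the chosen order of the coordinates.\<close>

theorem knothe_map_exists:
  fixes P R :: "real^'n::finite \<Rightarrow> real"
  assumes P: "gauss_dom UNIV P" and R: "gauss_dom UNIV R" and eq: "(LINT x|lborel. P x) = (LINT x|lborel. R x)"
  obtains T :: "real^'n \<Rightarrow> real^'n" and D :: "'n \<Rightarrow> real^'n \<Rightarrow> real" where
    "continuous_on UNIV T" "\<And>i. continuous_on UNIV (D i)" "\<And>i x. D i x > 0"
    "\<And>i x. ((\<lambda>r. T (upd x i r) $ i) has_real_derivative D i x) (at (x $ i))"
    "\<And>i j. i \<noteq> j \<Longrightarrow> (\<forall>x s. T (upd x j s) $ i = T x $ i) \<or> (\<forall>x s. T (upd x i s) $ j = T x $ j)"
    "\<And>x. P x = R (T x) * (\<Prod>i\<in>UNIV. D i x)"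
proof -
  obtain l :: "'n list" where l: "distinct l" "set l = UNIV"
    using finite_distinct_list[of "UNIV :: 'n set"] by auto
  have main: "\<exists>T D. knothe_inv P R l1 l2 T D" if "l1 @ l2 = l" for l1 l2
    using that
  proof (induction l1 arbitrary: l2 rule: rev_induct)
    case Nil
    have "knothe_inv P R [] l2 (\<lambda>_. 0) (\<lambda>_ _. 1)"
      using Nil l margs_UNIV[OF P] margs_UNIV[OF R] eq by (auto simp: knothe_inv_def)
    then show ?case by blast
  next
    case (snoc i l1)
    then obtain T D where "knothe_inv P R l1 (i # l2) T D" by fastforce
    then show ?case using knothe_step[OF P R, of l1 i l2] l snoc.prems by auto
  qed
  then obtain T D where inv: "knothe_inv P R l [] T D" by fastforce
  have tri: "(\<forall>x s. T (upd x j s) $ i = T x $ i) \<or> (\<forall>x s. T (upd x i s) $ j = T x $ j)" if "i \<noteq> j" for i j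
  proof -
    obtain m k where mk: "m < length l" "l ! m = i" "k < length l" "l ! k = j"
      using l(2) by (metis UNIV_I in_set_conv_nth)
    then have "m \<noteq> k" using that by auto
    then consider "m < k" | "k < m" by linarith
    then show ?thesis using inv mk unfolding knothe_inv_def by cases blast+
  qed
  show thesis
    by (rule that[of T D]) (use inv tri l(2) in \<open>auto simp: knothe_inv_def\<close>)
qed

section \<open>Almost everywhere derivatives along the axes and integration by parts\<close>

text \<open>A weak notion of partial derivative that suits both the components of the Knothe map, where the
  \<open>i\<close>-th one is differentiated along the \<open>i\<close>-th axis, and semiconcave functions such as the Hopf--Lax semigroup:
  derivative almost everywhere, plus a Lipschitz bound along the axis that is uniform on balls and
  dominates the difference quotients.\<close>

definition axis_deriv :: "'n::finite \<Rightarrow> (real^'n \<Rightarrow> real) \<Rightarrow> (real^'n \<Rightarrow> real) \<Rightarrow> bool" where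
  "axis_deriv i f g \<longleftrightarrow> continuous_on UNIV f \<and> g \<in> borel_measurable borel \<and>
     (\<forall>R. \<exists>L. \<forall>x h. norm x \<le> R \<longrightarrow> \<bar>h\<bar> \<le> 1 \<longrightarrow> \<bar>f (upd x i (x $ i + h)) - f x\<bar> \<le> L * \<bar>h\<bar>) \<and>
     (AE x in lborel. ((\<lambda>s. f (upd x i s)) has_real_derivative g x) (at (x $ i)))"

lemma bounded_on_cball:
  fixes f :: "real^'n::finite \<Rightarrow> real"
  assumes "continuous_on UNIV f"
  obtains M where "M \<ge> 0" "\<And>x. norm x \<le> R \<Longrightarrow> \<bar>f x\<bar> \<le> M"
proof -
  have "bounded (f ` cball 0 R)"
    by (intro compact_imp_bounded compact_continuous_image continuous_on_subset[OF assms]) auto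
  then obtain M where "M > 0" "\<And>x. x \<in> cball 0 R \<Longrightarrow> norm (f x) \<le> M"
    by (auto simp: bounded_pos)
  then show thesis using that[of M] by auto
qed

lemma norm_upd_le: "norm x \<le> R \<Longrightarrow> \<bar>h\<bar> \<le> 1 \<Longrightarrow> norm (upd x i (x $ i + h)) \<le> R + 1"
  unfolding add_axis_eq_upd[symmetric] using norm_triangle_ineq[of x "h *\<^sub>R axis i 1"] by simp

lemma axis_derivD:
  assumes "axis_deriv i f g"
  shows "continuous_on UNIV f" "g \<in> borel_measurable borel"
    "AE x in lborel. ((\<lambda>s. f (upd x i s)) has_real_derivative g x) (at (x $ i))"
    "f \<in> borel_measurable borel"
  using assms by (auto simp: axis_deriv_def intro: borel_measurable_continuous_onI)

lemma axis_deriv_lipschitz: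
  assumes "axis_deriv i f g"
  obtains L where "L \<ge> 0" "\<And>x h. norm x \<le> R \<Longrightarrow> \<bar>h\<bar> \<le> 1 \<Longrightarrow> \<bar>f (upd x i (x $ i + h)) - f x\<bar> \<le> L * \<bar>h\<bar>"
proof -
  obtain L where L: "\<And>x h. norm x \<le> R \<Longrightarrow> \<bar>h\<bar> \<le> 1 \<Longrightarrow> \<bar>f (upd x i (x $ i + h)) - f x\<bar> \<le> L * \<bar>h\<bar>"
    using assms unfolding axis_deriv_def by blast
  have "\<bar>f (upd x i (x $ i + h)) - f x\<bar> \<le> \<bar>L\<bar> * \<bar>h\<bar>" if "norm x \<le> R" "\<bar>h\<bar> \<le> 1" for x h
    using L[OF that] by (smt (verit) abs_ge_self mult_right_mono abs_ge_zero)
  then show thesis by (intro that[of "\<bar>L\<bar>"]) auto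
qed

text \<open>The mean value theorem turns a bound of the derivative on the larger ball into the Lipschitz bound.\<close>

lemma axis_deriv_C1:
  fixes f g :: "real^'n::finite \<Rightarrow> real"
  assumes f: "continuous_on UNIV f" and g: "continuous_on UNIV g"
    and d: "\<And>x. ((\<lambda>s. f (upd x i s)) has_real_derivative g x) (at (x $ i))"
  shows "axis_deriv i f g"
proof -
  have "\<exists>L. \<forall>x h. norm x \<le> R \<longrightarrow> \<bar>h\<bar> \<le> 1 \<longrightarrow> \<bar>f (upd x i (x $ i + h)) - f x\<bar> \<le> L * \<bar>h\<bar>" for R
  proof -
    obtain M where M: "M \<ge> 0" "\<And>x. norm x \<le> R + 1 \<Longrightarrow> \<bar>g x\<bar> \<le> M"
      using bounded_on_cball[OF g] by blast
    have "\<bar>f (upd x i (x $ i + h)) - f x\<bar> \<le> M * \<bar>h\<bar>" if "norm x \<le> R" "\<bar>h\<bar> \<le> 1" for x h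
    proof -
      have "norm (f (upd x i (x $ i + h)) - f (upd x i (x $ i))) \<le> M * norm ((x $ i + h) - x $ i)"
      proof (rule field_differentiable_bound[where S="{x $ i - \<bar>h\<bar>..x $ i + \<bar>h\<bar>}" and f'="\<lambda>s. g (upd x i s)"])
        fix s assume s: "s \<in> {x $ i - \<bar>h\<bar>..x $ i + \<bar>h\<bar>}"
        show "((\<lambda>s. f (upd x i s)) has_field_derivative g (upd x i s)) (at s within {x $ i - \<bar>h\<bar>..x $ i + \<bar>h\<bar>})"
          using d[of "upd x i s"] by (auto intro: has_field_derivative_at_within)
        have "\<bar>s - x $ i\<bar> \<le> 1" using s that by auto
        then have "norm (upd x i s) \<le> R + 1" using norm_upd_le[OF that(1), of "s - x $ i" i] by simp
        then show "norm (g (upd x i s)) \<le> M" using M by auto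
      qed auto
      then show ?thesis by simp
    qed
    then show ?thesis by blast
  qed
  then show ?thesis using assms by (auto simp: axis_deriv_def intro: borel_measurable_continuous_onI)
qed

lemma axis_deriv_mult:
  assumes f: "axis_deriv i f g" and f': "axis_deriv i f' g'"
  shows "axis_deriv i (\<lambda>x. f x * f' x) (\<lambda>x. g x * f' x + f x * g' x)"
  unfolding axis_deriv_def
proof (intro conjI allI)
  note [measurable] = axis_derivD(2,4)[OF f] axis_derivD(2,4)[OF f']
  show "continuous_on UNIV (\<lambda>x. f x * f' x)"
    by (intro continuous_intros axis_derivD(1)[OF f] axis_derivD(1)[OF f'])
  show "(\<lambda>x. g x * f' x + f x * g' x) \<in> borel_measurable borel" by measurable
  show "AE x in lborel. ((\<lambda>s. f (upd x i s) * f' (upd x i s)) has_real_derivative g x * f' x + f x * g' x) (at (x $ i))"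
    using axis_derivD(3)[OF f] axis_derivD(3)[OF f']
    by eventually_elim (auto intro!: derivative_eq_intros)
  fix R
  obtain L where L: "L \<ge> 0" "\<And>x h. norm x \<le> R \<Longrightarrow> \<bar>h\<bar> \<le> 1 \<Longrightarrow> \<bar>f (upd x i (x $ i + h)) - f x\<bar> \<le> L * \<bar>h\<bar>"
    using axis_deriv_lipschitz[OF f] by blast
  obtain L' where L': "L' \<ge> 0" "\<And>x h. norm x \<le> R \<Longrightarrow> \<bar>h\<bar> \<le> 1 \<Longrightarrow> \<bar>f' (upd x i (x $ i + h)) - f' x\<bar> \<le> L' * \<bar>h\<bar>"
    using axis_deriv_lipschitz[OF f'] by blast
  obtain M where M: "M \<ge> 0" "\<And>x. norm x \<le> R + 1 \<Longrightarrow> \<bar>f x\<bar> \<le> M"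
    using bounded_on_cball[OF axis_derivD(1)[OF f]] by blast
  obtain M' where M': "M' \<ge> 0" "\<And>x. norm x \<le> R + 1 \<Longrightarrow> \<bar>f' x\<bar> \<le> M'"
    using bounded_on_cball[OF axis_derivD(1)[OF f']] by blast
  have "\<bar>f (upd x i (x $ i + h)) * f' (upd x i (x $ i + h)) - f x * f' x\<bar> \<le> (L * M' + M * L') * \<bar>h\<bar>"
    if "norm x \<le> R" "\<bar>h\<bar> \<le> 1" for x h
  proof -
    let ?y = "upd x i (x $ i + h)"
    have "f ?y * f' ?y - f x * f' x = (f ?y - f x) * f' ?y + f x * (f' ?y - f' x)" by (simp add: algebra_simps)
    then have "\<bar>f ?y * f' ?y - f x * f' x\<bar> \<le> \<bar>f ?y - f x\<bar> * \<bar>f' ?y\<bar> + \<bar>f x\<bar> * \<bar>f' ?y - f' x\<bar>"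
      by (metis abs_mult abs_triangle_ineq)
    also have "\<dots> \<le> (L * \<bar>h\<bar>) * M' + M * (L' * \<bar>h\<bar>)"
      using that L L' M M' norm_upd_le[OF that] by (intro add_mono mult_mono) auto
    finally show ?thesis by (simp add: algebra_simps)
  qed
  then show "\<exists>L. \<forall>x h. norm x \<le> R \<longrightarrow> \<bar>h\<bar> \<le> 1 \<longrightarrow> \<bar>f (upd x i (x $ i + h)) * f' (upd x i (x $ i + h)) - f x * f' x\<bar> \<le> L * \<bar>h\<bar>"
    by blast
qed

lemma axis_deriv_add:
  assumes f: "axis_deriv i f g" and f': "axis_deriv i f' g'"
  shows "axis_deriv i (\<lambda>x. f x + f' x) (\<lambda>x. g x + g' x)"
  unfolding axis_deriv_def
proof (intro conjI allI)
  note [measurable] = axis_derivD(2,4)[OF f] axis_derivD(2,4)[OF f']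
  show "continuous_on UNIV (\<lambda>x. f x + f' x)"
    by (intro continuous_intros axis_derivD(1)[OF f] axis_derivD(1)[OF f'])
  show "(\<lambda>x. g x + g' x) \<in> borel_measurable borel" by measurable
  show "AE x in lborel. ((\<lambda>s. f (upd x i s) + f' (upd x i s)) has_real_derivative g x + g' x) (at (x $ i))"
    using axis_derivD(3)[OF f] axis_derivD(3)[OF f']
    by eventually_elim (auto intro!: derivative_eq_intros)
  fix R
  obtain L where L: "L \<ge> 0" "\<And>x h. norm x \<le> R \<Longrightarrow> \<bar>h\<bar> \<le> 1 \<Longrightarrow> \<bar>f (upd x i (x $ i + h)) - f x\<bar> \<le> L * \<bar>h\<bar>"
    using axis_deriv_lipschitz[OF f] by blast
  obtain L' where L': "L' \<ge> 0" "\<And>x h. norm x \<le> R \<Longrightarrow> \<bar>h\<bar> \<le> 1 \<Longrightarrow> \<bar>f' (upd x i (x $ i + h)) - f' x\<bar> \<le> L' * \<bar>h\<bar>"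
    using axis_deriv_lipschitz[OF f'] by blast
  have "\<bar>f (upd x i (x $ i + h)) + f' (upd x i (x $ i + h)) - (f x + f' x)\<bar> \<le> (L + L') * \<bar>h\<bar>"
    if "norm x \<le> R" "\<bar>h\<bar> \<le> 1" for x h
    using L(2)[OF that] L'(2)[OF that] by (simp add: algebra_simps)
  then show "\<exists>L. \<forall>x h. norm x \<le> R \<longrightarrow> \<bar>h\<bar> \<le> 1 \<longrightarrow> \<bar>f (upd x i (x $ i + h)) + f' (upd x i (x $ i + h)) - (f x + f' x)\<bar> \<le> L * \<bar>h\<bar>"
    by blast
qed

lemma axis_deriv_exp:
  assumes f: "axis_deriv i f g"
  shows "axis_deriv i (\<lambda>x. exp (f x)) (\<lambda>x. exp (f x) * g x)"
  unfolding axis_deriv_def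
proof (intro conjI allI)
  note [measurable] = axis_derivD(2,4)[OF f]
  show "continuous_on UNIV (\<lambda>x. exp (f x))"
    by (intro continuous_intros axis_derivD(1)[OF f])
  show "(\<lambda>x. exp (f x) * g x) \<in> borel_measurable borel" by measurable
  show "AE x in lborel. ((\<lambda>s. exp (f (upd x i s))) has_real_derivative exp (f x) * g x) (at (x $ i))"
    using axis_derivD(3)[OF f] by eventually_elim (auto intro!: derivative_eq_intros)
  fix R
  obtain L where L: "L \<ge> 0" "\<And>x h. norm x \<le> R \<Longrightarrow> \<bar>h\<bar> \<le> 1 \<Longrightarrow> \<bar>f (upd x i (x $ i + h)) - f x\<bar> \<le> L * \<bar>h\<bar>"
    using axis_deriv_lipschitz[OF f] by blast
  obtain M where M: "M \<ge> 0" "\<And>x. norm x \<le> R + 1 \<Longrightarrow> \<bar>f x\<bar> \<le> M"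
    using bounded_on_cball[OF axis_derivD(1)[OF f]] by blast
  have expl: "\<bar>exp a - exp b\<bar> \<le> exp M * \<bar>a - b\<bar>" if "\<bar>a\<bar> \<le> M" "\<bar>b\<bar> \<le> M" for a b
  proof -
    have "norm (exp a - exp b) \<le> exp M * norm (a - b)"
      by (rule field_differentiable_bound[where S="{-M..M}" and f'=exp]) (use that in \<open>auto intro!: derivative_eq_intros\<close>)
    then show ?thesis by simp
  qed
  have "\<bar>exp (f (upd x i (x $ i + h))) - exp (f x)\<bar> \<le> (exp M * L) * \<bar>h\<bar>"
    if "norm x \<le> R" "\<bar>h\<bar> \<le> 1" for x h
  proof -
    have "\<bar>exp (f (upd x i (x $ i + h))) - exp (f x)\<bar> \<le> exp M * \<bar>f (upd x i (x $ i + h)) - f x\<bar>"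
      using that norm_upd_le[OF that] by (intro expl M) auto
    also have "\<dots> \<le> exp M * (L * \<bar>h\<bar>)" using L(2)[OF that] by (intro mult_left_mono) auto
    finally show ?thesis by (simp add: mult_ac)
  qed
  then show "\<exists>L. \<forall>x h. norm x \<le> R \<longrightarrow> \<bar>h\<bar> \<le> 1 \<longrightarrow> \<bar>exp (f (upd x i (x $ i + h))) - exp (f x)\<bar> \<le> L * \<bar>h\<bar>"
    by blast
qed

lemma lborel_translate_integral:
  fixes f :: "'a::euclidean_space \<Rightarrow> real"
  assumes "integrable lborel f"
  shows "integrable lborel (\<lambda>x. f (x + t))" "(LINT x|lborel. f (x + t)) = (LINT x|lborel. f x)"
proof -
  have e: "distr lborel borel (\<lambda>x::'a. x + t) = lborel"
  proof -
    have "(+) t = (\<lambda>x. x + t)" by (auto simp: add.commute)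
    then show ?thesis using lborel_distr_plus[of t] by simp
  qed
  have [measurable]: "f \<in> borel_measurable borel" using assms by auto
  from assms have "integrable (distr lborel borel (\<lambda>x::'a. x + t)) f" by (simp add: e)
  then show "integrable lborel (\<lambda>x. f (x + t))" by (rule integrable_distr[rotated]) auto
  have "(LINT x|distr lborel borel (\<lambda>x::'a. x + t). f x) = (LINT x|lborel. f (x + t))"
    by (intro integral_distr) auto
  then show "(LINT x|lborel. f (x + t)) = (LINT x|lborel. f x)" by (simp add: e)
qed

lemma integrable_bounded_support:
  fixes f :: "real^'n::finite \<Rightarrow> real"
  assumes "f \<in> borel_measurable borel" "\<And>x. \<bar>f x\<bar> \<le> M * indicator (cball 0 R) x"
  shows "integrable lborel f"
proof (rule Bochner_Integration.integrable_bound)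
  have "emeasure lborel (cball (0::real^'n) R) < \<infinity>" by (intro emeasure_bounded_finite) auto
  then show "integrable lborel (\<lambda>x::real^'n. M * indicator (cball 0 R) x)" by auto
qed (use assms in \<open>auto intro!: AE_I2 order_trans[OF assms(2)]\<close>)

text \<open>By translation invariance every difference quotient of \<open>w\<close> has integral zero; the quotients converge
  to \<open>g\<close> and are dominated on a ball.\<close>

lemma integral_axis_deriv_eq_0:
  assumes w: "axis_deriv i w g" and supp: "\<And>x. norm x > R \<Longrightarrow> w x = 0"
  shows "integrable lborel g" "(LINT x|lborel. g x) = 0"
proof -
  note [measurable] = axis_derivD(2,4)[OF w]
  obtain L where L: "L \<ge> 0" "\<And>x h. norm x \<le> R + 1 \<Longrightarrow> \<bar>h\<bar> \<le> 1 \<Longrightarrow> \<bar>w (upd x i (x $ i + h)) - w x\<bar> \<le> L * \<bar>h\<bar>"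
    using axis_deriv_lipschitz[OF w, of "R + 1"] by blast
  obtain M where M: "M \<ge> 0" "\<And>x. norm x \<le> R \<Longrightarrow> \<bar>w x\<bar> \<le> M"
    using bounded_on_cball[OF axis_derivD(1)[OF w]] by blast
  define h where "h = (\<lambda>n::nat. inverse (real (Suc n)))"
  have h: "h n > 0" "h n \<le> 1" for n by (auto simp: h_def field_simps)
  have h0: "h \<longlonglongrightarrow> 0" unfolding h_def by (rule LIMSEQ_inverse_real_of_nat)
  have wint: "integrable lborel w"
    by (rule integrable_bounded_support[of _ M R]) (use M supp in \<open>auto simp: indicator_def not_le\<close>)
  define q where "q = (\<lambda>n x. (w (x + h n *\<^sub>R axis i 1) - w x) / h n)"
  have [measurable]: "q n \<in> borel_measurable borel" for n unfolding q_def by measurable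
  have q0: "(LINT x|lborel. q n x) = 0" for n
    unfolding q_def using wint lborel_translate_integral[of w "h n *\<^sub>R axis i 1"] by simp
  have dom: "integrable lborel (\<lambda>x::real^'a. L * indicator (cball 0 (R + 1)) x)"
    using L by (intro integrable_bounded_support[of _ L "R+1"] borel_measurable_times borel_measurable_const borel_measurable_indicator) auto
  have qb: "\<bar>q n x\<bar> \<le> L * indicator (cball 0 (R + 1)) x" for n x
  proof (cases "norm x \<le> R + 1")
    case True
    then have "\<bar>w (x + h n *\<^sub>R axis i 1) - w x\<bar> \<le> L * h n"
      using L(2)[OF True, of "h n"] h[of n] by (simp add: add_axis_eq_upd)
    then show ?thesis using True h[of n] by (simp add: q_def field_simps)
  next
    case False
    have "norm x \<le> norm (x + h n *\<^sub>R axis i 1) + norm (h n *\<^sub>R axis i 1 :: real^'a)"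
      using norm_triangle_ineq4[of "x + h n *\<^sub>R axis i 1" "h n *\<^sub>R axis i 1"] by simp
    then have "norm (x + h n *\<^sub>R axis i 1) > R" using False h[of n] by simp
    then show ?thesis using False supp by (simp add: q_def)
  qed
  have lim: "AE x in lborel. (\<lambda>n. q n x) \<longlonglongrightarrow> g x"
    using axis_derivD(3)[OF w]
  proof eventually_elim
    case (elim x)
    then have "((\<lambda>t. (w (upd x i (x $ i + t)) - w x) / t) \<longlongrightarrow> g x) (at 0)"
      by (simp add: DERIV_def)
    then show ?case unfolding q_def add_axis_eq_upd
      by (rule filterlim_compose) (use h0 h in \<open>auto simp: filterlim_at less_imp_neq[THEN not_sym]\<close>)
  qed
  show "integrable lborel g"
    by (rule integrable_dominated_convergence[where s=q and w="\<lambda>x. L * indicator (cball 0 (R + 1)) x"]) (use dom lim qb in auto)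
  have "(\<lambda>n. LINT x|lborel. q n x) \<longlonglongrightarrow> (LINT x|lborel. g x)"
    by (rule integral_dominated_convergence[OF _ _ dom lim]) (use qb in auto)
  then show "(LINT x|lborel. g x) = 0" by (simp add: q0 LIMSEQ_const_iff)
qed

text \<open>Remainders that vanish almost everywhere vanish everywhere once they are continuous.\<close>

lemma continuous_AE_eq_0:
  fixes f :: "'a::euclidean_space \<Rightarrow> real"
  assumes c: "continuous_on UNIV f" and "AE x in lborel. f x = 0"
  shows "f x = 0"
proof (rule ccontr)
  assume nz: "f x \<noteq> 0"
  have o: "open {x. f x \<noteq> 0}" by (intro open_Collect_neq c continuous_intros)
  from assms(2) have "{x. f x \<noteq> 0} \<in> null_sets lborel"
    by (subst (asm) AE_iff_null) (use borel_open[OF o] in auto)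
  then have "negligible {x. f x \<noteq> 0}" by (simp add: negligible_iff_null_sets null_sets_completionI)
  then show False using open_not_negligible[OF o] nz by blast
qed

text \<open>An increment over length \<open>t\<close> is a sum of \<open>m\<close> increments over \<open>t / m\<close>. After integrating over a ball and
  translating each summand back, the total is at most \<open>m\<close> times the integral of one small increment over a
  larger ball, and this tends to the integral of \<open>\<bar>t\<bar> * \<bar>g\<bar>\<close>, that is to zero.\<close>

lemma axis_deriv_zero_const:
  fixes k :: "real^'n::finite \<Rightarrow> real"
  assumes k: "axis_deriv i k g" and z: "AE x in lborel. g x = 0"
  shows "k (upd x i s) = k x"
proof -
  note [measurable] = axis_derivD(2,4)[OF k]
  define e :: "real^'n" where "e = axis i 1"
  have main: "(LINT x|lborel. indicator (cball 0 R) x * \<bar>k (x + t *\<^sub>R e) - k x\<bar>) = 0" if "R > 0" for R t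
  proof -
    define R' where "R' = R + \<bar>t\<bar>"
    obtain N :: nat where N: "real N \<ge> \<bar>t\<bar>" using real_arch_simple by blast
    define M where "M = (\<lambda>n. real (n + N + 1))"
    have M: "M n > 0" "\<bar>t / M n\<bar> \<le> 1" for n using N by (auto simp: M_def field_simps)
    obtain L where L: "L \<ge> 0" "\<And>x h. norm x \<le> R' \<Longrightarrow> \<bar>h\<bar> \<le> 1 \<Longrightarrow> \<bar>k (upd x i (x $ i + h)) - k x\<bar> \<le> L * \<bar>h\<bar>"
      using axis_deriv_lipschitz[OF k] by blast
    define q where "q = (\<lambda>n x. indicator (cball 0 R') x * \<bar>k (x + (t / M n) *\<^sub>R e) - k x\<bar> :: real)"
    have cb[measurable]: "cball (0::real^'n) r \<in> sets borel" for r by auto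
    have [measurable]: "q n \<in> borel_measurable borel" for n unfolding q_def by measurable
    have dom: "integrable lborel (\<lambda>x::real^'n. (L * \<bar>t\<bar>) * indicator (cball 0 R') x)"
      using L by (intro integrable_bounded_support[of _ "L * \<bar>t\<bar>" R'] borel_measurable_times borel_measurable_const borel_measurable_indicator) auto
    have qb: "\<bar>M n * q n x\<bar> \<le> (L * \<bar>t\<bar>) * indicator (cball 0 R') x" for n x
    proof (cases "norm x \<le> R'")
      case True
      then have "\<bar>k (x + (t / M n) *\<^sub>R e) - k x\<bar> \<le> L * \<bar>t / M n\<bar>"
        using L(2)[OF True M(2)] by (simp add: add_axis_eq_upd e_def)
      then show ?thesis using True M(1)[of n] by (simp add: q_def field_simps abs_mult)
    qed (simp add: q_def)
    have qi: "integrable lborel (\<lambda>x. M n * q n x)" for n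
      by (rule Bochner_Integration.integrable_bound[OF dom]) (use qb L in auto)
    then have qi': "integrable lborel (q n)" for n using M(1)[of n] by (metis integrable_mult_left_iff less_irrefl)
    have t0: "(\<lambda>n. t / M n) \<longlonglongrightarrow> 0"
    proof (rule tendsto_divide_0[OF tendsto_const])
      show "filterlim M at_infinity sequentially" unfolding M_def
        by (rule filterlim_at_top_imp_at_infinity, rule filterlim_at_top_mono[OF filterlim_real_sequentially]) auto
    qed
    have lim: "AE x in lborel. (\<lambda>n. M n * q n x) \<longlonglongrightarrow> 0"
      using axis_derivD(3)[OF k] z
    proof eventually_elim
      case (elim x)
      then have d: "((\<lambda>h. (k (upd x i (x $ i + h)) - k x) / h) \<longlongrightarrow> 0) (at 0)"
        by (simp add: DERIV_def)
      show ?case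
      proof (cases "t = 0")
        case True then show ?thesis by (simp add: q_def)
      next
        case False
        have "(\<lambda>n. (k (upd x i (x $ i + t / M n)) - k x) / (t / M n)) \<longlonglongrightarrow> 0"
          by (rule filterlim_compose[OF d])
             (use t0 False M in \<open>auto simp: filterlim_at less_imp_neq[THEN not_sym]\<close>)
        from tendsto_mult_right[OF tendsto_rabs_zero[OF this], of "indicator (cball 0 R') x * \<bar>t\<bar>"]
        show ?thesis using False M by (simp add: q_def add_axis_eq_upd e_def abs_mult less_imp_le mult_ac)
      qed
    qed
    have lim': "(\<lambda>n. M n * (LINT x|lborel. q n x)) \<longlonglongrightarrow> 0"
      using integral_dominated_convergence[OF _ _ dom lim] qb by simp
    have le: "(LINT x|lborel. indicator (cball 0 R) x * \<bar>k (x + t *\<^sub>R e) - k x\<bar>) \<le> M n * (LINT x|lborel. q n x)" for n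
    proof -
      define m where "m = n + N + 1"
      have Mm: "M n = real m" by (simp add: M_def m_def)
      define a where "a = (\<lambda>j. (real j * (t / M n)) *\<^sub>R e)"
      have aS: "a (Suc j) = a j + (t / M n) *\<^sub>R e" for j by (simp add: a_def algebra_simps add_divide_distrib)
      have am: "a m = t *\<^sub>R e" using M(1)[of n] by (simp add: a_def Mm[symmetric])
      have a0: "a 0 = 0" by (simp add: a_def)
      have na: "norm (a j) \<le> \<bar>t\<bar>" if "j \<le> m" for j
      proof -
        have "norm (a j) = real j / real m * \<bar>t\<bar>" by (simp add: a_def e_def Mm abs_mult)
        also have "\<dots> \<le> 1 * \<bar>t\<bar>" using that by (intro mult_right_mono) (auto simp: m_def field_simps)
        finally show ?thesis by simp
      qed
      have pt: "indicator (cball 0 R) x * \<bar>k (x + t *\<^sub>R e) - k x\<bar> \<le> (\<Sum>j<m. q n (x + a j))" for x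
      proof (cases "norm x \<le> R")
        case True
        have "k (x + a m) - k (x + a 0) = (\<Sum>j<m. k (x + a (Suc j)) - k (x + a j))"
          by (rule sum_lessThan_telescope[symmetric])
        then have "\<bar>k (x + t *\<^sub>R e) - k x\<bar> \<le> (\<Sum>j<m. \<bar>k (x + a (Suc j)) - k (x + a j)\<bar>)"
          using sum_abs[of "\<lambda>j. k (x + a (Suc j)) - k (x + a j)" "{..<m}"] by (simp add: am a0 del: sum_abs)
        also have "\<dots> = (\<Sum>j<m. q n (x + a j))"
        proof (rule sum.cong)
          fix j assume "j \<in> {..<m}"
          then have "norm (x + a j) \<le> R'" using na[of j] True norm_triangle_ineq[of x "a j"] by (simp add: R'_def)
          then show "\<bar>k (x + a (Suc j)) - k (x + a j)\<bar> = q n (x + a j)"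
            by (simp add: q_def aS add.assoc)
        qed simp
        finally show ?thesis using True by simp
      qed (simp add: q_def sum_nonneg)
      have "(LINT x|lborel. indicator (cball 0 R) x * \<bar>k (x + t *\<^sub>R e) - k x\<bar>) \<le> (LINT x|lborel. (\<Sum>j<m. q n (x + a j)))"
      proof (rule integral_mono_AE')
        show "integrable lborel (\<lambda>x. \<Sum>j<m. q n (x + a j))"
          by (intro Bochner_Integration.integrable_sum lborel_translate_integral qi')
      qed (use pt in \<open>auto simp: q_def intro!: AE_I2 sum_nonneg\<close>)
      also have "\<dots> = (\<Sum>j<m. LINT x|lborel. q n (x + a j))"
        by (intro Bochner_Integration.integral_sum lborel_translate_integral qi')
      also have "\<dots> = M n * (LINT x|lborel. q n x)"
        by (simp add: lborel_translate_integral(2)[OF qi'] Mm)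
      finally show ?thesis .
    qed
    have "(LINT x|lborel. indicator (cball 0 R) x * \<bar>k (x + t *\<^sub>R e) - k x\<bar>) \<le> 0"
      by (rule tendsto_lowerbound[OF lim']) (use le in auto)
    moreover have "(LINT x|lborel. indicator (cball 0 R) x * \<bar>k (x + t *\<^sub>R e) - k x\<bar>) \<ge> 0"
      by (intro Bochner_Integration.integral_nonneg) auto
    ultimately show ?thesis by simp
  qed
  have ck: "continuous_on UNIV (\<lambda>x. k (x + t *\<^sub>R e) - k x)" for t
    by (intro continuous_intros continuous_on_compose2[OF axis_derivD(1)[OF k]] axis_derivD(1)[OF k]) auto
  have "AE x in lborel. k (x + t *\<^sub>R e) - k x = 0" for t
  proof -
    have "AE x in lborel. \<forall>n. indicator (cball 0 (real (Suc n))) x * \<bar>k (x + t *\<^sub>R e) - k x\<bar> = 0"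
      unfolding AE_all_countable
    proof
      fix n
      let ?f = "\<lambda>x. indicator (cball 0 (real (Suc n))) x * \<bar>k (x + t *\<^sub>R e) - k x\<bar>"
      obtain B where B: "B \<ge> 0" "\<And>x. norm x \<le> real (Suc n) \<Longrightarrow> \<bar>k (x + t *\<^sub>R e) - k x\<bar> \<le> B"
        using bounded_on_cball[OF ck] by blast
      have [measurable]: "cball (0::real^'n) r \<in> sets borel" for r by auto
      have fi: "integrable lborel ?f"
      proof (rule integrable_bounded_support[of _ B "real (Suc n)"])
        show "?f \<in> borel_measurable borel" by measurable
      qed (use B in \<open>auto simp: indicator_def\<close>)
      then show "AE x in lborel. ?f x = 0"
        using main[of "real (Suc n)" t] integral_nonneg_eq_0_iff_AE[OF fi] by simp
    qed
    then show ?thesis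
    proof eventually_elim
      case (elim x)
      obtain n where "norm x \<le> real n" using real_arch_simple by blast
      then have "norm x \<le> real (Suc n)" by simp
      then show ?case using elim[rule_format, of n] by (simp add: indicator_def)
    qed
  qed
  from continuous_AE_eq_0[OF ck this[of "s - x $ i"], of x] show ?thesis
    by (simp add: upd_eq e_def)
qed

text \<open>The square of a nonnegative function, so that the error in the integration by parts, which is linear
  in the displacement, can be absorbed by the quadratic remainder with the same weight.\<close>

definition cutoff :: "real \<Rightarrow> real^'n::finite \<Rightarrow> real" where
  "cutoff R x = (max 0 (1 - (x \<bullet> x) / R\<^sup>2))\<^sup>2"

lemma DERIV_max_0_square: "DERIV (\<lambda>r. (max 0 r)\<^sup>2) r :> 2 * max 0 (r::real)"
proof -
  consider "r > 0" | "r < 0" | "r = 0" by linarith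
  then show ?thesis
  proof cases
    case 1
    have "DERIV (\<lambda>r. r\<^sup>2) r :> 2 * max 0 r" using 1 by (auto intro!: derivative_eq_intros)
    then show ?thesis
      by (rule has_field_derivative_transform_within_open[where S="{0<..}"]) (use 1 in auto)
  next
    case 2
    have "DERIV (\<lambda>r. 0) r :> 2 * max 0 r" using 2 by simp
    then show ?thesis
      by (rule has_field_derivative_transform_within_open[where S="{..<0}"]) (use 2 in auto)
  next
    case 3
    have "(\<lambda>h::real. (max 0 h)\<^sup>2 / h) \<midarrow>0\<rightarrow> 0"
    proof (rule Lim_null_comparison)
      show "\<forall>\<^sub>F h in at (0::real). norm ((max 0 h)\<^sup>2 / h) \<le> \<bar>h\<bar>"
        by (auto simp: eventually_at_filter max_def power2_eq_square)
      show "(\<lambda>h::real. \<bar>h\<bar>) \<midarrow>0\<rightarrow> 0" by (rule tendsto_eq_intros | simp)+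
    qed
    then show ?thesis using 3 by (simp add: DERIV_def)
  qed
qed

lemma upd_has_derivative: "((\<lambda>s. upd x i s) has_derivative (\<lambda>h. h *\<^sub>R axis i 1)) (at t)"
  unfolding upd_eq by (auto intro!: derivative_eq_intros)

lemma axis_deriv_cutoff:
  "axis_deriv i (cutoff R) (\<lambda>x. (2 * max 0 (1 - (x \<bullet> x) / R\<^sup>2)) * (- (2 * x $ i / R\<^sup>2)))"
proof (rule axis_deriv_C1)
  show "continuous_on UNIV (cutoff R :: real^'a \<Rightarrow> real)" unfolding cutoff_def
    by (cases "R = 0") (auto intro!: continuous_intros)
  show "continuous_on UNIV (\<lambda>x::real^'a. (2 * max 0 (1 - (x \<bullet> x) / R\<^sup>2)) * (- (2 * x $ i / R\<^sup>2)))"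
    by (cases "R = 0") (auto intro!: continuous_intros)
  fix x :: "real^'a"
  have "((\<lambda>s. 1 - (upd x i s \<bullet> upd x i s) / R\<^sup>2) has_real_derivative (- (2 * x $ i / R\<^sup>2))) (at (x $ i))"
  proof (cases "R = 0")
    case False
    then show ?thesis
      unfolding has_field_derivative_def
      by - (rule has_derivative_eq_rhs, (rule derivative_intros upd_has_derivative)+,
        auto simp: fun_eq_iff inner_axis inner_commute[of "axis i 1"])
  qed simp
  from DERIV_chain2[OF DERIV_max_0_square this]
  show "((\<lambda>s. cutoff R (upd x i s)) has_real_derivative (2 * max 0 (1 - (x \<bullet> x) / R\<^sup>2)) * (- (2 * x $ i / R\<^sup>2))) (at (x $ i))"
    by (simp add: cutoff_def)
qed

lemma upd_invariant_const:
  fixes f :: "real^'n::finite \<Rightarrow> 'b"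
  assumes "\<And>x i s. f (upd x i s) = f x"
  shows "f x = f 0"
proof -
  have "f (\<chi> j. if j \<in> S then 0 else x $ j) = f x" if "finite S" for S
    using that
  proof (induction S)
    case empty
    then show ?case by (auto intro!: arg_cong[where f=f] simp: vec_eq_iff)
  next
    case (insert i S)
    have "(\<chi> j. if j \<in> insert i S then 0 else x $ j) = upd (\<chi> j. if j \<in> S then 0 else x $ j) i 0"
      by (auto simp: vec_eq_iff)
    then show ?case using assms insert by simp
  qed
  from this[of UNIV] show ?thesis by (simp add: zero_vec_def)
qed

section \<open>The logarithmic Sobolev inequality and its equality case\<close>

lemma cutoff_bounds: "0 \<le> cutoff R x" "cutoff R x \<le> 1"
proof -
  have "0 \<le> (x \<bullet> x) / R\<^sup>2" by simp
  then show "0 \<le> cutoff R x" "cutoff R x \<le> 1" by (auto simp: cutoff_def power_le_one)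
qed

lemma cutoff_mult_le: "norm (cutoff R x * a) \<le> norm a"
proof -
  have "\<bar>cutoff R x\<bar> * \<bar>a\<bar> \<le> 1 * \<bar>a\<bar>"
    using cutoff_bounds[of R x] by (intro mult_right_mono) auto
  then show ?thesis by (simp add: abs_mult)
qed

lemma cutoff_support: "R > 0 \<Longrightarrow> norm x > R \<Longrightarrow> cutoff R x = 0"
proof -
  assume R: "R > 0" "norm x > R"
  then have "R\<^sup>2 \<le> x \<bullet> x" by (simp add: power2_norm_eq_inner[symmetric] power_mono)
  then have "1 - (x \<bullet> x) / R\<^sup>2 \<le> 0" using R by simp
  then show ?thesis by (simp add: cutoff_def)
qed

lemma cutoff_mono:
  assumes "0 < R" "R \<le> R'" shows "cutoff R x \<le> cutoff R' x"
proof -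
  have "(x \<bullet> x) / R'\<^sup>2 \<le> (x \<bullet> x) / R\<^sup>2" using assms by (intro divide_left_mono power_mono) auto
  then show ?thesis unfolding cutoff_def by (intro power_mono) auto
qed

lemma cutoff_tendsto_1: "(\<lambda>n. cutoff (real (Suc n)) x) \<longlonglongrightarrow> 1"
proof -
  have "(\<lambda>n. (x \<bullet> x) * (inverse (real (Suc n)))\<^sup>2) \<longlonglongrightarrow> (x \<bullet> x) * 0\<^sup>2"
    by (intro tendsto_intros LIMSEQ_inverse_real_of_nat)
  then have "(\<lambda>n. (x \<bullet> x) / (real (Suc n))\<^sup>2) \<longlonglongrightarrow> 0" by (simp add: field_simps)
  then have "(\<lambda>n. (max 0 (1 - (x \<bullet> x) / (real (Suc n))\<^sup>2))\<^sup>2) \<longlonglongrightarrow> (max 0 (1 - 0))\<^sup>2"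
    by (intro tendsto_intros)
  then show ?thesis by (simp add: cutoff_def)
qed

lemma axis_deriv_minus:
  assumes "axis_deriv i f g" shows "axis_deriv i (\<lambda>x. - f x) (\<lambda>x. - g x)"
proof -
  have "axis_deriv i (\<lambda>_. - 1 :: real) (\<lambda>_. 0)" by (intro axis_deriv_C1) auto
  from axis_deriv_mult[OF this assms] show ?thesis by simp
qed

text \<open>The absorption step: Young's inequality splits off at most half of the quadratic remainder, and what is
  left is small like \<open>1 / R\<close> with an integrable factor.\<close>

lemma cutoff_gradient_bound:
  fixes x w G :: "real^'n::finite"
  assumes c: "c > 0" and R: "R \<ge> 1"
  defines "\<psi> \<equiv> max 0 (1 - (x \<bullet> x) / R\<^sup>2)"
  shows "(c/4) * \<psi>\<^sup>2 * (norm w)\<^sup>2 - ((4 * \<psi> / R\<^sup>2) *\<^sub>R x) \<bullet> (w - (1/c) *\<^sub>R G) \<ge> - ((16/c + (2/c) * (1 + (norm G)\<^sup>2)) / R)"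
proof (cases "norm x \<le> R")
  case False
  then have "R\<^sup>2 \<le> x \<bullet> x" using R by (simp add: power2_norm_eq_inner[symmetric] power_mono)
  then have "1 - (x \<bullet> x) / R\<^sup>2 \<le> 0" using R by simp
  then have "\<psi> = 0" by (simp add: \<psi>_def)
  then show ?thesis using c R by simp
next
  case True
  have \<psi>: "0 \<le> \<psi>" "\<psi> \<le> 1" by (auto simp: \<psi>_def)
  define K where "K = (4 * \<psi> / R\<^sup>2) *\<^sub>R x"
  have nK: "norm K \<le> 4 * \<psi> / R"
  proof -
    have "norm K = 4 * \<psi> / R\<^sup>2 * norm x" using \<psi> by (simp add: K_def)
    also have "\<dots> \<le> 4 * \<psi> / R\<^sup>2 * R" using True \<psi> by (intro mult_left_mono) auto
    also have "\<dots> = 4 * \<psi> / R" using R by (simp add: power2_eq_square)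
    finally show ?thesis .
  qed
  have 1: "K \<bullet> w \<le> (c/4) * \<psi>\<^sup>2 * (norm w)\<^sup>2 + 16 / (c * R\<^sup>2)"
  proof -
    define a where "a = \<psi> * norm w"
    have "K \<bullet> w \<le> norm K * norm w" by (rule norm_cauchy_schwarz)
    also have "\<dots> \<le> (4 * \<psi> / R) * norm w" using nK by (intro mult_right_mono) auto
    also have "\<dots> = 4 / R * a" by (simp add: a_def)
    also have "\<dots> \<le> (c/4) * a\<^sup>2 + 16 / (c * R\<^sup>2)"
    proof -
      have "0 \<le> (c/4) * (a - 8 / (c * R))\<^sup>2" using c by simp
      also have "\<dots> = (c/4) * a\<^sup>2 - 4 / R * a + 16 / (c * R\<^sup>2)"
        using c R by (simp add: power2_eq_square field_simps)
      finally show ?thesis by simp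
    qed
    finally show ?thesis by (simp add: a_def power_mult_distrib)
  qed
  have 2: "K \<bullet> G \<ge> - (4 / R * norm G)"
  proof -
    have "\<bar>K \<bullet> G\<bar> \<le> norm K * norm G" by (rule Cauchy_Schwarz_ineq2)
    also have "\<dots> \<le> 4 / R * norm G"
    proof (intro mult_right_mono order_trans[OF nK])
      show "4 * \<psi> / R \<le> 4 / R" using \<psi> R by (intro divide_right_mono) auto
    qed auto
    finally show ?thesis by linarith
  qed
  have 3: "4 * norm G \<le> 2 * (1 + (norm G)\<^sup>2)"
    using zero_le_power2[of "norm G - 1"] by (simp add: power2_eq_square algebra_simps)
  have 4: "(1/c) * (K \<bullet> G) \<ge> - ((2/c) * (1 + (norm G)\<^sup>2) / R)"
  proof -
    have "(1/c) * (K \<bullet> G) \<ge> (1/c) * (- (4 / R * norm G))" using 2 c by (intro mult_left_mono) auto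
    moreover have "(1/c) * (4 * norm G / R) \<le> (1/c) * (2 * (1 + (norm G)\<^sup>2) / R)"
      using 3 c R by (intro mult_left_mono divide_right_mono) auto
    ultimately show ?thesis by simp
  qed
  have 5: "16 / (c * R\<^sup>2) \<le> 16 / c / R"
  proof -
    have "R \<le> R\<^sup>2" using R by (simp add: power2_eq_square)
    then have "16 / (c * R\<^sup>2) \<le> 16 / (c * R)" using c R by (intro divide_left_mono mult_left_mono) auto
    then show ?thesis by simp
  qed
  have "K \<bullet> (w - (1/c) *\<^sub>R G) = K \<bullet> w - (1/c) * (K \<bullet> G)" by (simp add: inner_diff_right)
  moreover have "(16/c + (2/c) * (1 + (norm G)\<^sup>2)) / R = 16/c/R + (2/c) * (1 + (norm G)\<^sup>2) / R"
    by (simp add: add_divide_distrib)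
  ultimately show ?thesis using 1 4 5 unfolding K_def[symmetric] by linarith
qed

text \<open>With \<open>p = exp (g - V)\<close> and the displacement \<open>\<theta> = T x - x\<close> of the Knothe map from \<open>p\<close> to \<open>exp (- V)\<close>,
  the logarithm of the Jacobian equation gives
  \<open>p (|G|\<^sup>2 / (2 c) - g) = p (s\<^sub>V + s\<^sub>D + (c/2) |\<theta> + G / c|\<^sup>2) - div (p \<theta>)\<close>.
  Here \<open>s\<^sub>V \<ge> 0\<close> is the gap in the strong convexity estimate of \<open>V\<close> and \<open>s\<^sub>D \<ge> 0\<close> the gap in
  \<open>ln d \<le> d - 1\<close> for the diagonal derivatives. Integration against a cutoff removes the divergence. In
  the equality case all three gaps vanish, which determines \<open>g\<close>.\<close>

theorem log_sobolev_knothe: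
  fixes V g :: "real^'n::finite \<Rightarrow> real" and DV G :: "real^'n \<Rightarrow> real^'n"
  assumes c: "c > 0"
    and V: "continuous_on UNIV V" "continuous_on UNIV DV" "\<And>i. axis_deriv i V (\<lambda>x. DV x $ i)"
      "\<And>x h. V (x + h) \<ge> V x + DV x \<bullet> h + c/2 * (norm h)\<^sup>2"
    and g: "\<And>i. axis_deriv i g (\<lambda>x. G x $ i)"
    and dom: "gauss_dom UNIV (\<lambda>x. exp (g x - V x))" "gauss_dom UNIV (\<lambda>x. exp (- V x))"
    and eq: "(LINT x|lborel. exp (g x - V x)) = (LINT x|lborel. exp (- V x))"
    and int: "integrable lborel (\<lambda>x. exp (g x - V x) * g x)"
      "integrable lborel (\<lambda>x. exp (g x - V x) * (norm (G x))\<^sup>2)"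
  shows "0 \<le> (LINT x|lborel. exp (g x - V x) * ((norm (G x))\<^sup>2 / (2*c) - g x))"
    and "(LINT x|lborel. exp (g x - V x) * ((norm (G x))\<^sup>2 / (2*c) - g x)) = 0 \<Longrightarrow>
      \<exists>\<theta>. (\<forall>x. g x = g 0 - c * (\<theta> \<bullet> x)) \<and> (\<forall>x. V (x + \<theta>) = V x + DV x \<bullet> \<theta> + c/2 * (norm \<theta>)\<^sup>2)"
proof -
  obtain T D where T: "continuous_on UNIV T" and Dc: "\<And>i. continuous_on UNIV (D i)" and Dp: "\<And>i x. D i x > 0"
    and Dd: "\<And>i x. ((\<lambda>r. T (upd x i r) $ i) has_real_derivative D i x) (at (x $ i))"
    and tri: "\<And>i j. i \<noteq> j \<Longrightarrow> (\<forall>x s. T (upd x j s) $ i = T x $ i) \<or> (\<forall>x s. T (upd x i s) $ j = T x $ j)"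
    and MA: "\<And>x. exp (g x - V x) = exp (- V (T x)) * (\<Prod>i\<in>UNIV. D i x)"
    by (rule knothe_map_exists[OF dom(1,2) eq]) (rule that; assumption)
  define p where "p = (\<lambda>x. exp (g x - V x))"
  have p0: "p x > 0" for x by (simp add: p_def)
  define th where "th = (\<lambda>x. T x - x)"
  have thc: "continuous_on UNIV th" unfolding th_def by (intro continuous_intros T)
  define sV where "sV = (\<lambda>x. V (x + th x) - V x - DV x \<bullet> th x - c/2 * (norm (th x))\<^sup>2)"
  define sD where "sD = (\<lambda>x. \<Sum>i\<in>UNIV. (D i x - 1 - ln (D i x)))"
  have sV0: "sV x \<ge> 0" for x using V(4)[of x "th x"] by (simp add: sV_def)
  have sDi: "D i x - 1 - ln (D i x) \<ge> 0" for i x using ln_le_minus_one[OF Dp[of i x]] by simp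
  have sD0: "sD x \<ge> 0" for x unfolding sD_def by (intro sum_nonneg sDi)
  have cVT: "continuous_on UNIV (\<lambda>x. V (x + th x))"
    by (intro continuous_on_compose2[OF V(1)] continuous_intros thc) auto
  have sVc: "continuous_on UNIV sV" unfolding sV_def by (intro continuous_intros cVT V thc)
  have sDic: "continuous_on UNIV (\<lambda>x. D i x - 1 - ln (D i x))" for i
    using Dp[of i] by (intro continuous_intros Dc) (auto simp: less_imp_neq[THEN not_sym])
  have sDc: "continuous_on UNIV sD" unfolding sD_def by (intro continuous_intros sDic)
  have gid: "g x = - (sV x + DV x \<bullet> th x + c/2 * (norm (th x))\<^sup>2) + (\<Sum>i\<in>UNIV. D i x - 1) - sD x" for x
  proof -
    have "ln (exp (g x - V x)) = ln (exp (- V (T x)) * (\<Prod>i\<in>UNIV. D i x))" using MA by simp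
    also have "\<dots> = - V (T x) + (\<Sum>i\<in>UNIV. ln (D i x))"
      using Dp by (subst ln_mult_pos) (auto intro!: prod_pos ln_prod simp: less_imp_neq[THEN not_sym])
    finally have "g x = V x - V (T x) + (\<Sum>i\<in>UNIV. ln (D i x))" by simp
    then show ?thesis by (simp add: sV_def sD_def th_def sum_subtractf)
  qed
  have thd: "axis_deriv i (\<lambda>x. th x $ i) (\<lambda>x. D i x - 1)" for i
  proof (rule axis_deriv_C1)
    show "((\<lambda>s. th (upd x i s) $ i) has_real_derivative D i x - 1) (at (x $ i))" for x
      unfolding th_def by (auto intro!: derivative_eq_intros Dd)
  qed (intro continuous_intros thc Dc)+
  have pd: "axis_deriv i p (\<lambda>x. p x * (G x $ i - DV x $ i))" for i
    using axis_deriv_exp[OF axis_deriv_add[OF g[of i] axis_deriv_minus[OF V(3)[of i]]]]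
    by (simp add: p_def)
  have pc: "continuous_on UNIV p" using axis_derivD(1)[OF pd] .
  have [measurable]: "p \<in> borel_measurable borel" using pc by (rule borel_measurable_continuous_onI)
  have [measurable]: "g \<in> borel_measurable borel" by (rule axis_derivD(4)[OF g])
  have [measurable]: "G \<in> borel_measurable borel"
    by (subst borel_measurable_euclidean_space) (auto simp: Basis_vec_def inner_axis intro!: axis_derivD(2)[OF g])
  have [measurable]: "th \<in> borel_measurable borel" "sV \<in> borel_measurable borel" "sD \<in> borel_measurable borel"
    using thc sVc sDc by (auto intro: borel_measurable_continuous_onI)
  have [measurable]: "cutoff R \<in> borel_measurable borel" for R :: real
    using axis_derivD(4)[OF axis_deriv_cutoff] .
  have pint: "integrable lborel p" using margs_UNIV(2)[OF dom(1)] finite_distinct_list[of "UNIV :: 'n set"] by (auto simp: p_def)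
  define e where "e = (\<lambda>x. (norm (G x))\<^sup>2 / (2*c) - g x)"
  define w where "w = (\<lambda>x. th x + (1/c) *\<^sub>R G x)"
  define S where "S = (\<lambda>x. sV x + sD x + (c/4) * (norm (w x))\<^sup>2)"
  have [measurable]: "w \<in> borel_measurable borel" "S \<in> borel_measurable borel" "e \<in> borel_measurable borel"
    unfolding w_def S_def e_def by measurable
  have S0: "S x \<ge> 0" for x using sV0[of x] sD0[of x] c by (simp add: S_def)
  have peint: "integrable lborel (\<lambda>x. p x * e x)"
  proof -
    have "integrable lborel (\<lambda>x. exp (g x - V x) * (norm (G x))\<^sup>2 * (1 / (2*c)) - exp (g x - V x) * g x)"
      using int by (intro Bochner_Integration.integrable_diff integrable_mult_left)
    then show ?thesis by (simp add: p_def e_def algebra_simps)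
  qed
  define er where "er = (\<lambda>x. p x * (16/c + (2/c) * (1 + (norm (G x))\<^sup>2)))"
  have erint: "integrable lborel er"
  proof -
    have "integrable lborel (\<lambda>x. (16/c + 2/c) * p x + (2/c) * (exp (g x - V x) * (norm (G x))\<^sup>2))"
      using int pint by (intro Bochner_Integration.integrable_add integrable_mult_right)
    then show ?thesis by (simp add: er_def p_def algebra_simps)
  qed
  define E where "E = (LINT x|lborel. er x)"
  define \<psi> where "\<psi> = (\<lambda>(R::real) (x::real^'n). max 0 (1 - (x \<bullet> x) / R\<^sup>2))"
  \<comment> \<open>the divergence of \<open>cutoff R * p * th\<close>\<close>
  define \<tau> where "\<tau> = (\<lambda>(R::real) (x::real^'n). \<Sum>i\<in>UNIV. ((2 * \<psi> R x) * (- (2 * x $ i / R\<^sup>2))) * (p x * th x $ i)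
       + cutoff R x * (p x * (G x $ i - DV x $ i) * th x $ i + p x * (D i x - 1)))"
  have \<tau>: "integrable lborel (\<tau> R)" "(LINT x|lborel. \<tau> R x) = 0" if R: "R > 0" for R
  proof -
    have a: "axis_deriv i (\<lambda>x. cutoff R x * (p x * th x $ i))
        (\<lambda>x. ((2 * \<psi> R x) * (- (2 * x $ i / R\<^sup>2))) * (p x * th x $ i)
       + cutoff R x * (p x * (G x $ i - DV x $ i) * th x $ i + p x * (D i x - 1)))" for i
      unfolding \<psi>_def by (intro axis_deriv_mult axis_deriv_cutoff pd thd)
    have sup: "cutoff R x * (p x * th x $ i) = 0" if "norm x > R" for i x
      using cutoff_support[OF R that] by simp
    note b = integral_axis_deriv_eq_0[OF a sup]
    show "integrable lborel (\<tau> R)" unfolding \<tau>_def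
      by (intro Bochner_Integration.integrable_sum b(1))
    show "(LINT x|lborel. \<tau> R x) = 0" unfolding \<tau>_def
      by (subst Bochner_Integration.integral_sum, rule b(1), assumption, intro sum.neutral ballI b(2))
  qed
  have \<tau>e: "\<tau> R x = p x * (- (((4 * \<psi> R x / R\<^sup>2) *\<^sub>R x) \<bullet> th x)
      + cutoff R x * (G x \<bullet> th x - DV x \<bullet> th x + (\<Sum>i\<in>UNIV. D i x - 1)))" for R x
    unfolding \<tau>_def inner_vec_def
    by (simp add: sum.distrib sum_distrib_left sum_negf sum_subtractf algebra_simps)
  have key: "cutoff R x * (p x * e x) + \<tau> R x \<ge> cutoff R x * (p x * S x) - er x / R" if R: "R \<ge> 1" for R x
  proof -
    have cp: "cutoff R x = (\<psi> R x)\<^sup>2" by (simp add: cutoff_def \<psi>_def)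
    have nw: "(norm (w x))\<^sup>2 = (norm (th x))\<^sup>2 + 2/c * (G x \<bullet> th x) + (norm (G x))\<^sup>2 / c\<^sup>2"
      unfolding w_def power2_norm_eq_inner
      using c by (simp add: inner_add_left inner_add_right inner_commute power2_eq_square)
    define B where "B = G x \<bullet> th x - DV x \<bullet> th x + (\<Sum>i\<in>UNIV. D i x - 1)"
    have eB: "e x + B = S x + (c/4) * (norm (w x))\<^sup>2"
    proof -
      have 1: "(c/4) * (norm (w x))\<^sup>2 = (c/4) * (norm (th x))\<^sup>2 + (1/2) * (G x \<bullet> th x) + (norm (G x))\<^sup>2 / (4*c)"
        unfolding nw using c by (simp add: field_simps power2_eq_square)
      have 2: "(norm (G x))\<^sup>2 / (2*c) = 2 * ((norm (G x))\<^sup>2 / (4*c))" by simp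
      show ?thesis using gid[of x] unfolding e_def S_def B_def 1 2 by linarith
    qed
    have "cutoff R x * (p x * e x) + \<tau> R x = p x * (cutoff R x * (e x + B) - ((4 * \<psi> R x / R\<^sup>2) *\<^sub>R x) \<bullet> th x)"
      unfolding \<tau>e B_def[symmetric] by (simp add: algebra_simps)
    also have "\<dots> = p x * (cutoff R x * (S x + (c/4) * (norm (w x))\<^sup>2) - ((4 * \<psi> R x / R\<^sup>2) *\<^sub>R x) \<bullet> th x)"
      unfolding eB ..
    also have "\<dots> = p x * (cutoff R x * S x + ((c/4) * (\<psi> R x)\<^sup>2 * (norm (w x))\<^sup>2 - ((4 * \<psi> R x / R\<^sup>2) *\<^sub>R x) \<bullet> (w x - (1/c) *\<^sub>R G x)))"
      by (simp add: cp w_def algebra_simps)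
    also have "\<dots> \<ge> p x * (cutoff R x * S x + - ((16/c + (2/c) * (1 + (norm (G x))\<^sup>2)) / R))"
      using cutoff_gradient_bound[OF c R, where x=x and w="w x" and G="G x"] p0[of x]
      by (intro mult_left_mono add_left_mono) (auto simp: \<psi>_def)
    finally show ?thesis by (simp add: er_def algebra_simps)
  qed
  have cpS0: "0 \<le> cutoff r x * (p x * S x)" for r x
    by (intro mult_nonneg_nonneg cutoff_bounds(1) less_imp_le[OF p0] S0)
  define R where "R = (\<lambda>n. real (Suc n))"
  have R: "R n \<ge> 1" "R n > 0" for n by (auto simp: R_def)
  have cpe: "integrable lborel (\<lambda>x. cutoff (R n) x * (p x * e x))" for n
    by (rule Bochner_Integration.integrable_bound[OF peint])
       (use cutoff_mult_le in auto)
  have cpS: "integrable lborel (\<lambda>x. cutoff (R n) x * (p x * S x))" for n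
  proof (rule Bochner_Integration.integrable_bound)
    show "integrable lborel (\<lambda>x. cutoff (R n) x * (p x * e x) + \<tau> (R n) x + er x / R n)"
      by (intro Bochner_Integration.integrable_add cpe \<tau> R integrable_divide erint)
    show "AE x in lborel. norm (cutoff (R n) x * (p x * S x)) \<le> norm (cutoff (R n) x * (p x * e x) + \<tau> (R n) x + er x / R n)"
    proof (rule AE_I2)
      fix x
      from cpS0[of "R n" x] key[OF R(1)[of n], of x] show "norm (cutoff (R n) x * (p x * S x)) \<le> norm (cutoff (R n) x * (p x * e x) + \<tau> (R n) x + er x / R n)"
        by simp
    qed
  qed measurable
  have main: "(LINT x|lborel. cutoff (R n) x * (p x * S x)) - E / R n \<le> (LINT x|lborel. cutoff (R n) x * (p x * e x))" for n
  proof -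
    have "(LINT x|lborel. cutoff (R n) x * (p x * S x)) - E / R n = (LINT x|lborel. cutoff (R n) x * (p x * S x) - er x / R n)"
      unfolding E_def using cpS erint by simp
    also have "\<dots> \<le> (LINT x|lborel. cutoff (R n) x * (p x * e x) + \<tau> (R n) x)"
      using key[OF R(1)[of n]] by (intro integral_mono Bochner_Integration.integrable_add Bochner_Integration.integrable_diff cpe \<tau> R cpS integrable_divide erint) auto
    also have "\<dots> = (LINT x|lborel. cutoff (R n) x * (p x * e x))"
      using cpe \<tau>[OF R(2)[of n]] by simp
    finally show ?thesis .
  qed
  have lim1: "(\<lambda>n. LINT x|lborel. cutoff (R n) x * (p x * e x)) \<longlonglongrightarrow> (LINT x|lborel. p x * e x)"
  proof (rule integral_dominated_convergence[where w="\<lambda>x. norm (p x * e x)"])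
    show "AE x in lborel. (\<lambda>n. cutoff (R n) x * (p x * e x)) \<longlonglongrightarrow> p x * e x"
      using tendsto_mult_right[OF cutoff_tendsto_1] by (auto simp: R_def)
    show "AE x in lborel. norm (cutoff (R n) x * (p x * e x)) \<le> norm (p x * e x)" for n
      by (intro AE_I2 cutoff_mult_le)
  qed (use peint in auto)
  have "(\<lambda>n. E * inverse (R n)) \<longlonglongrightarrow> E * 0" unfolding R_def by (intro tendsto_intros LIMSEQ_inverse_real_of_nat)
  then have lim2: "(\<lambda>n. E / R n) \<longlonglongrightarrow> 0" by (simp add: field_simps)
  have cSn: "(LINT x|lborel. cutoff (R n) x * (p x * S x)) \<ge> 0" for n
    by (intro Bochner_Integration.integral_nonneg cpS0)
  have lim3: "(\<lambda>n. (LINT x|lborel. cutoff (R n) x * (p x * e x)) + E / R n) \<longlonglongrightarrow> (LINT x|lborel. p x * e x)"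
    using tendsto_add[OF lim1 lim2] by simp
  have pe: "(LINT x|lborel. p x * e x) = (LINT x|lborel. exp (g x - V x) * ((norm (G x))\<^sup>2 / (2*c) - g x))"
    by (simp add: p_def e_def)
  show "0 \<le> (LINT x|lborel. exp (g x - V x) * ((norm (G x))\<^sup>2 / (2*c) - g x))"
    unfolding pe[symmetric]
  proof (rule tendsto_lowerbound[OF lim3])
    show "\<forall>\<^sub>F n in sequentially. 0 \<le> (LINT x|lborel. cutoff (R n) x * (p x * e x)) + E / R n"
      using main cSn by (intro always_eventually allI) (smt (verit))
  qed simp
  assume "(LINT x|lborel. exp (g x - V x) * ((norm (G x))\<^sup>2 / (2*c) - g x)) = 0"
  then have pe0: "(LINT x|lborel. p x * e x) = 0" by (simp add: pe)
  have cS0: "(LINT x|lborel. cutoff (R n) x * (p x * S x)) = 0" for n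
  proof -
    have "(LINT x|lborel. cutoff (R n) x * (p x * S x)) \<le> 0"
    proof (rule tendsto_lowerbound[OF lim3[unfolded pe0]])
      show "\<forall>\<^sub>F m in sequentially. (LINT x|lborel. cutoff (R n) x * (p x * S x)) \<le> (LINT x|lborel. cutoff (R m) x * (p x * e x)) + E / R m"
        using eventually_ge_at_top[of n]
      proof eventually_elim
        case (elim m)
        have "(LINT x|lborel. cutoff (R n) x * (p x * S x)) \<le> (LINT x|lborel. cutoff (R m) x * (p x * S x))"
          using elim R(2)[of n] p0 S0 by (intro integral_mono cpS mult_right_mono cutoff_mono) (auto simp: R_def less_imp_le)
        then show ?case using main[of m] by linarith
      qed
    qed simp
    with cSn[of n] show ?thesis by linarith
  qed
  have "AE x in lborel. \<forall>n. cutoff (R n) x * (p x * S x) = 0"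
    unfolding AE_all_countable
  proof
    fix n
    show "AE x in lborel. cutoff (R n) x * (p x * S x) = 0"
      using cS0[of n] integral_nonneg_eq_0_iff_AE[OF cpS[of n] AE_I2[OF cpS0]] by simp
  qed
  then have AES: "AE x in lborel. S x = 0"
  proof eventually_elim
    case (elim x)
    obtain n where "cutoff (R n) x > 0"
      using order_tendstoD(1)[OF cutoff_tendsto_1[of x], of 0] by (auto simp: R_def eventually_sequentially)
    then show ?case using elim[rule_format, of n] p0[of x] by simp
  qed
  have S0D: "sV x = 0 \<and> sD x = 0 \<and> w x = 0" if "S x = 0" for x
  proof -
    have "(c/4) * (norm (w x))\<^sup>2 \<ge> 0" using c by simp
    then have "sV x = 0" "sD x = 0" "(c/4) * (norm (w x))\<^sup>2 = 0"
      using that sV0[of x] sD0[of x] unfolding S_def by linarith+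
    then show ?thesis using c by simp
  qed
  have sVz: "sV x = 0" for x
    by (rule continuous_AE_eq_0[OF sVc]) (use AES S0D in \<open>auto elim!: eventually_mono\<close>)
  have sDz: "sD x = 0" for x
    by (rule continuous_AE_eq_0[OF sDc]) (use AES S0D in \<open>auto elim!: eventually_mono\<close>)
  have wz: "AE x in lborel. w x = 0" using AES by (rule eventually_mono) (use S0D in auto)
  have D1: "D i x = 1" for i x
  proof -
    have "\<forall>i\<in>UNIV. D i x - 1 - ln (D i x) = 0"
      using sDz[of x] sDi unfolding sD_def by (subst (asm) sum_nonneg_eq_0_iff) auto
    then show ?thesis using ln_eq_minus_one[OF Dp[of i x]] by simp
  qed
  have thi: "th (upd x i s) $ i = th x $ i" for x i s
  proof -
    have "axis_deriv i (\<lambda>x. th x $ i) (\<lambda>x. 0)" using thd[of i] by (simp add: D1)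
    then show ?thesis by (rule axis_deriv_zero_const) simp
  qed
  have gi: "g (upd x i s) - g x = - (c * th x $ i * (s - x $ i))" for x i s
  proof -
    have a1: "axis_deriv i (\<lambda>x. c * th x $ i) (\<lambda>x. 0)"
      using axis_deriv_mult[OF axis_deriv_C1[of "\<lambda>_. c" "\<lambda>_. 0" i] thd[of i]] by (simp add: D1)
    have a2: "axis_deriv i (\<lambda>x. x $ i) (\<lambda>x. 1)"
      by (rule axis_deriv_C1) (auto intro!: continuous_intros derivative_eq_intros)
    have "axis_deriv i (\<lambda>x. g x + c * th x $ i * x $ i) (\<lambda>x. G x $ i + (0 * x $ i + c * th x $ i * 1))"
      by (intro axis_deriv_add axis_deriv_mult a1 a2 g)
    moreover have "AE x in lborel. G x $ i + (0 * x $ i + c * th x $ i * 1) = 0"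
      using wz
    proof eventually_elim
      case (elim x)
      then have "w x $ i = 0" by simp
      then show ?case using c by (simp add: w_def field_simps)
    qed
    ultimately have "g (upd x i s) + c * th (upd x i s) $ i * upd x i s $ i = g x + c * th x $ i * x $ i"
      by (rule axis_deriv_zero_const)
    then show ?thesis by (simp add: thi algebra_simps)
  qed
  \<comment> \<open>compare the two ways of changing first one and then the other coordinate\<close>
  have sym: "th (upd x i s) $ j = th x $ j" if ij: "i \<noteq> j" and inv: "\<And>x r. T (upd x j r) $ i = T x $ i" for i j x s
  proof -
    have thj: "th (upd x j r) $ i = th x $ i" for x r using inv ij by (simp add: th_def)
    define r where "r = x $ j + 1"
    have "g (upd (upd x i s) j r) - g x = - (c * th (upd x i s) $ j * (r - x $ j)) - (c * th x $ i * (s - x $ i))"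
      using gi[of "upd x i s" j r] gi[of x i s] ij by simp
    moreover have "g (upd (upd x j r) i s) - g x = - (c * th x $ i * (s - x $ i)) - (c * th x $ j * (r - x $ j))"
      using gi[of "upd x j r" i s] gi[of x j r] ij by (simp add: thj)
    ultimately show ?thesis using c ij by (simp add: upd_swap[of i j] r_def)
  qed
  have thinv: "th (upd x i s) $ j = th x $ j" for x i j s
  proof (cases "i = j")
    case True then show ?thesis using thi by simp
  next
    case False
    with tri[of i j] sym[OF False, of x s] show ?thesis by (auto simp: th_def)
  qed
  then have "th (upd x i s) = th x" for x i s by (simp add: vec_eq_iff)
  then have th0: "th x = th 0" for x by (rule upd_invariant_const)
  have "g x + c * (th 0 \<bullet> x) = g 0 + c * (th 0 \<bullet> 0)" for x
  proof (rule upd_invariant_const[where f="\<lambda>x. g x + c * (th 0 \<bullet> x)"])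
    fix x i s
    have ip: "th 0 \<bullet> upd x i s = th 0 \<bullet> x + (s - x $ i) * th 0 $ i"
      unfolding upd_eq by (simp add: inner_add_right inner_axis)
    then show "g (upd x i s) + c * (th 0 \<bullet> upd x i s) = g x + c * (th 0 \<bullet> x)"
      using gi[of x i s] unfolding th0[of x] ip by (simp add: algebra_simps)
  qed
  then have 1: "\<forall>x. g x = g 0 - c * (th 0 \<bullet> x)" by (auto simp: algebra_simps)
  have 2: "\<forall>x. V (x + th 0) = V x + DV x \<bullet> th 0 + c/2 * (norm (th 0))\<^sup>2"
  proof
    fix x
    show "V (x + th 0) = V x + DV x \<bullet> th 0 + c/2 * (norm (th 0))\<^sup>2"
      using sVz[of x] th0[of x] by (simp add: sV_def)
  qed
  from 1 2 show "\<exists>\<theta>. (\<forall>x. g x = g 0 - c * (\<theta> \<bullet> x)) \<and> (\<forall>x. V (x + \<theta>) = V x + DV x \<bullet> \<theta> + c/2 * (norm \<theta>)\<^sup>2)"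
    by blast
qed

section \<open>Strongly convex potentials\<close>

lemma Ck_continuous: "Ck k f \<Longrightarrow> continuous_on UNIV f"
proof (induction k arbitrary: f)
  case (Suc k)
  then show ?case by (auto intro!: differentiable_imp_continuous_on simp: differentiable_on_def differentiable_at_withinI)
qed simp

lemma Ck_Suc_imp: "Ck (Suc k) f \<Longrightarrow> Ck k f"
proof (induction k arbitrary: f)
  case 0
  then show ?case using Ck_continuous[OF 0] by simp
next
  case (Suc k)
  then show ?case by (metis Ck.simps(2))
qed

lemma grad_inner:
  fixes V :: "real^'n::finite \<Rightarrow> real"
  assumes "V differentiable at x"
  shows "frechet_derivative V (at x) h = grad V x \<bullet> h"
proof -
  have lin: "linear (frechet_derivative V (at x))" using assms by (rule linear_frechet_derivative)
  have "frechet_derivative V (at x) h = frechet_derivative V (at x) (\<Sum>i\<in>UNIV. h $ i *\<^sub>R axis i 1)"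
    using basis_expansion[of h] by (simp add: scalar_mult_eq_scaleR)
  also have "\<dots> = (\<Sum>i\<in>UNIV. h $ i *\<^sub>R frechet_derivative V (at x) (axis i 1))"
    by (simp add: linear_sum[OF lin] linear_cmul[OF lin])
  finally show ?thesis by (simp add: grad_def partial_deriv_def inner_vec_def mult.commute)
qed

lemma C2_grad:
  fixes V :: "real^'n::finite \<Rightarrow> real"
  assumes "Ck 2 V"
  shows "(V has_derivative (\<lambda>h. grad V x \<bullet> h)) (at x)"
    "(grad V has_derivative (\<lambda>h. hessian V x *v h)) (at x)"
    "continuous_on UNIV V" "continuous_on UNIV (grad V)"
proof -
  have C: "Ck (Suc (Suc 0)) V" using assms by (simp add: numeral_2_eq_2)
  then have d: "V differentiable at x" for x by simp
  have "frechet_derivative V (at x) = (\<lambda>h. grad V x \<bullet> h)" by (auto simp: grad_inner[OF d])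
  then show "(V has_derivative (\<lambda>h. grad V x \<bullet> h)) (at x)" using d frechet_derivative_works by metis
  have p: "(\<lambda>x. partial_deriv i V x) differentiable at x" for i x
    using C unfolding partial_deriv_def by simp
  have q: "(\<lambda>x. partial_deriv i V x *\<^sub>R (axis i 1 :: real^'n)) differentiable at x" for i x
  proof -
    obtain D where "((\<lambda>x. partial_deriv i V x) has_derivative D) (at x)" using p[of i x] by (auto simp: differentiable_def)
    from has_derivative_scaleR_left[OF this, of "axis i 1 :: real^'n"] show ?thesis by (auto simp: differentiable_def)
  qed
  have "(\<lambda>x. \<Sum>i\<in>UNIV. partial_deriv i V x *\<^sub>R (axis i 1 :: real^'n)) differentiable at x" for x
    by (intro differentiable_sum ballI q) auto
  moreover have "(\<lambda>x. \<Sum>i\<in>UNIV. partial_deriv i V x *\<^sub>R (axis i 1 :: real^'n)) = grad V"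
    using basis_expansion[of "grad V _"] by (auto simp: grad_def scalar_mult_eq_scaleR fun_eq_iff)
  ultimately have g: "grad V differentiable at x" for x by simp
  then show "(grad V has_derivative (\<lambda>h. hessian V x *v h)) (at x)"
    unfolding hessian_def using jacobian_works by blast
  show "continuous_on UNIV V" using d by (intro differentiable_imp_continuous_on) (auto simp: differentiable_on_def differentiable_at_withinI)
  show "continuous_on UNIV (grad V)" using g by (intro differentiable_imp_continuous_on) (auto simp: differentiable_on_def differentiable_at_withinI)
qed

lemma line_derivs:
  fixes V :: "real^'n::finite \<Rightarrow> real"
  assumes "Ck 2 V"
  shows "((\<lambda>s. V (x + s *\<^sub>R h)) has_real_derivative (grad V (x + s *\<^sub>R h) \<bullet> h)) (at s)"
    "((\<lambda>s. grad V (x + s *\<^sub>R h) \<bullet> k) has_real_derivative ((hessian V (x + s *\<^sub>R h) *v h) \<bullet> k)) (at s)"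
proof -
  have l: "((\<lambda>s. x + s *\<^sub>R h) has_derivative (\<lambda>t. t *\<^sub>R h)) (at s)" by (auto intro!: derivative_eq_intros)
  show "((\<lambda>s. V (x + s *\<^sub>R h)) has_real_derivative (grad V (x + s *\<^sub>R h) \<bullet> h)) (at s)"
    using has_derivative_compose[OF l C2_grad(1)[OF assms]]
    by (simp add: has_field_derivative_def mult_commute_abs)
  have "((\<lambda>s. grad V (x + s *\<^sub>R h)) has_derivative (\<lambda>t. hessian V (x + s *\<^sub>R h) *v (t *\<^sub>R h))) (at s)"
    using has_derivative_compose[OF l C2_grad(2)[OF assms]] .
  then have "((\<lambda>s. grad V (x + s *\<^sub>R h) \<bullet> k) has_derivative (\<lambda>t. (hessian V (x + s *\<^sub>R h) *v (t *\<^sub>R h)) \<bullet> k)) (at s)"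
    by (rule has_derivative_inner_left)
  then show "((\<lambda>s. grad V (x + s *\<^sub>R h) \<bullet> k) has_real_derivative ((hessian V (x + s *\<^sub>R h) *v h) \<bullet> k)) (at s)"
    by (simp add: has_field_derivative_def mult_commute_abs matrix_vector_mult_scaleR)
qed

lemma axis_deriv_grad:
  fixes V :: "real^'n::finite \<Rightarrow> real"
  assumes "Ck 1 V" shows "axis_deriv i V (partial_deriv i V)"
proof (rule axis_deriv_C1)
  have C: "Ck (Suc 0) V" using assms by simp
  then have d: "V differentiable at x" for x by simp
  show "continuous_on UNIV V" using C by (rule Ck_continuous)
  show "continuous_on UNIV (partial_deriv i V)" using C by (simp add: partial_deriv_def[abs_def])
  have "(V has_derivative frechet_derivative V (at x)) (at x)" for x using d frechet_derivative_works by blast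
  from has_derivative_compose[OF upd_has_derivative, of V _ _ i "_ $ i"] this
  have "((\<lambda>s. V (upd x i s)) has_derivative (\<lambda>t. frechet_derivative V (at x) (t *\<^sub>R axis i 1))) (at (x $ i))" for x
    by simp
  then show "((\<lambda>s. V (upd x i s)) has_real_derivative partial_deriv i V x) (at (x $ i))" for x
    by (simp add: has_field_derivative_def partial_deriv_def linear_cmul[OF linear_frechet_derivative[OF d]] mult_commute_abs)
qed

text \<open>Minimising the quadratic form along the line through \<open>v\<close> in the direction \<open>A *v v\<close> would make it
  negative unless that direction is zero.\<close>

lemma psd_kernel:
  fixes A :: "real^'n::finite^'n"
  assumes "psd A" "v \<bullet> (A *v v) = 0" shows "A *v v = 0"
proof -
  define w where "w = A *v v"
  have sym: "w \<bullet> v' = v \<bullet> (A *v v')" for v'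
    using assms(1) unfolding w_def psd_def by (metis dot_lmul_matrix transpose_matrix_vector)
  have ge: "0 \<le> 2 * t * (w \<bullet> w) + t\<^sup>2 * (w \<bullet> (A *v w))" for t
  proof -
    have "0 \<le> (v + t *\<^sub>R w) \<bullet> (A *v (v + t *\<^sub>R w))" using assms(1) by (simp add: psd_def)
    also have "\<dots> = v \<bullet> (A *v v) + t * (v \<bullet> (A *v w)) + t * (w \<bullet> (A *v v)) + t\<^sup>2 * (w \<bullet> (A *v w))"
      by (simp add: matrix_vector_right_distrib matrix_vector_mult_scaleR inner_add_left inner_add_right power2_eq_square algebra_simps)
    finally show ?thesis using assms(2) sym[of w] by (simp add: w_def)
  qed
  define q where "q = w \<bullet> (A *v w)"
  have q0: "q \<ge> 0" using assms(1) by (simp add: psd_def q_def)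
  have "w \<bullet> w = 0"
  proof (rule ccontr)
    assume "w \<bullet> w \<noteq> 0"
    then have p: "w \<bullet> w > 0" by (metis inner_gt_zero_iff inner_eq_zero_iff)
    define t where "t = - (w \<bullet> w) / (q + 1)"
    have "2 * t * (w \<bullet> w) + t\<^sup>2 * q = - (w \<bullet> w)\<^sup>2 / (q+1) * (2 - q / (q + 1))"
      by (simp add: t_def divide_inverse power2_eq_square algebra_simps)
    moreover have "2 - q / (q + 1) > 0" using q0 by (simp add: field_simps)
    then have "- (w \<bullet> w)\<^sup>2 / (q+1) * (2 - q / (q + 1)) < 0" using p q0 by (intro mult_neg_pos) auto
    ultimately show False using ge[of t] by (simp add: q_def)
  qed
  then show ?thesis by (simp add: w_def)
qed

lemma inner_shift_mat: "v \<bullet> ((A - c *\<^sub>R mat 1) *v w) = v \<bullet> (A *v w) - c * (v \<bullet> w)"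
  for A :: "real^'n::finite^'n"
  by (simp add: matrix_vector_mult_diff_rdistrib scaleR_matrix_vector_assoc[symmetric] inner_diff_right)

text \<open>Taylor's formula on the segment, in the form of two applications of monotonicity.\<close>

lemma strongly_convex_bound:
  fixes V :: "real^'n::finite \<Rightarrow> real"
  assumes V: "Ck 2 V" and psd: "\<And>x. psd (hessian V x - c *\<^sub>R mat 1)"
  shows "V (x + h) \<ge> V x + grad V x \<bullet> h + c/2 * (norm h)\<^sup>2"
proof -
  have hh: "(hessian V y *v h) \<bullet> h \<ge> c * (h \<bullet> h)" for y
  proof -
    have "0 \<le> h \<bullet> ((hessian V y - c *\<^sub>R mat 1) *v h)" using psd[of y] by (simp add: psd_def)
    then show ?thesis unfolding inner_shift_mat by (simp add: inner_commute)
  qed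
  have g: "grad V (x + s *\<^sub>R h) \<bullet> h - c * s * (h \<bullet> h) \<ge> grad V x \<bullet> h" if "s \<ge> 0" for s
  proof -
    have "grad V (x + 0 *\<^sub>R h) \<bullet> h - c * 0 * (h \<bullet> h) \<le> grad V (x + s *\<^sub>R h) \<bullet> h - c * s * (h \<bullet> h)"
      by (rule DERIV_nonneg_imp_nondecreasing[OF that, of "\<lambda>s. grad V (x + s *\<^sub>R h) \<bullet> h - c * s * (h \<bullet> h)"])
         (use hh in \<open>auto intro!: exI conjI derivative_eq_intros line_derivs[OF V]\<close>)
    then show ?thesis by simp
  qed
  define W where "W = (\<lambda>s. V (x + s *\<^sub>R h) - s * (grad V x \<bullet> h) - c/2 * s\<^sup>2 * (h \<bullet> h))"
  have dW: "(W has_real_derivative (grad V (x + s *\<^sub>R h) \<bullet> h - grad V x \<bullet> h - c * s * (h \<bullet> h))) (at s)" for s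
    unfolding W_def by (auto intro!: derivative_eq_intros line_derivs[OF V])
  have "W 0 \<le> W 1"
  proof (rule DERIV_nonneg_imp_nondecreasing[of 0 1 W])
    show "\<exists>y. (W has_real_derivative y) (at s) \<and> 0 \<le> y" if "0 \<le> s" "s \<le> 1" for s
      using dW[of s] g[OF that(1)] by (intro exI conjI) auto
  qed simp
  then show ?thesis by (simp add: W_def power2_norm_eq_inner)
qed

text \<open>On the segment from \<open>y\<close> to \<open>y + \<theta>\<close> the convex function \<open>W\<close> starts with value and slope zero and ends at
  zero, so it vanishes on the segment and so does its second derivative at the midpoint. Every point is
  the midpoint of such a segment.\<close>

lemma equality_imp_kernel:
  fixes V :: "real^'n::finite \<Rightarrow> real"
  assumes V: "Ck 2 V" and psd: "\<And>x. psd (hessian V x - c *\<^sub>R mat 1)"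
    and eq: "\<And>x. V (x + \<theta>) = V x + grad V x \<bullet> \<theta> + c/2 * (norm \<theta>)\<^sup>2"
  shows "\<theta> \<in> Ker_hessian V c"
proof -
  have "\<theta> \<bullet> ((hessian V x - c *\<^sub>R mat 1) *v \<theta>) = 0" for x
  proof -
    define y where "y = x - (1/2) *\<^sub>R \<theta>"
    define W' where "W' = (\<lambda>s. grad V (y + s *\<^sub>R \<theta>) \<bullet> \<theta> - grad V y \<bullet> \<theta> - c * s * (\<theta> \<bullet> \<theta>))"
    define W where "W = (\<lambda>s. V (y + s *\<^sub>R \<theta>) - V y - s * (grad V y \<bullet> \<theta>) - c/2 * s\<^sup>2 * (\<theta> \<bullet> \<theta>))"
    have dW: "(W has_real_derivative W' s) (at s)" for s
      unfolding W_def W'_def by (auto intro!: derivative_eq_intros line_derivs[OF V])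
    have dW': "(W' has_real_derivative (\<theta> \<bullet> ((hessian V (y + s *\<^sub>R \<theta>) - c *\<^sub>R mat 1) *v \<theta>))) (at s)" for s
      unfolding W'_def inner_shift_mat inner_commute[of \<theta> "hessian V _ *v \<theta>"]
      by (auto intro!: derivative_eq_intros line_derivs[OF V])
    have mW': "W' s \<le> W' t" if "s \<le> t" for s t
      by (rule DERIV_nonneg_imp_nondecreasing[OF that]) (use dW' psd in \<open>auto simp: psd_def intro!: exI conjI\<close>)
    have W'0: "W' 0 = 0" by (simp add: W'_def)
    have mW: "W s \<le> W t" if "0 \<le> s" "s \<le> t" for s t
      by (rule DERIV_nonneg_imp_nondecreasing[OF that(2)]) (use dW mW'[of 0] W'0 that in \<open>auto intro!: exI conjI\<close>)
    have W0: "W 0 = 0" by (simp add: W_def)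
    have W1: "W 1 = 0" using eq[of y] by (simp add: W_def power2_norm_eq_inner)
    have Wz: "W s = 0" if "0 \<le> s" "s \<le> 1" for s using mW[of 0 s] mW[of s 1] that W0 W1 by auto
    have W'z: "W' s = 0" if "0 < s" "s < 1" for s
    proof -
      have "((\<lambda>_. 0) has_real_derivative W' s) (at s)"
        by (rule has_field_derivative_transform_within_open[OF dW, of "{0<..<1}"]) (use that Wz in auto)
      then show ?thesis using DERIV_unique[OF DERIV_const] by metis
    qed
    have "((\<lambda>_. 0) has_real_derivative (\<theta> \<bullet> ((hessian V (y + (1/2) *\<^sub>R \<theta>) - c *\<^sub>R mat 1) *v \<theta>))) (at (1/2))"
      by (rule has_field_derivative_transform_within_open[OF dW', of "{0<..<1}"]) (use W'z in auto)
    then have "\<theta> \<bullet> ((hessian V (y + (1/2) *\<^sub>R \<theta>) - c *\<^sub>R mat 1) *v \<theta>) = 0" using DERIV_unique[OF DERIV_const] by metis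
    then show ?thesis by (simp add: y_def)
  qed
  then show ?thesis using psd_kernel[OF psd] by (auto simp: Ker_hessian_def)
qed

text \<open>Along a kernel direction \<open>V\<close> is exactly quadratic, and symmetry of the Hessian makes its slope in that
  direction an affine function of the base point.\<close>

lemma kernel_imp_affine:
  fixes V :: "real^'n::finite \<Rightarrow> real"
  assumes V: "Ck 2 V" and psd: "\<And>x. psd (hessian V x - c *\<^sub>R mat 1)" and k: "\<theta> \<in> Ker_hessian V c"
  obtains m where "\<And>x s. V (x + s *\<^sub>R \<theta>) = V x + s * (c * (\<theta> \<bullet> x) + m) + c/2 * s\<^sup>2 * (\<theta> \<bullet> \<theta>)"
proof -
  have H: "hessian V x *v \<theta> = c *\<^sub>R \<theta>" for x
    using k by (auto simp: Ker_hessian_def matrix_vector_mult_diff_rdistrib scaleR_matrix_vector_assoc[symmetric])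
  have sym: "(hessian V x *v h) \<bullet> \<theta> = c * (h \<bullet> \<theta>)" for x h
  proof -
    have "transpose (hessian V x - c *\<^sub>R mat 1) = hessian V x - c *\<^sub>R mat 1" using psd by (simp add: psd_def)
    then have "((hessian V x - c *\<^sub>R mat 1) *v h) \<bullet> \<theta> = h \<bullet> ((hessian V x - c *\<^sub>R mat 1) *v \<theta>)"
      by (metis dot_lmul_matrix inner_commute transpose_matrix_vector)
    also have "\<dots> = 0" using k by (auto simp: Ker_hessian_def)
    finally show ?thesis using inner_shift_mat[of \<theta> "hessian V x" c h] by (simp add: inner_commute)
  qed
  define m where "m = grad V 0 \<bullet> \<theta>"
  have gm: "grad V x \<bullet> \<theta> = c * (\<theta> \<bullet> x) + m" for x
  proof -
    define W where "W = (\<lambda>s. grad V (0 + s *\<^sub>R x) \<bullet> \<theta> - s * (c * (x \<bullet> \<theta>)))"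
    have "(W has_real_derivative 0) (at t)" for t
      using DERIV_diff[OF line_derivs(2)[OF V, of 0 x \<theta> t] DERIV_cmult_right[OF DERIV_ident, of "c * (x \<bullet> \<theta>)"]]
      by (simp add: W_def sym)
    then have "W 1 = W 0" by (intro DERIV_isconst_all) auto
    then have "grad V x \<bullet> \<theta> = c * (x \<bullet> \<theta>) + grad V 0 \<bullet> \<theta>" by (simp add: W_def)
    then show ?thesis by (simp add: m_def inner_commute)
  qed
  have "V (x + s *\<^sub>R \<theta>) = V x + s * (c * (\<theta> \<bullet> x) + m) + c/2 * s\<^sup>2 * (\<theta> \<bullet> \<theta>)" for x s
  proof -
    define K where "K = c * (\<theta> \<bullet> x) + m"
    define N where "N = \<theta> \<bullet> \<theta>"
    have gK: "grad V (x + t *\<^sub>R \<theta>) \<bullet> \<theta> = K + c * t * N" for t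
      unfolding gm K_def N_def by (simp add: inner_add_right algebra_simps)
    define W where "W = (\<lambda>s. V (x + s *\<^sub>R \<theta>) - s * K - c/2 * s\<^sup>2 * N)"
    have "(W has_real_derivative 0) (at t)" for t
    proof -
      have "(W has_real_derivative (grad V (x + t *\<^sub>R \<theta>) \<bullet> \<theta> - K - c * t * N)) (at t)"
        unfolding W_def by (auto intro!: derivative_eq_intros line_derivs(1)[OF V])
      then show ?thesis by (simp add: gK)
    qed
    then have "W s = W 0" by (intro DERIV_isconst_all) auto
    then show ?thesis by (simp add: W_def K_def N_def)
  qed
  then show thesis by (rule that)
qed

section \<open>Test functions and weak gradients\<close>

lemma Ck_const: "Ck k (\<lambda>_. a)"
proof (induction k arbitrary: a)
  case (Suc k)
  then show ?case by simp
qed simp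

lemma Ck_add:
  assumes "Ck k f" "Ck k g" shows "Ck k (\<lambda>x. f x + g x)"
  using assms
proof (induction k arbitrary: f g)
  case 0
  then show ?case by (auto intro: continuous_intros)
next
  case (Suc k)
  have "frechet_derivative (\<lambda>x. f x + g x) (at x) v = frechet_derivative f (at x) v + frechet_derivative g (at x) v" for x v
  proof -
    have "((\<lambda>x. f x + g x) has_derivative (\<lambda>v. frechet_derivative f (at x) v + frechet_derivative g (at x) v)) (at x)"
      using Suc.prems by (intro has_derivative_add) (auto simp flip: frechet_derivative_works)
    from frechet_derivative_at[OF this] show ?thesis by metis
  qed
  then show ?case using Suc by auto
qed

lemma Ck_mult:
  fixes f g :: "'a::euclidean_space \<Rightarrow> real"
  assumes "Ck k f" "Ck k g" shows "Ck k (\<lambda>x. f x * g x)"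
  using assms
proof (induction k arbitrary: f g)
  case 0
  then show ?case by (auto intro: continuous_intros)
next
  case (Suc k)
  have "frechet_derivative (\<lambda>x. f x * g x) (at x) v = f x * frechet_derivative g (at x) v + frechet_derivative f (at x) v * g x" for x v
  proof -
    have "((\<lambda>x. f x * g x) has_derivative (\<lambda>v. f x * frechet_derivative g (at x) v + frechet_derivative f (at x) v * g x)) (at x)"
      using Suc.prems by (intro has_derivative_mult) (auto simp flip: frechet_derivative_works)
    from frechet_derivative_at[OF this] show ?thesis by metis
  qed
  moreover have "Ck k f" "Ck k g" using Suc.prems Ck_Suc_imp by auto
  ultimately show ?case using Suc by (auto intro!: Ck_add)
qed

lemma Ck_prod:
  fixes f :: "'i \<Rightarrow> 'a::euclidean_space \<Rightarrow> real"
  assumes "finite S" "\<And>i. i \<in> S \<Longrightarrow> Ck k (f i)" shows "Ck k (\<lambda>x. \<Prod>i\<in>S. f i x)"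
  using assms by (induction S) (auto intro: Ck_const Ck_mult)

text \<open>The functions \<open>s\<^sup>-\<^sup>m exp (- 1 / s)\<close>, extended by zero. Derivatives of members of this family are
  linear combinations of members, so smoothness of all of them follows by one induction.\<close>

definition flat :: "nat \<Rightarrow> real \<Rightarrow> real" where
  "flat m s = (if s > 0 then (1 / s) ^ m / exp (1 / s) else 0)"

lemma flat_tendsto_0: "(flat m \<longlongrightarrow> 0) (at_right 0)"
proof -
  have "filterlim (\<lambda>s::real. 1 / s) at_top (at_right 0)"
    using filterlim_inverse_at_top_right by (simp add: divide_inverse)
  then have "((\<lambda>s::real. (1 / s) ^ m / exp (1 / s)) \<longlongrightarrow> 0) (at_right 0)"
    by (rule filterlim_compose[OF tendsto_power_div_exp_0])
  then show ?thesis
    by (rule Lim_transform_eventually) (auto simp: flat_def eventually_at_filter)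
qed

lemma flat_DERIV: "DERIV (flat m) s :> flat (m + 2) s - real m * flat (m + 1) s"
proof -
  consider "s > 0" | "s < 0" | "s = 0" by linarith
  then show ?thesis
  proof cases
    case 1
    define u where "u = inverse s"
    have "DERIV (\<lambda>v. v ^ m * exp (- v)) (inverse s) :> real m * u ^ (m - 1) * exp (- u) - u ^ m * exp (- u)"
      unfolding u_def by (auto intro!: derivative_eq_intros)
    moreover have "DERIV inverse s :> - (u\<^sup>2)"
      using DERIV_inverse[of s] 1 by (simp add: u_def power2_eq_square)
    ultimately have "DERIV (\<lambda>s. inverse s ^ m * exp (- inverse s)) s :>
        (real m * u ^ (m - 1) * exp (- u) - u ^ m * exp (- u)) * (- (u\<^sup>2))"
      by (rule DERIV_chain2)
    also have "(real m * u ^ (m - 1) * exp (- u) - u ^ m * exp (- u)) * (- (u\<^sup>2))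
        = u ^ (m + 2) * exp (- u) - real m * (u ^ (m + 1) * exp (- u))"
      by (cases m) (simp_all add: algebra_simps power2_eq_square)
    also have "\<dots> = flat (m + 2) s - real m * flat (m + 1) s"
      using 1 by (simp add: flat_def u_def exp_minus divide_inverse)
    also have "(\<lambda>s. inverse s ^ m * exp (- inverse s)) = (\<lambda>s::real. (1 / s) ^ m / exp (1 / s))"
      by (simp add: exp_minus divide_inverse)
    finally have "DERIV (\<lambda>s. (1 / s) ^ m / exp (1 / s)) s :> flat (m + 2) s - real m * flat (m + 1) s" .
    then show ?thesis
      by (rule has_field_derivative_transform_within_open[where S="{0<..}"]) (use 1 in \<open>auto simp: flat_def\<close>)
  next
    case 2
    have "DERIV (\<lambda>s. 0) s :> flat (m + 2) s - real m * flat (m + 1) s" using 2 by (simp add: flat_def)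
    then show ?thesis
      by (rule has_field_derivative_transform_within_open[where S="{..<0}"]) (use 2 in \<open>auto simp: flat_def\<close>)
  next
    case 3
    have "((\<lambda>h. flat m h / h) \<longlongrightarrow> 0) (at_right 0)"
      by (rule Lim_transform_eventually[OF flat_tendsto_0[of "Suc m"]]) (auto simp: flat_def eventually_at_filter)
    moreover have "((\<lambda>h. flat m h / h) \<longlongrightarrow> 0) (at_left 0)"
      by (rule tendsto_eventually) (auto simp: flat_def eventually_at_filter)
    ultimately have "((\<lambda>h. flat m h / h) \<longlongrightarrow> 0) (at 0)" by (simp add: filterlim_split_at)
    then show ?thesis using 3 by (simp add: DERIV_def flat_def)
  qed
qed

lemma Ck_flat: "Ck k (\<lambda>x::real^'n::finite. flat m (a * x $ i + b))"
proof (induction k arbitrary: m)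
  case 0
  have "continuous_on UNIV (flat m)"
    using flat_DERIV DERIV_isCont continuous_at_imp_continuous_on by blast
  then show ?case by (auto intro!: continuous_intros continuous_on_compose2[of UNIV "flat m"])
next
  case (Suc k)
  define e where "e = (\<lambda>x::real^'n. flat (m + 2) (a * x $ i + b) - real m * flat (m + 1) (a * x $ i + b))"
  have d: "((\<lambda>x::real^'n. flat m (a * x $ i + b)) has_derivative (\<lambda>v. e x * (a * v $ i))) (at x)" for x
  proof -
    have "((\<lambda>x::real^'n. a * x $ i + b) has_derivative (\<lambda>v. a * v $ i)) (at x)"
      by (auto intro!: derivative_eq_intros bounded_linear.has_derivative[OF bounded_linear_vec_nth])
    from has_derivative_compose[OF this flat_DERIV[of m, unfolded has_field_derivative_def]]
    show ?thesis by (simp add: e_def)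
  qed
  then have f: "frechet_derivative (\<lambda>x::real^'n. flat m (a * x $ i + b)) (at x) v = e x * (a * v $ i)" for x v
    using frechet_derivative_at[OF d[of x]] by metis
  have "Ck k (\<lambda>x::real^'n. flat (m + 2) (a * x $ i + b) + (- real m) * flat (m + 1) (a * x $ i + b))"
    by (intro Ck_add Ck_mult Ck_const Suc)
  then have "Ck k e" by (simp add: e_def)
  then show ?case using d f by (auto simp: differentiable_def intro!: Ck_mult Ck_const)
qed

text \<open>Smooth functions that increase to the indicator of the open box as \<open>m\<close> grows.\<close>

definition box_bump :: "real \<Rightarrow> real^'n::finite \<Rightarrow> real^'n \<Rightarrow> real^'n \<Rightarrow> real" where
  "box_bump m a b x = (\<Prod>i\<in>UNIV. flat 0 (m * (x $ i - a $ i)) * flat 0 (m * (b $ i - x $ i)))"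

lemma flat0_bounds: "0 \<le> flat 0 s" "flat 0 s \<le> 1" by (auto simp: flat_def)

lemma box_bump_bounds: "0 \<le> box_bump m a b x" "box_bump m a b x \<le> 1"
  unfolding box_bump_def
  by (intro prod_nonneg prod_le_1 conjI mult_nonneg_nonneg mult_le_one flat0_bounds ballI)+

lemma box_bump_outside:
  assumes "m > 0" "x \<notin> box a b" shows "box_bump m a b x = 0"
proof -
  from assms(2) obtain i where i: "x $ i \<le> a $ i \<or> b $ i \<le> x $ i" by (auto simp: mem_box_cart not_less)
  have "flat 0 (m * (x $ i - a $ i)) * flat 0 (m * (b $ i - x $ i)) = 0"
    using i assms(1) by (auto simp: flat_def zero_less_mult_iff)
  then show ?thesis unfolding box_bump_def by (intro prod_zero) auto
qed

lemma box_bump_tendsto: "(\<lambda>n. box_bump (real (Suc n)) a b x) \<longlonglongrightarrow> indicator (box a b) x"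
proof (cases "x \<in> box a b")
  case False
  then show ?thesis by (simp add: box_bump_outside)
next
  case True
  have f: "(\<lambda>n. flat 0 (real (Suc n) * t)) \<longlonglongrightarrow> 1" if "t > 0" for t
  proof -
    have "(\<lambda>n. exp (- (inverse (real (Suc n)) * (1 / t)))) \<longlonglongrightarrow> exp (- (0 * (1 / t)))"
      by (intro tendsto_intros LIMSEQ_inverse_real_of_nat)
    moreover have "flat 0 (real (Suc n) * t) = exp (- (inverse (real (Suc n)) * (1 / t)))" for n
    proof -
      have "real (Suc n) * t > 0" using that by simp
      then have "flat 0 (real (Suc n) * t) = exp (- (1 / (real (Suc n) * t)))"
        unfolding flat_def by (simp only: if_True power_0 exp_minus inverse_eq_divide)
      then show ?thesis by (simp only: divide_inverse inverse_mult_distrib mult_1)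
    qed
    ultimately show ?thesis by simp
  qed
  have "(\<lambda>n. box_bump (real (Suc n)) a b x) \<longlonglongrightarrow> (\<Prod>i\<in>(UNIV::'a set). 1 * 1)"
    unfolding box_bump_def by (intro tendsto_prod tendsto_mult f) (use True in \<open>auto simp: mem_box_cart\<close>)
  then show ?thesis using True by simp
qed

lemma box_bump_test_function:
  assumes "m > 0" shows "test_function (box_bump m a b)"
proof -
  have "Ck k (box_bump m a b)" for k
  proof -
    have "Ck k (\<lambda>x. \<Prod>i\<in>UNIV. flat 0 (m * x $ i + - m * a $ i) * flat 0 (- m * x $ i + m * b $ i))"
      by (intro Ck_prod Ck_mult Ck_flat) auto
    moreover have "box_bump m a b = (\<lambda>x. \<Prod>i\<in>UNIV. flat 0 (m * x $ i + - m * a $ i) * flat 0 (- m * x $ i + m * b $ i))"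
      by (auto simp: box_bump_def fun_eq_iff algebra_simps)
    ultimately show ?thesis by simp
  qed
  moreover have "{x. box_bump m a b x \<noteq> 0} \<subseteq> cbox a b"
    using box_bump_outside[OF assms] box_subset_cbox by fastforce
  then have "compact (closure {x. box_bump m a b x \<noteq> 0})"
    by (meson bounded_cbox bounded_subset compact_closure)
  ultimately show ?thesis by (simp add: test_function_def smooth_def)
qed

lemma locally_integrable_measurable:
  fixes f :: "'a::euclidean_space \<Rightarrow> 'b::{banach,second_countable_topology}"
  assumes "locally_integrable f" shows "f \<in> borel_measurable borel"
proof (rule borel_measurable_LIMSEQ_metric)
  show "(\<lambda>x. indicator (cball 0 (real n)) x *\<^sub>R f x) \<in> borel_measurable borel" for n
  proof -
    have "set_integrable lborel (cball 0 (real n)) f"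
      by (rule assms[unfolded locally_integrable_def, rule_format]) (rule compact_cball)
    then have "integrable lborel (\<lambda>x. indicator (cball 0 (real n)) x *\<^sub>R f x)" by (simp only: set_integrable_def)
    from borel_measurable_integrable[OF this] show ?thesis by simp
  qed
  show "(\<lambda>n. indicator (cball 0 (real n)) x *\<^sub>R f x) \<longlonglongrightarrow> f x" for x
  proof (rule tendsto_eventually)
    obtain N :: nat where N: "norm x \<le> real N" using real_arch_simple by blast
    show "\<forall>\<^sub>F n in sequentially. indicator (cball 0 (real n)) x *\<^sub>R f x = f x"
      using eventually_ge_at_top[of N] by eventually_elim (use N in \<open>auto simp: indicator_def\<close>)
  qed
qed

text \<open>The bumps show that the integral over every open box vanishes; boxes determine a measure, so the
  positive and the negative part of \<open>k\<close> agree almost everywhere.\<close>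

lemma zero_of_test_functions:
  fixes k :: "real^'n::finite \<Rightarrow> real"
  assumes k: "locally_integrable k" and z: "\<And>\<phi>. test_function \<phi> \<Longrightarrow> (LINT x|lborel. k x * \<phi> x) = 0"
  shows "AE x in lborel. k x = 0"
proof -
  have [measurable]: "k \<in> borel_measurable borel" by (rule locally_integrable_measurable[OF k])
  have ic: "integrable lborel (\<lambda>x. indicator (cbox a b) x * k x)" for a b
    using k by (auto simp: locally_integrable_def set_integrable_def compact_cbox)
  have ib: "integrable lborel (\<lambda>x. indicator (box a b) x * k x)" for a b
    by (rule Bochner_Integration.integrable_bound[OF ic[of a b]]) (use box_subset_cbox in \<open>auto simp: indicator_def\<close>)
  have box0: "(LINT x|lborel. indicator (box a b) x * k x) = 0" for a b
  proof -
    have "(\<lambda>n. LINT x|lborel. k x * box_bump (real (Suc n)) a b x) \<longlonglongrightarrow> (LINT x|lborel. k x * indicator (box a b) x)"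
    proof (rule integral_dominated_convergence[where w="\<lambda>x. norm (indicator (box a b) x * k x)"])
      show "(\<lambda>x. k x * box_bump (real (Suc n)) a b x) \<in> borel_measurable lborel" for n
      proof -
        have "Ck 0 (box_bump (real (Suc n)) a b)"
          using box_bump_test_function[of "real (Suc n)" a b] unfolding test_function_def smooth_def by simp
        then have [measurable]: "box_bump (real (Suc n)) a b \<in> borel_measurable borel"
          by (intro borel_measurable_continuous_onI) simp
        show ?thesis by measurable
      qed
      show "AE x in lborel. (\<lambda>n. k x * box_bump (real (Suc n)) a b x) \<longlonglongrightarrow> k x * indicator (box a b) x"
        by (intro AE_I2 tendsto_mult tendsto_const box_bump_tendsto)
      show "AE x in lborel. norm (k x * box_bump (real (Suc n)) a b x) \<le> norm (indicator (box a b) x * k x)" for n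
      proof (rule AE_I2)
        fix x
        show "norm (k x * box_bump (real (Suc n)) a b x) \<le> norm (indicator (box a b) x * k x)"
          using box_bump_bounds[of "real (Suc n)" a b x] box_bump_outside[of "real (Suc n)" x a b]
          by (cases "x \<in> box a b") (auto simp: abs_mult mult_left_le)
      qed
    qed (use ib in auto)
    then have "(LINT x|lborel. k x * indicator (box a b) x) = 0"
      using z[OF box_bump_test_function] by (simp add: LIMSEQ_const_iff)
    then show ?thesis by (simp add: mult.commute)
  qed
  have AEn: "AE x in lborel. x \<in> box (- (real n *\<^sub>R One)) (real n *\<^sub>R One) \<longrightarrow> k x = 0" for n
  proof -
    define B :: "(real^'n) set" where "B = box (- (real n *\<^sub>R One)) (real n *\<^sub>R One)"
    have [measurable]: "B \<in> sets borel" by (simp add: B_def)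
    have BI: "\<exists>c d. B \<inter> box a b = box c d" for a b unfolding B_def box_Int_box by blast
    define P where "P = (\<lambda>x. ennreal (indicator B x * max 0 (k x)))"
    \<comment> \<open>positive and negative part, restricted to a box so that both measures are finite\<close>
    define N where "N = (\<lambda>x. ennreal (indicator B x * max 0 (- k x)))"
    have [measurable]: "P \<in> borel_measurable borel" "N \<in> borel_measurable borel" unfolding P_def N_def by measurable
    have e: "emeasure (density lborel P) (box a b) = emeasure (density lborel N) (box a b)"
      "emeasure (density lborel P) (box a b) \<noteq> \<infinity>" for a b
    proof -
      obtain c d where cd: "B \<inter> box a b = box c d" using BI by blast
      have ip: "integrable lborel (\<lambda>x. indicator (box c d) x * max 0 (k x))"
        by (rule Bochner_Integration.integrable_bound[OF ib[of c d]]) (auto simp: indicator_def)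
      have im: "integrable lborel (\<lambda>x. indicator (box c d) x * max 0 (- k x))"
        by (rule Bochner_Integration.integrable_bound[OF ib[of c d]]) (auto simp: indicator_def)
      have "emeasure (density lborel P) (box a b) = (\<integral>\<^sup>+x. ennreal (indicator (box c d) x * max 0 (k x)) \<partial>lborel)"
        by (subst emeasure_density) (auto intro!: nn_integral_cong simp: P_def cd[symmetric] indicator_def)
      also have "\<dots> = ennreal (LINT x|lborel. indicator (box c d) x * max 0 (k x))"
        by (rule nn_integral_eq_integral[OF ip]) auto
      finally have 1: "emeasure (density lborel P) (box a b) = ennreal (LINT x|lborel. indicator (box c d) x * max 0 (k x))" .
      have "emeasure (density lborel N) (box a b) = (\<integral>\<^sup>+x. ennreal (indicator (box c d) x * max 0 (- k x)) \<partial>lborel)"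
        by (subst emeasure_density) (auto intro!: nn_integral_cong simp: N_def cd[symmetric] indicator_def)
      also have "\<dots> = ennreal (LINT x|lborel. indicator (box c d) x * max 0 (- k x))"
        by (rule nn_integral_eq_integral[OF im]) auto
      finally have 2: "emeasure (density lborel N) (box a b) = ennreal (LINT x|lborel. indicator (box c d) x * max 0 (- k x))" .
      have "(LINT x|lborel. indicator (box c d) x * max 0 (k x)) - (LINT x|lborel. indicator (box c d) x * max 0 (- k x))
        = (LINT x|lborel. indicator (box c d) x * max 0 (k x) - indicator (box c d) x * max 0 (- k x))"
        using ip im by simp
      also have "\<dots> = (LINT x|lborel. indicator (box c d) x * k x)"
        by (intro Bochner_Integration.integral_cong) (auto simp: max_def indicator_def)
      finally show "emeasure (density lborel P) (box a b) = emeasure (density lborel N) (box a b)"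
        using box0 1 2 by simp
      show "emeasure (density lborel P) (box a b) \<noteq> \<infinity>" using 1 by simp
    qed
    have "density lborel P = density lborel N"
    proof (rule measure_eqI_generator_eq[where E="range (\<lambda>(a, b). box a b)" and \<Omega>=UNIV
          and A="\<lambda>i. box (- (real i *\<^sub>R One)) (real i *\<^sub>R One)"])
      show "Int_stable (range (\<lambda>(a, b). box a b :: (real^'n) set))"
        unfolding Int_stable_def by (auto simp: box_Int_box)
      show "sets (density lborel P) = sigma_sets UNIV (range (\<lambda>(a, b). box a b))"
        "sets (density lborel N) = sigma_sets UNIV (range (\<lambda>(a, b). box a b))"
        by (simp_all add: borel_eq_box)
      show "(\<Union>i. box (- (real i *\<^sub>R One)) (real i *\<^sub>R One)) = (UNIV :: (real^'n) set)"
        by (rule UN_box_eq_UNIV)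
    qed (use e in auto)
    then have "AE x in lborel. P x = N x"
      by (intro sigma_finite_measure.density_unique[OF sigma_finite_lborel]) auto
    then have "AE x in lborel. x \<in> B \<longrightarrow> k x = 0"
    proof eventually_elim
      case (elim x)
      then show ?case by (auto simp: P_def N_def max_def split: if_splits)
    qed
    then show ?thesis by (simp add: B_def)
  qed
  have "AE x in lborel. \<forall>n. x \<in> box (- (real n *\<^sub>R One)) (real n *\<^sub>R One) \<longrightarrow> k x = 0"
    unfolding AE_all_countable using AEn by blast
  then show ?thesis
  proof eventually_elim
    case (elim x)
    have "x \<in> (\<Union>i::nat. box (- (real i *\<^sub>R One)) (real i *\<^sub>R One))"
      by (subst UN_box_eq_UNIV) simp
    then show ?case using elim by blast
  qed
qed

lemma AE_axis_deriv_bounded: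
  assumes "axis_deriv i f g"
  obtains L where "L \<ge> 0" "AE x in lborel. norm x \<le> R \<longrightarrow> \<bar>g x\<bar> \<le> L"
proof -
  obtain L where L: "L \<ge> 0" "\<And>x h. norm x \<le> R \<Longrightarrow> \<bar>h\<bar> \<le> 1 \<Longrightarrow> \<bar>f (upd x i (x $ i + h)) - f x\<bar> \<le> L * \<bar>h\<bar>"
    using axis_deriv_lipschitz[OF assms] by blast
  have "AE x in lborel. norm x \<le> R \<longrightarrow> \<bar>g x\<bar> \<le> L"
    using axis_derivD(3)[OF assms]
  proof (eventually_elim, intro impI)
    fix x assume d: "((\<lambda>s. f (upd x i s)) has_real_derivative g x) (at (x $ i))" and x: "norm x \<le> R"
    have "((\<lambda>h. \<bar>(f (upd x i (x $ i + h)) - f x) / h\<bar>) \<longlongrightarrow> \<bar>g x\<bar>) (at 0)"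
      using d by (intro tendsto_rabs) (simp add: DERIV_def)
    moreover have "\<forall>\<^sub>F h in at (0::real). \<bar>(f (upd x i (x $ i + h)) - f x) / h\<bar> \<le> L"
    proof -
      have "\<forall>\<^sub>F h in at (0::real). h \<noteq> 0 \<and> \<bar>h\<bar> \<le> 1"
        unfolding eventually_at by (intro exI[of _ 1]) (auto simp: dist_real_def)
      then show ?thesis by eventually_elim (use L(2)[OF x] in \<open>auto simp: field_simps\<close>)
    qed
    ultimately show "\<bar>g x\<bar> \<le> L" by (rule tendsto_upperbound) simp
  qed
  with L(1) show thesis by (rule that)
qed

lemma integrable_AE_bounded_support:
  fixes f :: "real^'n::finite \<Rightarrow> real"
  assumes [measurable]: "f \<in> borel_measurable borel" and b: "AE x in lborel. norm x \<le> R \<longrightarrow> \<bar>f x\<bar> \<le> M" and "M \<ge> 0"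
    and s: "\<And>x. norm x > R \<Longrightarrow> f x = 0"
  shows "integrable lborel f"
proof (rule Bochner_Integration.integrable_bound)
  show "integrable lborel (\<lambda>x::real^'n. M * indicator (cball 0 R) x)"
    by (intro integrable_bounded_support[of _ M R] borel_measurable_times borel_measurable_const borel_measurable_indicator)
      (use assms(3) in auto)
  show "AE x in lborel. norm (f x) \<le> norm (M * indicator (cball 0 R) x)"
    using b
  proof eventually_elim
    case (elim x)
    then show ?case using s[of x] assms(3) by (cases "norm x \<le> R") auto
  qed
qed simp

lemma compact_norm_bound:
  fixes K :: "'a::euclidean_space set"
  assumes "compact K" obtains R where "\<And>x. x \<in> K \<Longrightarrow> norm x \<le> R"
  using compact_imp_bounded[OF assms] by (auto simp: bounded_iff)

lemma locally_integrable_real: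
  fixes f :: "real^'n::finite \<Rightarrow> real"
  assumes [measurable]: "f \<in> borel_measurable borel"
    and b: "\<And>R. \<exists>M\<ge>0. AE x in lborel. norm x \<le> R \<longrightarrow> \<bar>f x\<bar> \<le> M"
  shows "locally_integrable f"
  unfolding locally_integrable_def set_integrable_def
proof (intro allI impI)
  fix K :: "(real^'n) set" assume K: "compact K"
  obtain R where R: "\<And>x. x \<in> K \<Longrightarrow> norm x \<le> R" using compact_norm_bound[OF K] by metis
  obtain M where M: "M \<ge> 0" "AE x in lborel. norm x \<le> R \<longrightarrow> \<bar>f x\<bar> \<le> M" using b by blast
  have [measurable]: "K \<in> sets borel" using K by (rule borel_compact)
  show "integrable lborel (\<lambda>x. indicator K x *\<^sub>R f x)"
  proof (rule integrable_AE_bounded_support[of _ R M])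
    show "AE x in lborel. norm x \<le> R \<longrightarrow> \<bar>indicator K x *\<^sub>R f x\<bar> \<le> M"
      using M(2) by eventually_elim (use M(1) in \<open>auto simp: indicator_def\<close>)
  qed (use M R in \<open>auto simp: indicator_def dest!: R\<close>)
qed

lemma locally_integrable_component:
  fixes g :: "real^'n::finite \<Rightarrow> real^'n"
  shows "locally_integrable g \<longleftrightarrow> (\<forall>i. locally_integrable (\<lambda>x. g x $ i))"
proof
  assume g: "locally_integrable g"
  show "\<forall>i. locally_integrable (\<lambda>x. g x $ i)"
    unfolding locally_integrable_def set_integrable_def
  proof (intro allI impI)
    fix i and K :: "(real^'n) set" assume K: "compact K"
    have "integrable lborel (\<lambda>x. indicator K x *\<^sub>R g x)"
      using g K unfolding locally_integrable_def set_integrable_def by blast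
    then have "integrable lborel (\<lambda>x. (indicator K x *\<^sub>R g x) \<bullet> axis i 1)" by (rule integrable_inner_left)
    then show "integrable lborel (\<lambda>x. indicator K x *\<^sub>R g x $ i)" by (simp add: inner_axis)
  qed
next
  assume g: "\<forall>i. locally_integrable (\<lambda>x. g x $ i)"
  show "locally_integrable g"
    unfolding locally_integrable_def set_integrable_def
  proof (intro allI impI)
    fix K :: "(real^'n) set" assume K: "compact K"
    have "integrable lborel (\<lambda>x. indicator K x *\<^sub>R g x $ i)" for i
      using g K unfolding locally_integrable_def set_integrable_def by blast
    then have "integrable lborel (\<lambda>x. \<Sum>i\<in>UNIV. (indicator K x *\<^sub>R g x $ i) *\<^sub>R (axis i 1 :: real^'n))"
      by (intro Bochner_Integration.integrable_sum integrable_scaleR_left)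
    moreover have "(\<lambda>x. \<Sum>i\<in>UNIV. (indicator K x *\<^sub>R g x $ i) *\<^sub>R (axis i 1 :: real^'n)) = (\<lambda>x. indicator K x *\<^sub>R g x)"
      using basis_expansion[of "indicator K _ *\<^sub>R g _"] by (auto simp: scalar_mult_eq_scaleR fun_eq_iff)
    ultimately show "integrable lborel (\<lambda>x. indicator K x *\<^sub>R g x)" by simp
  qed
qed

lemma test_function_axis_deriv:
  assumes "test_function \<phi>"
  obtains R where "axis_deriv i \<phi> (partial_deriv i \<phi>)" "continuous_on UNIV (partial_deriv i \<phi>)"
    "\<And>x. norm x > R \<Longrightarrow> \<phi> x = 0" "\<And>x. norm x > R \<Longrightarrow> partial_deriv i \<phi> x = 0"
proof -
  have C: "Ck (Suc 0) \<phi>" using assms unfolding test_function_def smooth_def by blast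
  have K: "compact (closure {x. \<phi> x \<noteq> 0})" using assms unfolding test_function_def by blast
  obtain R where R: "\<And>x. x \<in> closure {x. \<phi> x \<noteq> 0} \<Longrightarrow> norm x \<le> R"
    using compact_norm_bound[OF K] by metis
  have out: "x \<in> - closure {x. \<phi> x \<noteq> 0}" if "norm x > R" for x
    using R[of x] that by auto
  have z: "\<phi> x = 0" if "x \<in> - closure {x. \<phi> x \<noteq> 0}" for x
    using that closure_subset[of "{x. \<phi> x \<noteq> 0}"] by blast
  have "partial_deriv i \<phi> x = 0" if "norm x > R" for x
  proof -
    have o: "open (- closure {x. \<phi> x \<noteq> 0})" by (intro open_Compl closed_closure)
    have "(\<phi> has_derivative (\<lambda>_. 0)) (at x)"
      by (rule has_derivative_transform_within_open[OF has_derivative_const o out[OF that]]) (rule z[symmetric])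
    then have "frechet_derivative \<phi> (at x) = (\<lambda>_. 0)" using frechet_derivative_at by metis
    then show ?thesis by (simp add: partial_deriv_def)
  qed
  moreover have "axis_deriv i \<phi> (partial_deriv i \<phi>)" using C by (intro axis_deriv_grad) simp
  moreover have "continuous_on UNIV (partial_deriv i \<phi>)" using C by (simp add: partial_deriv_def[abs_def])
  ultimately show thesis using that out z by blast
qed

text \<open>Integration by parts for the product with a test function.\<close>

lemma is_weak_gradient_axis_deriv:
  fixes f :: "real^'n::finite \<Rightarrow> real"
  assumes d: "\<And>i. axis_deriv i f (\<lambda>x. G x $ i)"
  shows "is_weak_gradient f G"
  unfolding is_weak_gradient_def
proof (intro conjI allI impI)
  have fc: "continuous_on UNIV f" using axis_derivD(1)[OF d] .
  have fm[measurable]: "f \<in> borel_measurable borel" using axis_derivD(4)[OF d] .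
  show "locally_integrable f"
  proof (intro locally_integrable_real fm)
    fix R
    obtain M where "M \<ge> 0" "\<And>x. norm x \<le> R \<Longrightarrow> \<bar>f x\<bar> \<le> M" using bounded_on_cball[OF fc] by blast
    then show "\<exists>M\<ge>0. AE x in lborel. norm x \<le> R \<longrightarrow> \<bar>f x\<bar> \<le> M" by (intro exI[of _ M]) auto
  qed
  show "locally_integrable G"
    unfolding locally_integrable_component
  proof (intro allI locally_integrable_real axis_derivD(2)[OF d])
    fix i R
    obtain L where "L \<ge> 0" "AE x in lborel. norm x \<le> R \<longrightarrow> \<bar>G x $ i\<bar> \<le> L"
      by (rule AE_axis_deriv_bounded[OF d])
    then show "\<exists>M\<ge>0. AE x in lborel. norm x \<le> R \<longrightarrow> \<bar>G x $ i\<bar> \<le> M" by blast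
  qed
  fix \<phi> i assume tf: "test_function (\<phi> :: real^'n \<Rightarrow> real)"
  obtain R where p: "axis_deriv i \<phi> (partial_deriv i \<phi>)" "continuous_on UNIV (partial_deriv i \<phi>)"
    "\<And>x. norm x > R \<Longrightarrow> \<phi> x = 0" "\<And>x. norm x > R \<Longrightarrow> partial_deriv i \<phi> x = 0"
    using test_function_axis_deriv[OF tf] by blast
  note [measurable] = axis_derivD(2,4)[OF p(1)] axis_derivD(2)[OF d]
  obtain M where M: "M \<ge> 0" "\<And>x. norm x \<le> R \<Longrightarrow> \<bar>\<phi> x\<bar> \<le> M"
    using bounded_on_cball[OF axis_derivD(1)[OF p(1)]] by blast
  obtain M' where M': "M' \<ge> 0" "\<And>x. norm x \<le> R \<Longrightarrow> \<bar>f x * partial_deriv i \<phi> x\<bar> \<le> M'"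
    using bounded_on_cball[OF continuous_on_mult[OF fc p(2)]] by blast
  obtain L where L: "L \<ge> 0" "AE x in lborel. norm x \<le> R \<longrightarrow> \<bar>G x $ i\<bar> \<le> L"
    using AE_axis_deriv_bounded[OF d] by blast
  have i1: "integrable lborel (\<lambda>x. G x $ i * \<phi> x)"
  proof (rule integrable_AE_bounded_support[of _ R "L * M"])
    show "AE x in lborel. norm x \<le> R \<longrightarrow> \<bar>G x $ i * \<phi> x\<bar> \<le> L * M"
      using L(2) by eventually_elim (use L(1) M in \<open>auto simp: abs_mult intro!: mult_mono\<close>)
  qed (use p L M in auto)
  have i2: "integrable lborel (\<lambda>x. f x * partial_deriv i \<phi> x)"
    by (rule integrable_AE_bounded_support[of _ R M']) (use p M' in auto)
  have "(LINT x|lborel. G x $ i * \<phi> x + f x * partial_deriv i \<phi> x) = 0"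
    by (rule integral_axis_deriv_eq_0(2)[OF axis_deriv_mult[OF d p(1)], of R]) (simp add: p(3))
  then show "(LINT x|lborel. f x * partial_deriv i \<phi> x) = - (LINT x|lborel. G x $ i * \<phi> x)"
    using i1 i2 by simp
qed

lemma weak_gradient_unique:
  fixes f :: "real^'n::finite \<Rightarrow> real"
  assumes g: "is_weak_gradient f g" and g': "is_weak_gradient f g'"
  shows "AE x in lborel. g x = g' x"
proof -
  have "AE x in lborel. g x $ i - g' x $ i = 0" for i
  proof (rule zero_of_test_functions)
    have li: "locally_integrable (\<lambda>x. g x $ i)" "locally_integrable (\<lambda>x. g' x $ i)"
      using g g' unfolding is_weak_gradient_def locally_integrable_component by auto
    note [measurable] = li[THEN locally_integrable_measurable]
    show "locally_integrable (\<lambda>x. g x $ i - g' x $ i)"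
      using li unfolding locally_integrable_def by (auto intro: set_integral_diff)
    fix \<phi> :: "real^'n \<Rightarrow> real" assume tf: "test_function \<phi>"
    obtain R where p: "axis_deriv i \<phi> (partial_deriv i \<phi>)" "\<And>x. norm x > R \<Longrightarrow> \<phi> x = 0"
      using test_function_axis_deriv[OF tf] by blast
    note [measurable] = axis_derivD(4)[OF p(1)]
    obtain M where M: "M \<ge> 0" "\<And>x. norm x \<le> R \<Longrightarrow> \<bar>\<phi> x\<bar> \<le> M"
      using bounded_on_cball[OF axis_derivD(1)[OF p(1)]] by blast
    have int: "integrable lborel (\<lambda>x. h x * \<phi> x)" if "locally_integrable h" for h :: "real^'n \<Rightarrow> real"
    proof (rule Bochner_Integration.integrable_bound)
      note [measurable] = that[THEN locally_integrable_measurable]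
      have "integrable lborel (\<lambda>x. indicator (cball 0 R) x *\<^sub>R h x)"
        using that unfolding locally_integrable_def set_integrable_def by auto
      then show "integrable lborel (\<lambda>x. M * (indicator (cball 0 R) x *\<^sub>R h x))" by simp
      show "AE x in lborel. norm (h x * \<phi> x) \<le> norm (M * (indicator (cball 0 R) x *\<^sub>R h x))"
      proof (rule AE_I2)
        fix x show "norm (h x * \<phi> x) \<le> norm (M * (indicator (cball 0 R) x *\<^sub>R h x))"
          using M p(2)[of x] by (cases "norm x \<le> R") (auto simp: abs_mult mult.commute intro!: mult_mono)
      qed
      show "(\<lambda>x. h x * \<phi> x) \<in> borel_measurable lborel" by measurable
    qed
    have "(LINT x|lborel. g x $ i * \<phi> x) = (LINT x|lborel. g' x $ i * \<phi> x)"
    proof -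
      have "(LINT x|lborel. f x * partial_deriv i \<phi> x) = - (LINT x|lborel. g x $ i * \<phi> x)"
        "(LINT x|lborel. f x * partial_deriv i \<phi> x) = - (LINT x|lborel. g' x $ i * \<phi> x)"
        using g g' tf unfolding is_weak_gradient_def by blast+
      then show ?thesis by linarith
    qed
    then show "(LINT x|lborel. (g x $ i - g' x $ i) * \<phi> x) = 0"
      using int[OF li(1)] int[OF li(2)] by (simp add: left_diff_distrib)
  qed
  then have "AE x in lborel. \<forall>i. g x $ i - g' x $ i = 0" by (simp add: AE_all_countable)
  then show ?thesis by eventually_elim (simp add: vec_eq_iff)
qed

text \<open>Weak gradients are unique almost everywhere, so the one chosen by the Hilbert operator can be computed
  from the derivatives along the axes.\<close>

lemma weak_grad_axis_deriv:
  fixes f :: "real^'n::finite \<Rightarrow> real"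
  assumes d: "\<And>i. axis_deriv i f (\<lambda>x. G x $ i)"
  shows "AE x in lborel. weak_grad f x = G x" "weak_grad f \<in> borel_measurable borel" "is_weak_gradient f (weak_grad f)"
proof -
  have G: "is_weak_gradient f G" by (rule is_weak_gradient_axis_deriv[OF d])
  show w: "is_weak_gradient f (weak_grad f)" unfolding weak_grad_def by (rule someI[of "is_weak_gradient f", OF G])
  show "AE x in lborel. weak_grad f x = G x" by (rule weak_gradient_unique[OF w G])
  show "weak_grad f \<in> borel_measurable borel"
    using w by (auto simp: is_weak_gradient_def intro: locally_integrable_measurable)
qed

section \<open>Minimisers in the Hopf--Lax formula\<close>

text \<open>Fubini in the form of averaging over translates: the measure of the set equals the average over
  \<open>s \<in> [0, 1]\<close> of the measures of its translates, and for fixed \<open>x\<close> the set of bad \<open>s\<close> is countable.\<close>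

lemma AE_null_of_countable_slices:
  fixes A :: "(real^'n::finite) set"
  assumes A[measurable]: "A \<in> sets borel" and c: "\<And>x. countable {s. upd x i s \<in> A}"
  shows "AE x in lborel. x \<notin> A"
proof -
  define e :: "real^'n" where "e = axis i 1"
  have t: "(\<integral>\<^sup>+x. indicator A (x + s *\<^sub>R e) \<partial>lborel) = emeasure lborel A" for s
  proof -
    have "(+) (s *\<^sub>R e) = (\<lambda>x. x + s *\<^sub>R e)" by (auto simp: add.commute)
    then have eq: "distr lborel borel (\<lambda>x. x + s *\<^sub>R e) = lborel" using lborel_distr_plus[of "s *\<^sub>R e"] by simp
    have "(\<integral>\<^sup>+x. indicator A (x + s *\<^sub>R e) \<partial>lborel) = (\<integral>\<^sup>+x. indicator A x \<partial>distr lborel borel (\<lambda>x. x + s *\<^sub>R e))"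
      by (subst nn_integral_distr) auto
    then show ?thesis by (simp add: eq)
  qed
  have z: "(\<integral>\<^sup>+s. indicator A (x + s *\<^sub>R e) * indicator {0..1::real} s \<partial>lborel) = 0" for x
  proof -
    have "countable {s. x + s *\<^sub>R e \<in> A}"
    proof -
      have "{s. x + s *\<^sub>R e \<in> A} = (\<lambda>s. s - x $ i) ` {s. upd x i s \<in> A}"
      proof (intro equalityI subsetI)
        fix s assume "s \<in> {s. x + s *\<^sub>R e \<in> A}"
        then have "x $ i + s \<in> {s. upd x i s \<in> A}" by (simp add: e_def add_axis_eq_upd)
        then show "s \<in> (\<lambda>s. s - x $ i) ` {s. upd x i s \<in> A}" by (rule rev_image_eqI) simp
      qed (auto simp: e_def upd_eq)
      then show ?thesis using c[of x] by simp
    qed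
    then have "{s. x + s *\<^sub>R e \<in> A} \<in> null_sets lborel" by (rule countable_imp_null_set_lborel)
    then have "AE s in lborel. s \<notin> {s. x + s *\<^sub>R e \<in> A}" by (rule AE_not_in)
    then have "AE s in lborel. indicator A (x + s *\<^sub>R e) * indicator {0..1::real} s = (0::ennreal)"
      by eventually_elim auto
    then show ?thesis by (simp add: nn_integral_0_iff_AE)
  qed
  have "0 = (\<integral>\<^sup>+x. (\<integral>\<^sup>+s. indicator A (x + s *\<^sub>R e) * indicator {0..1::real} s \<partial>lborel) \<partial>lborel)"
    by (simp add: z)
  also have "\<dots> = (\<integral>\<^sup>+s. (\<integral>\<^sup>+x. indicator A (x + s *\<^sub>R e) * indicator {0..1::real} s \<partial>lborel) \<partial>lborel)"
    by (rule lborel_pair.Fubini'[symmetric]) measurable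
  also have "\<dots> = (\<integral>\<^sup>+s. emeasure lborel A * indicator {0..1::real} s \<partial>lborel)"
    by (intro nn_integral_cong) (simp add: nn_integral_multc t)
  also have "\<dots> = emeasure lborel A" by (simp add: nn_integral_cmult)
  finally have "A \<in> null_sets lborel" using A by (simp add: null_sets_def)
  then show ?thesis by (rule AE_not_in)
qed

lemma tendsto_if_subsubseq:
  fixes X :: "nat \<Rightarrow> 'a::metric_space"
  assumes "\<And>r::nat \<Rightarrow> nat. strict_mono r \<Longrightarrow> \<exists>s::nat \<Rightarrow> nat. strict_mono s \<and> (\<lambda>n. X (r (s n))) \<longlonglongrightarrow> L"
  shows "X \<longlonglongrightarrow> L"
proof (rule ccontr)
  assume "\<not> X \<longlonglongrightarrow> L"
  then obtain e where e: "e > 0" "\<And>N. \<exists>n\<ge>N. \<not> dist (X n) L < e" unfolding lim_sequentially by blast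
  define A where "A = {n. \<not> dist (X n) L < e}"
  have inf: "infinite A" using e(2) unfolding infinite_nat_iff_unbounded_le A_def by blast
  obtain s where s: "(\<lambda>n. X (enumerate A (s n))) \<longlonglongrightarrow> L"
    using assms[OF strict_mono_enumerate[OF inf]] by blast
  then obtain n where "dist (X (enumerate A (s n))) L < e" using e(1) unfolding lim_sequentially by blast
  moreover have "enumerate A (s n) \<in> A" by (rule enumerate_in_set[OF inf])
  ultimately show False by (simp add: A_def)
qed

text \<open>As \<open>\<epsilon>\<close> is small against \<open>1 / T\<close>, the quadratic cost outweighs the growth of \<open>u\<close> up to time \<open>T\<close> and keeps
  minimisers at a controlled distance.\<close>

locale hopf_lax_growth =
  fixes u :: "real^'n::finite \<Rightarrow> real" and T \<epsilon> C :: real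
  assumes u_cont: "continuous_on UNIV u" and T_pos: "T > 0" and eps_pos: "\<epsilon> > 0" and eps_T: "8 * \<epsilon> * T \<le> 1"
    and C_nonneg: "C \<ge> 0" and u_bound: "\<And>x. \<bar>u x\<bar> \<le> C + \<epsilon> * (norm x)\<^sup>2"
begin

definition cost :: "real \<Rightarrow> real^'n \<Rightarrow> real^'n \<Rightarrow> real" where
  "cost \<tau> x y = u y + (norm (x - y))\<^sup>2 / (2 * \<tau>)"

definition minimizers :: "real \<Rightarrow> real^'n \<Rightarrow> (real^'n) set" where
  "minimizers \<tau> x = {y. \<forall>z. cost \<tau> x y \<le> cost \<tau> x z}"

text \<open>\<open>4 * \<tau> * growth x\<close> bounds the squared distance from \<open>x\<close> to any minimiser.\<close>

definition growth :: "real^'n \<Rightarrow> real" where "growth x = 2 * C + 3 * \<epsilon> * (norm x)\<^sup>2"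

lemma growth_nonneg: "growth x \<ge> 0" using C_nonneg eps_pos by (simp add: growth_def)

text \<open>Half of the quadratic cost absorbs the growth of \<open>u\<close> in the difference \<open>x - y\<close>.\<close>

lemma cost_lower:
  assumes "0 < \<tau>" "\<tau> \<le> T"
  shows "cost \<tau> x y \<ge> - C - 2 * \<epsilon> * (norm x)\<^sup>2 + (norm (x - y))\<^sup>2 / (4 * \<tau>)"
proof -
  have "(norm y)\<^sup>2 \<le> 2 * (norm x)\<^sup>2 + 2 * (norm (x - y))\<^sup>2"
  proof -
    have "norm y \<le> norm x + norm (x - y)" using norm_triangle_ineq4[of x "x - y"] by simp
    then have "(norm y)\<^sup>2 \<le> (norm x + norm (x - y))\<^sup>2" by (intro power_mono) auto
    also have "\<dots> \<le> 2 * (norm x)\<^sup>2 + 2 * (norm (x - y))\<^sup>2"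
      using zero_le_power2[of "norm x - norm (x - y)"] by (simp add: power2_eq_square algebra_simps)
    finally show ?thesis .
  qed
  then have "\<epsilon> * (norm y)\<^sup>2 \<le> \<epsilon> * (2 * (norm x)\<^sup>2 + 2 * (norm (x - y))\<^sup>2)" using eps_pos by (intro mult_left_mono) auto
  then have 1: "u y \<ge> - C - 2 * \<epsilon> * (norm x)\<^sup>2 - 2 * \<epsilon> * (norm (x - y))\<^sup>2"
    using u_bound[of y] by (simp add: algebra_simps)
  have "8 * \<epsilon> * \<tau> \<le> 8 * \<epsilon> * T" using assms eps_pos by (intro mult_left_mono) auto
  then have "2 * \<epsilon> \<le> 1 / (4 * \<tau>)" using eps_T assms by (simp add: field_simps)
  then have "2 * \<epsilon> * (norm (x - y))\<^sup>2 \<le> 1 / (4 * \<tau>) * (norm (x - y))\<^sup>2" by (intro mult_right_mono) auto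
  moreover have "(norm (x - y))\<^sup>2 / (2 * \<tau>) = 1 / (4 * \<tau>) * (norm (x - y))\<^sup>2 + (norm (x - y))\<^sup>2 / (4 * \<tau>)"
    using assms by (simp add: field_simps)
  ultimately show ?thesis using 1 unfolding cost_def by linarith
qed

lemma cost_le_self_imp:
  assumes "0 < \<tau>" "\<tau> \<le> T" "cost \<tau> x y \<le> u x"
  shows "(norm (x - y))\<^sup>2 \<le> 4 * \<tau> * growth x"
proof -
  have "(norm (x - y))\<^sup>2 / (4 * \<tau>) \<le> growth x"
    using cost_lower[OF assms(1,2), of x y] assms(3) u_bound[of x] unfolding growth_def by linarith
  then show ?thesis using assms(1) by (simp add: field_simps)
qed

lemma cost_self: "cost \<tau> x x = u x" by (simp add: cost_def)

lemma minimizer_bound: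
  assumes "0 < \<tau>" "\<tau> \<le> T" "y \<in> minimizers \<tau> x"
  shows "(norm (x - y))\<^sup>2 \<le> 4 * \<tau> * growth x"
proof (rule cost_le_self_imp[OF assms(1,2)])
  have "cost \<tau> x y \<le> cost \<tau> x x" using assms(3) by (simp add: minimizers_def)
  then show "cost \<tau> x y \<le> u x" by (simp add: cost_self)
qed

lemma continuous_cost: "continuous_on UNIV (cost \<tau> x)"
  unfolding cost_def by (cases "\<tau> = 0") (auto intro!: continuous_intros u_cont)

lemma minimizers_nonempty:
  assumes "0 < \<tau>" "\<tau> \<le> T" shows "\<exists>y. y \<in> minimizers \<tau> x"
proof -
  define K where "K = cball x (sqrt (4 * \<tau> * growth x))"
  have xK: "x \<in> K" using growth_nonneg assms by (simp add: K_def)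
  obtain y where y: "y \<in> K" "\<And>z. z \<in> K \<Longrightarrow> cost \<tau> x y \<le> cost \<tau> x z"
  proof -
    have "compact K" by (simp add: K_def)
    moreover have "K \<noteq> {}" using xK by blast
    moreover have "continuous_on K (cost \<tau> x)" using continuous_cost by (rule continuous_on_subset) simp
    ultimately have "\<exists>y\<in>K. \<forall>z\<in>K. cost \<tau> x y \<le> cost \<tau> x z" by (rule continuous_attains_inf)
    then show thesis using that by blast
  qed
  have "cost \<tau> x y \<le> cost \<tau> x z" for z
  proof (cases "z \<in> K")
    case False
    have "\<not> cost \<tau> x z \<le> u x"
    proof
      assume "cost \<tau> x z \<le> u x"
      from cost_le_self_imp[OF assms this] have "norm (x - z) \<le> sqrt (4 * \<tau> * growth x)"
        by (rule real_le_rsqrt)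
      then show False using False by (simp add: K_def dist_norm)
    qed
    then show ?thesis using y(2)[OF xK] cost_self[of \<tau> x] by linarith
  qed (use y in auto)
  then show ?thesis by (auto simp: minimizers_def)
qed

lemma hopf_lax_eq:
  assumes "0 < \<tau>" "y \<in> minimizers \<tau> x"
  shows "hopf_lax \<tau> u x = cost \<tau> x y"
proof -
  have "Inf (range (cost \<tau> x)) = cost \<tau> x y"
    by (rule cInf_eq_minimum) (use assms(2) in \<open>auto simp: minimizers_def\<close>)
  then show ?thesis using assms(1) by (simp add: hopf_lax_def cost_def[abs_def])
qed

lemma hopf_lax_le_cost:
  assumes "0 < \<tau>" "\<tau> \<le> T" shows "hopf_lax \<tau> u x \<le> cost \<tau> x y"
proof -
  obtain z where "z \<in> minimizers \<tau> x" using minimizers_nonempty[OF assms] by blast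
  then show ?thesis using hopf_lax_eq[OF assms(1)] by (auto simp: minimizers_def)
qed

lemma hopf_lax_le: "0 < \<tau> \<Longrightarrow> \<tau> \<le> T \<Longrightarrow> hopf_lax \<tau> u x \<le> u x"
  using hopf_lax_le_cost[of \<tau> x x] cost_self by simp

lemma hopf_lax_bound:
  assumes "0 \<le> \<tau>" "\<tau> \<le> T" shows "\<bar>hopf_lax \<tau> u x\<bar> \<le> C + 2 * \<epsilon> * (norm x)\<^sup>2"
proof (cases "\<tau> = 0")
  case True
  have "\<epsilon> * (norm x)\<^sup>2 \<ge> 0" using eps_pos by simp
  then show ?thesis using True u_bound[of x] by (simp add: hopf_lax_def)
next
  case False
  then have t: "0 < \<tau>" using assms by simp
  obtain z where z: "z \<in> minimizers \<tau> x" using minimizers_nonempty[OF t assms(2)] by blast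
  have "(norm (x - z))\<^sup>2 / (4 * \<tau>) \<ge> 0" using t by simp
  then have "hopf_lax \<tau> u x \<ge> - C - 2 * \<epsilon> * (norm x)\<^sup>2"
    using cost_lower[OF t assms(2), of x z] hopf_lax_eq[OF t z] by linarith
  moreover have "\<epsilon> * (norm x)\<^sup>2 \<ge> 0" using eps_pos by simp
  ultimately show ?thesis using hopf_lax_le[OF t assms(2), of x] u_bound[of x] by linarith
qed

lemma minimizers_closed:
  assumes t: "tn \<longlonglongrightarrow> \<tau>" "\<tau> > 0" and x: "xn \<longlonglongrightarrow> x" and y: "yn \<longlonglongrightarrow> y"
    and m: "\<And>n. yn n \<in> minimizers (tn n) (xn n)"
  shows "y \<in> minimizers \<tau> x"
  unfolding minimizers_def
proof (intro CollectI allI)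
  fix z
  have c: "(\<lambda>n. cost (tn n) (xn n) (wn n)) \<longlonglongrightarrow> cost \<tau> x w" if "wn \<longlonglongrightarrow> w" for wn w
    unfolding cost_def using t(2)
    by (intro tendsto_intros continuous_on_tendsto_compose[OF u_cont] that t x) auto
  show "cost \<tau> x y \<le> cost \<tau> x z"
    by (rule LIMSEQ_le[OF c[OF y] c[OF tendsto_const]]) (use m in \<open>auto simp: minimizers_def\<close>)
qed

text \<open>Add the two minimality inequalities with the competitors exchanged.\<close>

lemma minimizers_monotone:
  assumes "0 < \<tau>" "y \<in> minimizers \<tau> x" "y' \<in> minimizers \<tau> x'"
  shows "(x' - x) \<bullet> (y' - y) \<ge> 0"
proof -
  have "cost \<tau> x y \<le> cost \<tau> x y'" "cost \<tau> x' y' \<le> cost \<tau> x' y" using assms by (auto simp: minimizers_def)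
  then have "(norm (x - y))\<^sup>2 / (2 * \<tau>) + (norm (x' - y'))\<^sup>2 / (2 * \<tau>) \<le> (norm (x - y'))\<^sup>2 / (2 * \<tau>) + (norm (x' - y))\<^sup>2 / (2 * \<tau>)"
    unfolding cost_def by linarith
  then have "(norm (x - y))\<^sup>2 + (norm (x' - y'))\<^sup>2 \<le> (norm (x - y'))\<^sup>2 + (norm (x' - y))\<^sup>2"
    using assms(1) by (simp add: add_divide_distrib[symmetric] divide_le_cancel)
  then show ?thesis
    unfolding power2_norm_eq_inner by (simp add: inner_diff_left inner_diff_right inner_commute)
qed

definition unique_min :: "real \<Rightarrow> real^'n \<Rightarrow> bool" where
  "unique_min \<tau> x \<longleftrightarrow> (\<forall>y\<in>minimizers \<tau> x. \<forall>y'\<in>minimizers \<tau> x. y = y')"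

definition argmin_choice :: "real \<Rightarrow> real^'n \<Rightarrow> real^'n" where
  "argmin_choice \<tau> x = (SOME y. y \<in> minimizers \<tau> x)"

lemma argmin_choice: "0 < \<tau> \<Longrightarrow> \<tau> \<le> T \<Longrightarrow> argmin_choice \<tau> x \<in> minimizers \<tau> x"
  unfolding argmin_choice_def using minimizers_nonempty by (rule someI_ex)

lemma minimizer_norm_bound:
  assumes "0 < \<tau>" "\<tau> \<le> T" "y \<in> minimizers \<tau> x" "norm x \<le> R"
  shows "norm (x - y) \<le> sqrt (4 * T * (2 * C + 3 * \<epsilon> * R\<^sup>2))"
proof (rule real_le_rsqrt)
  have "(norm x)\<^sup>2 \<le> R\<^sup>2" using assms(4) by (intro power_mono) auto
  then have "growth x \<le> 2 * C + 3 * \<epsilon> * R\<^sup>2" using eps_pos by (simp add: growth_def)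
  then have "4 * \<tau> * growth x \<le> 4 * T * (2 * C + 3 * \<epsilon> * R\<^sup>2)"
    using assms growth_nonneg[of x] by (intro mult_mono) auto
  then show "(norm (x - y))\<^sup>2 \<le> 4 * T * (2 * C + 3 * \<epsilon> * R\<^sup>2)" using minimizer_bound[OF assms(1-3)] by linarith
qed

lemma minimizers_subseq:
  assumes t: "tn \<longlonglongrightarrow> \<tau>" "\<tau> > 0" "\<And>n. 0 < tn n" "\<And>n. tn n \<le> T" and x: "xn \<longlonglongrightarrow> x"
    and m: "\<And>n. yn n \<in> minimizers (tn n) (xn n)"
  obtains r y where "strict_mono r" "(yn \<circ> r) \<longlonglongrightarrow> y" "y \<in> minimizers \<tau> x"
proof -
  have "Bseq xn" using x by (intro convergent_imp_Bseq) (auto simp: convergent_def)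
  then obtain R where R: "\<And>n. norm (xn n) \<le> R" by (auto simp: Bseq_def)
  have "norm (yn n) \<le> R + sqrt (4 * T * (2 * C + 3 * \<epsilon> * R\<^sup>2))" for n
    using minimizer_norm_bound[OF t(3,4) m R, of n] R[of n] norm_triangle_ineq4[of "xn n" "xn n - yn n"] by simp
  then have "bounded (range yn)" by (auto simp: bounded_iff)
  then obtain y r where r: "strict_mono r" "(yn \<circ> r) \<longlonglongrightarrow> y"
    using bounded_imp_convergent_subsequence by blast
  have "y \<in> minimizers \<tau> x"
    by (rule minimizers_closed[of "tn \<circ> r" _ "xn \<circ> r" _ "yn \<circ> r"])
       (use t x r m in \<open>auto intro: LIMSEQ_subseq_LIMSEQ\<close>)
  with r show thesis by (rule that)
qed

lemma argmin_choice_tendsto: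
  assumes u: "unique_min \<tau> x" and t: "tn \<longlonglongrightarrow> \<tau>" "\<tau> > 0" "\<tau> \<le> T" "\<And>n. 0 < tn n" "\<And>n. tn n \<le> T" and x: "xn \<longlonglongrightarrow> x"
  shows "(\<lambda>n. argmin_choice (tn n) (xn n)) \<longlonglongrightarrow> argmin_choice \<tau> x"
proof (rule tendsto_if_subsubseq)
  fix r :: "nat \<Rightarrow> nat" assume r: "strict_mono r"
  obtain s y where s: "strict_mono s" "((\<lambda>n. argmin_choice (tn (r n)) (xn (r n))) \<circ> s) \<longlonglongrightarrow> y" "y \<in> minimizers \<tau> x"
    by (rule minimizers_subseq[of "tn \<circ> r" \<tau> "xn \<circ> r" x "\<lambda>n. argmin_choice (tn (r n)) (xn (r n))"])
       (use t x r argmin_choice in \<open>auto intro: LIMSEQ_subseq_LIMSEQ\<close>)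
  have "y = argmin_choice \<tau> x" using u s(3) argmin_choice[OF t(2,3), of x] by (auto simp: unique_min_def)
  then show "\<exists>s. strict_mono s \<and> (\<lambda>n. argmin_choice (tn (r (s n))) (xn (r (s n)))) \<longlonglongrightarrow> argmin_choice \<tau> x"
    using s by (auto simp: o_def)
qed

end

section \<open>Regularity of the Hopf--Lax semigroup\<close>

context hopf_lax_growth
begin

text \<open>Minimisers depend on the base point with closed graph and stay bounded, so limits of pairs of
  separated minimisers are again such pairs. This makes the set of non-uniqueness an \<open>F\<^sub>\<sigma>\<close> set.\<close>

lemma not_uniq_closed:
  assumes \<tau>: "0 < \<tau>" "\<tau> \<le> T"
  shows "closed {x. \<exists>y\<in>minimizers \<tau> x. \<exists>y'\<in>minimizers \<tau> x. y $ i - y' $ i \<ge> d}"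
  unfolding closed_sequential_limits
proof (intro allI impI)
  fix xn x assume a: "(\<forall>n. xn n \<in> {x. \<exists>y\<in>minimizers \<tau> x. \<exists>y'\<in>minimizers \<tau> x. y $ i - y' $ i \<ge> d}) \<and> xn \<longlonglongrightarrow> x"
  then have "\<forall>n. \<exists>y y'. y \<in> minimizers \<tau> (xn n) \<and> y' \<in> minimizers \<tau> (xn n) \<and> y $ i - y' $ i \<ge> d" by blast
  then obtain y y' where y: "\<And>n. y n \<in> minimizers \<tau> (xn n)" "\<And>n. y' n \<in> minimizers \<tau> (xn n)" "\<And>n. y n $ i - y' n $ i \<ge> d"
    by metis
  have x: "xn \<longlonglongrightarrow> x" using a by blast
  obtain r z where r: "strict_mono r" "(y \<circ> r) \<longlonglongrightarrow> z" "z \<in> minimizers \<tau> x"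
    using minimizers_subseq[of "\<lambda>_. \<tau>" \<tau> xn x y] \<tau> x y(1) by auto
  obtain s z' where s: "strict_mono s" "((y' \<circ> r) \<circ> s) \<longlonglongrightarrow> z'" "z' \<in> minimizers \<tau> x"
    using minimizers_subseq[of "\<lambda>_. \<tau>" \<tau> "xn \<circ> r" x "y' \<circ> r"] \<tau> LIMSEQ_subseq_LIMSEQ[OF x r(1)] y(2) by auto
  have "((y \<circ> r) \<circ> s) \<longlonglongrightarrow> z" by (rule LIMSEQ_subseq_LIMSEQ[OF r(2) s(1)])
  then have "(\<lambda>n. ((y \<circ> r) \<circ> s) n $ i - ((y' \<circ> r) \<circ> s) n $ i) \<longlonglongrightarrow> z $ i - z' $ i"
    using s(2) by (intro tendsto_diff tendsto_vec_nth)
  then have "d \<le> z $ i - z' $ i"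
    by (rule tendsto_lowerbound) (use y(3) in auto)
  then show "x \<in> {x. \<exists>y\<in>minimizers \<tau> x. \<exists>y'\<in>minimizers \<tau> x. y $ i - y' $ i \<ge> d}" using r(3) s(3) by blast
qed

text \<open>By monotonicity along the line, the intervals of \<open>i\<close>-th coordinates spanned by the minimisers over
  distinct points do not overlap; choosing a rational in each of them is injective.\<close>

lemma not_uniq_slice_countable:
  assumes \<tau>: "0 < \<tau>" "\<tau> \<le> T" and d: "d > 0"
  shows "countable {s. upd x i s \<in> {x. \<exists>y\<in>minimizers \<tau> x. \<exists>y'\<in>minimizers \<tau> x. y $ i - y' $ i \<ge> d}}"
proof -
  define S where "S = {s. \<exists>y\<in>minimizers \<tau> (upd x i s). \<exists>y'\<in>minimizers \<tau> (upd x i s). y $ i - y' $ i \<ge> d}"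
  define R where "R = (\<lambda>s r. r \<in> \<rat> \<and> (\<exists>y\<in>minimizers \<tau> (upd x i s). \<exists>y'\<in>minimizers \<tau> (upd x i s). y' $ i < r \<and> r < y $ i))"
  have "\<exists>r. R s r" if sS: "s \<in> S" for s
  proof -
    obtain y y' where y: "y \<in> minimizers \<tau> (upd x i s)" "y' \<in> minimizers \<tau> (upd x i s)" "y $ i - y' $ i \<ge> d"
      using sS unfolding S_def mem_Collect_eq by blast
    then have "y' $ i < y $ i" using d by linarith
    then obtain r where "r \<in> \<rat>" "y' $ i < r" "r < y $ i" using Rats_dense_in_real by blast
    then show ?thesis unfolding R_def using y by (intro exI[of _ r] conjI bexI[of _ y] bexI[of _ y'])
  qed
  then have "\<forall>s\<in>S. \<exists>r. R s r" by (intro ballI)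
  then obtain r where r: "\<forall>s\<in>S. R s (r s)" using bchoice[of S R] by blast
  have lt: "r s < r s'" if s: "s \<in> S" "s' \<in> S" "s < s'" for s s'
  proof -
    obtain a where a: "a \<in> minimizers \<tau> (upd x i s)" "r s < a $ i" using r[rule_format, OF s(1)] unfolding R_def by blast
    obtain b where b: "b \<in> minimizers \<tau> (upd x i s')" "b $ i < r s'" using r[rule_format, OF s(2)] unfolding R_def by blast
    have "(upd x i s' - upd x i s) \<bullet> (b - a) \<ge> 0" by (rule minimizers_monotone[OF \<tau>(1) a(1) b(1)])
    moreover have "upd x i s' - upd x i s = (s' - s) *\<^sub>R axis i 1" by (auto simp: vec_eq_iff axis_def)
    ultimately have "0 \<le> (s' - s) * (b $ i - a $ i)" by (simp add: inner_axis')
    then have "a $ i \<le> b $ i" using s(3) by (simp add: zero_le_mult_iff)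
    then show ?thesis using a(2) b(2) by linarith
  qed
  have "inj_on r S"
  proof (rule inj_onI)
    fix s s' assume "s \<in> S" "s' \<in> S" "r s = r s'"
    then show "s = s'" using lt[of s s'] lt[of s' s] by (cases s s' rule: linorder_cases) simp_all
  qed
  moreover have "r ` S \<subseteq> \<rat>" using r by (auto simp: R_def)
  then have "countable (r ` S)" by (rule countable_subset) (rule countable_rat)
  ultimately have "countable S" by (rule countable_image_inj_on[rotated])
  then show ?thesis by (simp add: S_def)
qed

lemma not_uniq_eq:
  "{x. \<not> unique_min \<tau> x} = (\<Union>i. \<Union>m::nat. {x. \<exists>y\<in>minimizers \<tau> x. \<exists>y'\<in>minimizers \<tau> x. y $ i - y' $ i \<ge> inverse (real (Suc m))})"
    (is "_ = (\<Union>i. \<Union>m. ?N i m)")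
proof (intro equalityI subsetI)
  fix x assume "x \<in> {x. \<not> unique_min \<tau> x}"
  then obtain y y' where y: "y \<in> minimizers \<tau> x" "y' \<in> minimizers \<tau> x" "y \<noteq> y'" by (auto simp: unique_min_def)
  then obtain i where "y $ i \<noteq> y' $ i" by (auto simp: vec_eq_iff)
  then consider "y $ i - y' $ i > 0" | "y' $ i - y $ i > 0" by linarith
  then show "x \<in> (\<Union>i. \<Union>m. ?N i m)"
  proof cases
    case 1
    obtain m where "inverse (real (Suc m)) < y $ i - y' $ i" using reals_Archimedean[OF 1] by blast
    then have "x \<in> ?N i m" using y by (intro CollectI bexI[of _ y] bexI[of _ y']) auto
    then show ?thesis by blast
  next
    case 2
    obtain m where "inverse (real (Suc m)) < y' $ i - y $ i" using reals_Archimedean[OF 2] by blast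
    then have "x \<in> ?N i m" using y by (intro CollectI bexI[of _ y'] bexI[of _ y]) auto
    then show ?thesis by blast
  qed
next
  fix x assume "x \<in> (\<Union>i. \<Union>m. ?N i m)"
  then obtain i m y y' where y: "y \<in> minimizers \<tau> x" "y' \<in> minimizers \<tau> x" "y $ i - y' $ i \<ge> inverse (real (Suc m))" by blast
  have "inverse (real (Suc m)) > 0" by simp
  then have "y \<noteq> y'" using y(3) by auto
  then show "x \<in> {x. \<not> unique_min \<tau> x}" using y by (auto simp: unique_min_def)
qed

lemma unique_min_AE:
  assumes \<tau>: "0 < \<tau>" "\<tau> \<le> T"
  shows "{x. unique_min \<tau> x} \<in> sets borel" "AE x in lborel. unique_min \<tau> x"
proof -
  let ?N = "\<lambda>i m. {x. \<exists>y\<in>minimizers \<tau> x. \<exists>y'\<in>minimizers \<tau> x. y $ i - y' $ i \<ge> inverse (real (Suc m))}"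
  have b: "?N i m \<in> sets borel" for i m by (rule borel_closed[OF not_uniq_closed[OF \<tau>]])
  have nU: "(\<Union>m. ?N i m) \<in> sets borel" for i
    by (intro sets.countable_UN image_subsetI b)
  have "{x. \<not> unique_min \<tau> x} \<in> sets borel" unfolding not_uniq_eq
    by (rule sets.finite_UN[OF finite nU])
  then have "- {x. \<not> unique_min \<tau> x} \<in> sets borel" by (rule borel_comp)
  then show "{x. unique_min \<tau> x} \<in> sets borel" by (simp add: Collect_neg_eq[symmetric])
  have "AE x in lborel. x \<notin> ?N i m" for i m
    by (rule AE_null_of_countable_slices[OF b]) (rule not_uniq_slice_countable[OF \<tau>], simp)
  then have "AE x in lborel. \<forall>i m. x \<notin> ?N i m" unfolding AE_all_countable by blast
  then show "AE x in lborel. unique_min \<tau> x"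
  proof eventually_elim
    case (elim x)
    then have "x \<notin> {x. \<not> unique_min \<tau> x}" unfolding not_uniq_eq by blast
    then show ?case by blast
  qed
qed

lemma hopf_lax_diff_le:
  assumes "0 < \<tau>" "0 < \<sigma>" "\<sigma> \<le> T" "y \<in> minimizers \<tau> x"
  shows "hopf_lax \<sigma> u x' - hopf_lax \<tau> u x \<le> (norm (x' - y))\<^sup>2 / (2 * \<sigma>) - (norm (x - y))\<^sup>2 / (2 * \<tau>)"
  using hopf_lax_le_cost[OF assms(2,3), of x' y] hopf_lax_eq[OF assms(1,4)] unfolding cost_def by linarith

lemma norm_upd_sq: "(norm (upd x i (x $ i + h) - z))\<^sup>2 = (norm (x - z))\<^sup>2 + (2 * h * (x $ i - z $ i) + h\<^sup>2)"
  for x z :: "real^'n"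
proof -
  have "upd x i (x $ i + h) - z = (x - z) + h *\<^sub>R axis i 1" by (simp add: add_axis_eq_upd[symmetric])
  then have "(norm (upd x i (x $ i + h) - z))\<^sup>2 = ((x - z) + h *\<^sub>R axis i 1) \<bullet> ((x - z) + h *\<^sub>R axis i 1)"
    by (simp only: power2_norm_eq_inner)
  also have "\<dots> = (x - z) \<bullet> (x - z) + 2 * h * ((x - z) \<bullet> axis i 1) + h * h * (axis i 1 \<bullet> (axis i 1 :: real^'n))"
    by (simp add: inner_add_left inner_add_right inner_commute)
  also have "\<dots> = (norm (x - z))\<^sup>2 + (2 * h * (x $ i - z $ i) + h\<^sup>2)"
    unfolding power2_norm_eq_inner by (simp add: inner_axis inner_axis_axis power2_eq_square)
  finally show ?thesis .
qed

lemma hopf_lax_axis_increment: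
  assumes \<tau>: "0 < \<tau>" "\<tau> \<le> T" and y: "y \<in> minimizers \<tau> x" and yh: "yh \<in> minimizers \<tau> (upd x i (x $ i + h))"
  defines "D \<equiv> hopf_lax \<tau> u (upd x i (x $ i + h)) - hopf_lax \<tau> u x"
  shows "D \<le> (2 * h * (x $ i - y $ i) + h\<^sup>2) / (2 * \<tau>)" "D \<ge> (2 * h * (x $ i - yh $ i) + h\<^sup>2) / (2 * \<tau>)"
proof -
  show "D \<le> (2 * h * (x $ i - y $ i) + h\<^sup>2) / (2 * \<tau>)"
    using hopf_lax_diff_le[OF \<tau>(1) \<tau> y, of "upd x i (x $ i + h)"] unfolding D_def norm_upd_sq
    by (simp add: add_divide_distrib)
  show "D \<ge> (2 * h * (x $ i - yh $ i) + h\<^sup>2) / (2 * \<tau>)"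
    using hopf_lax_diff_le[OF \<tau>(1) \<tau> yh, of x] unfolding D_def norm_upd_sq
    by (simp add: add_divide_distrib)
qed

text \<open>The minimiser at \<open>x\<close> bounds the increment from above and the minimiser at the neighbouring point from
  below; the two bounds merge because minimisers converge to a unique minimiser.\<close>

lemma hopf_lax_axis_DERIV:
  assumes \<tau>: "0 < \<tau>" "\<tau> \<le> T" and u: "unique_min \<tau> x"
  shows "((\<lambda>s. hopf_lax \<tau> u (upd x i s)) has_real_derivative ((x - argmin_choice \<tau> x) $ i / \<tau>)) (at (x $ i))"
  unfolding DERIV_def
proof (subst tendsto_at_iff_sequentially, intro allI impI)
  fix h :: "nat \<Rightarrow> real" assume h: "\<forall>n. h n \<in> UNIV - {0}" "h \<longlonglongrightarrow> 0"
  define y where "y = argmin_choice \<tau> x"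
  define yn where "yn = (\<lambda>n. argmin_choice \<tau> (upd x i (x $ i + h n)))"
  have h0: "h n \<noteq> 0" for n using h(1) by auto
  have "(\<lambda>n. upd x i (x $ i + h n)) \<longlonglongrightarrow> upd x i (x $ i + 0)" by (intro tendsto_intros h(2))
  then have "yn \<longlonglongrightarrow> y" unfolding yn_def y_def
    using \<tau> by (intro argmin_choice_tendsto[OF u]) auto
  then have "(\<lambda>n. \<bar>h n\<bar> / (2 * \<tau>) + \<bar>yn n $ i - y $ i\<bar> / \<tau>) \<longlonglongrightarrow> \<bar>0\<bar> / (2 * \<tau>) + \<bar>y $ i - y $ i\<bar> / \<tau>"
    using \<tau> by (intro tendsto_intros h(2)) auto
  then have e0: "(\<lambda>n. \<bar>h n\<bar> / (2 * \<tau>) + \<bar>yn n $ i - y $ i\<bar> / \<tau>) \<longlonglongrightarrow> 0" by simp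
  define Dq where "Dq = (\<lambda>n. hopf_lax \<tau> u (upd x i (x $ i + h n)) - hopf_lax \<tau> u x)"
  have b: "\<bar>Dq n / h n - (x - y) $ i / \<tau>\<bar> \<le> \<bar>h n\<bar> / (2 * \<tau>) + \<bar>yn n $ i - y $ i\<bar> / \<tau>" for n
  proof -
    have 1: "Dq n \<le> (2 * h n * (x $ i - y $ i) + (h n)\<^sup>2) / (2 * \<tau>)" "Dq n \<ge> (2 * h n * (x $ i - yn n $ i) + (h n)\<^sup>2) / (2 * \<tau>)"
      unfolding Dq_def y_def yn_def
      by (rule hopf_lax_axis_increment(1)[OF \<tau> argmin_choice[OF \<tau>] argmin_choice[OF \<tau>]],
        rule hopf_lax_axis_increment(2)[OF \<tau> argmin_choice[OF \<tau>] argmin_choice[OF \<tau>]])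
    have e1: "(2 * h n * (x $ i - y $ i) + (h n)\<^sup>2) / (2 * \<tau>) = h n * ((x - y) $ i / \<tau>) + (h n)\<^sup>2 / (2 * \<tau>)"
      using \<tau> by (simp add: field_simps)
    have e2: "(2 * h n * (x $ i - yn n $ i) + (h n)\<^sup>2) / (2 * \<tau>) = h n * ((x - y) $ i / \<tau>) - h n * ((yn n $ i - y $ i) / \<tau>) + (h n)\<^sup>2 / (2 * \<tau>)"
      using \<tau> by (simp add: field_simps)
    have "(h n)\<^sup>2 / (2 * \<tau>) \<ge> 0" using \<tau> by simp
    moreover have "h n * ((yn n $ i - y $ i) / \<tau>) \<le> \<bar>h n\<bar> * (\<bar>yn n $ i - y $ i\<bar> / \<tau>)"
      using \<tau> by (metis abs_ge_self abs_mult abs_divide abs_of_pos)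
    moreover have "\<bar>h n\<bar> * (\<bar>yn n $ i - y $ i\<bar> / \<tau>) \<ge> 0" using \<tau> by simp
    ultimately have "\<bar>Dq n - h n * ((x - y) $ i / \<tau>)\<bar> \<le> (h n)\<^sup>2 / (2 * \<tau>) + \<bar>h n\<bar> * (\<bar>yn n $ i - y $ i\<bar> / \<tau>)"
      using 1 unfolding e1 e2 by (intro abs_leI) linarith+
    also have "\<dots> = \<bar>h n\<bar> * (\<bar>h n\<bar> / (2 * \<tau>) + \<bar>yn n $ i - y $ i\<bar> / \<tau>)"
      by (simp add: distrib_left power2_eq_square)
    finally have "\<bar>Dq n - h n * ((x - y) $ i / \<tau>)\<bar> / \<bar>h n\<bar> \<le> \<bar>h n\<bar> / (2 * \<tau>) + \<bar>yn n $ i - y $ i\<bar> / \<tau>"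
      using h0[of n] by (simp add: divide_le_eq mult.commute)
    moreover have "Dq n / h n - (x - y) $ i / \<tau> = (Dq n - h n * ((x - y) $ i / \<tau>)) / h n"
      using h0[of n] by (simp add: diff_divide_distrib)
    ultimately show ?thesis by (simp add: abs_divide)
  qed
  have "(\<lambda>n. Dq n / h n - (x - y) $ i / \<tau>) \<longlonglongrightarrow> 0"
    by (rule Lim_null_comparison[OF _ e0]) (use b in auto)
  then have "(\<lambda>n. Dq n / h n) \<longlonglongrightarrow> (x - y) $ i / \<tau>" by (simp add: LIM_zero_iff)
  then show "((\<lambda>h. (hopf_lax \<tau> u (upd x i (x $ i + h)) - hopf_lax \<tau> u (upd x i (x $ i))) / h) \<circ> h) \<longlonglongrightarrow> (x - argmin_choice \<tau> x) $ i / \<tau>"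
    by (simp add: Dq_def y_def o_def)
qed

lemma hopf_lax_axis_lipschitz:
  assumes \<tau>: "0 < \<tau>" "\<tau> \<le> T" and x: "norm x \<le> R" and h: "\<bar>h\<bar> \<le> 1"
  shows "\<bar>hopf_lax \<tau> u (upd x i (x $ i + h)) - hopf_lax \<tau> u x\<bar> \<le> ((sqrt (4 * T * (2 * C + 3 * \<epsilon> * (R + 1)\<^sup>2)) + 1) / \<tau>) * \<bar>h\<bar>"
proof -
  define K where "K = sqrt (4 * T * (2 * C + 3 * \<epsilon> * (R + 1)\<^sup>2))"
  define y where "y = argmin_choice \<tau> x"
  define xh where "xh = upd x i (x $ i + h)"
  define yh where "yh = argmin_choice \<tau> xh"
  define D where "D = hopf_lax \<tau> u xh - hopf_lax \<tau> u x"
  have y: "y \<in> minimizers \<tau> x" "yh \<in> minimizers \<tau> xh" using argmin_choice[OF \<tau>] by (auto simp: y_def yh_def)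
  have "norm (x - y) \<le> K" unfolding K_def by (rule minimizer_norm_bound[OF \<tau> y(1)]) (use x in simp)
  then have y1: "\<bar>x $ i - y $ i\<bar> \<le> K" using component_le_norm_cart[of "x - y" i] by simp
  have "norm (xh - yh) \<le> K" unfolding K_def
    by (rule minimizer_norm_bound[OF \<tau> y(2)]) (use norm_upd_le[OF x h] in \<open>simp add: xh_def\<close>)
  then have y2: "\<bar>xh $ i - yh $ i\<bar> \<le> K" using component_le_norm_cart[of "xh - yh" i] by simp
  have xh: "xh $ i = x $ i + h" by (simp add: xh_def)
  have h2: "h\<^sup>2 \<le> \<bar>h\<bar>" using h by (metis abs_ge_zero mult_left_le power2_abs power2_eq_square)
  have D: "D \<le> (2 * h * (x $ i - y $ i) + h\<^sup>2) / (2 * \<tau>)" "D \<ge> (2 * h * (x $ i - yh $ i) + h\<^sup>2) / (2 * \<tau>)"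
    unfolding D_def xh_def
    by (rule hopf_lax_axis_increment(1)[OF \<tau> y(1) y(2)[unfolded xh_def]],
      rule hopf_lax_axis_increment(2)[OF \<tau> y(1) y(2)[unfolded xh_def]])
  have m1: "h * (x $ i - y $ i) \<le> K * \<bar>h\<bar>"
    using mult_mono[OF order_refl y1, of "\<bar>h\<bar>"] abs_ge_self[of "h * (x $ i - y $ i)"] by (simp add: abs_mult mult.commute)
  have m2: "h * (xh $ i - yh $ i) \<ge> - (K * \<bar>h\<bar>)"
    using mult_mono[OF order_refl y2, of "\<bar>h\<bar>"] abs_ge_minus_self[of "h * (xh $ i - yh $ i)"] by (simp add: abs_mult mult.commute)
  have a1: "(2 * h * (x $ i - y $ i) + h\<^sup>2) / (2 * \<tau>) \<le> (2 * (K + 1) * \<bar>h\<bar>) / (2 * \<tau>)"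
    using m1 h2 \<tau> abs_ge_zero[of h] by (intro divide_right_mono) (auto simp: algebra_simps)
  have a2: "- ((2 * (K + 1) * \<bar>h\<bar>) / (2 * \<tau>)) \<le> (2 * h * (x $ i - yh $ i) + h\<^sup>2) / (2 * \<tau>)"
  proof -
    have "- (2 * (K + 1) * \<bar>h\<bar>) \<le> 2 * h * (x $ i - yh $ i) + h\<^sup>2"
      using m2 h2 abs_ge_zero[of h] unfolding xh by (simp add: algebra_simps power2_eq_square)
    from divide_right_mono[OF this, of "2 * \<tau>"] show ?thesis using \<tau> by simp
  qed
  have "\<bar>D\<bar> \<le> (2 * (K + 1) * \<bar>h\<bar>) / (2 * \<tau>)"
    using order_trans[OF D(1) a1] order_trans[OF a2 D(2)] unfolding abs_le_iff by (subst minus_le_iff) (rule conjI)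
  also have "\<dots> = ((K + 1) / \<tau>) * \<bar>h\<bar>" using \<tau> by (simp add: field_simps)
  finally show ?thesis by (simp only: D_def xh_def K_def)
qed

lemma hopf_lax_tendsto:
  assumes t: "tn \<longlonglongrightarrow> \<tau>" "\<tau> > 0" "\<And>n. 0 < tn n" "\<And>n. tn n \<le> T" and x: "xn \<longlonglongrightarrow> x"
  shows "(\<lambda>n. hopf_lax (tn n) u (xn n)) \<longlonglongrightarrow> hopf_lax \<tau> u x"
proof (rule tendsto_if_subsubseq)
  fix r :: "nat \<Rightarrow> nat" assume r: "strict_mono r"
  define yn where "yn = (\<lambda>n. argmin_choice (tn (r n)) (xn (r n)))"
  have ym: "yn n \<in> minimizers (tn (r n)) (xn (r n))" for n unfolding yn_def by (rule argmin_choice[OF t(3,4)])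
  have tr: "(\<lambda>n. tn (r n)) \<longlonglongrightarrow> \<tau>" "(\<lambda>n. xn (r n)) \<longlonglongrightarrow> x"
    using LIMSEQ_subseq_LIMSEQ[OF t(1) r] LIMSEQ_subseq_LIMSEQ[OF x r] by (auto simp: o_def)
  obtain s y where s: "strict_mono s" "(yn \<circ> s) \<longlonglongrightarrow> y" "y \<in> minimizers \<tau> x"
    by (rule minimizers_subseq[OF tr(1) t(2) t(3) t(4) tr(2) ym])
  have trs: "(\<lambda>n. tn (r (s n))) \<longlonglongrightarrow> \<tau>" "(\<lambda>n. xn (r (s n))) \<longlonglongrightarrow> x"
    using LIMSEQ_subseq_LIMSEQ[OF tr(1) s(1)] LIMSEQ_subseq_LIMSEQ[OF tr(2) s(1)] by (auto simp: o_def)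
  have "(\<lambda>n. cost (tn (r (s n))) (xn (r (s n))) (yn (s n))) \<longlonglongrightarrow> cost \<tau> x y"
    unfolding cost_def using t(2) s(2)
    by (intro tendsto_intros continuous_on_tendsto_compose[OF u_cont] trs) (auto simp: o_def)
  moreover have "hopf_lax (tn (r (s n))) u (xn (r (s n))) = cost (tn (r (s n))) (xn (r (s n))) (yn (s n))" for n
    by (rule hopf_lax_eq[OF t(3) ym])
  moreover have "hopf_lax \<tau> u x = cost \<tau> x y" by (rule hopf_lax_eq[OF t(2) s(3)])
  ultimately show "\<exists>s. strict_mono s \<and> (\<lambda>n. hopf_lax (tn (r (s n))) u (xn (r (s n)))) \<longlonglongrightarrow> hopf_lax \<tau> u x"
    using s(1) by auto
qed

lemma continuous_hopf_lax:
  assumes "0 \<le> \<tau>" "\<tau> \<le> T" shows "continuous_on UNIV (hopf_lax \<tau> u)"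
proof (cases "\<tau> = 0")
  case True
  then show ?thesis using u_cont by (simp add: hopf_lax_def[abs_def])
next
  case False
  then show ?thesis unfolding continuous_on_sequentially comp_def
    using hopf_lax_tendsto[of "\<lambda>_. \<tau>" \<tau>] assms by auto
qed

text \<open>The value zero at points of non-uniqueness keeps the bound of the gradient valid everywhere.\<close>

definition hl_grad :: "real \<Rightarrow> real^'n \<Rightarrow> real^'n" where
  "hl_grad \<tau> x = (if unique_min \<tau> x then (1 / \<tau>) *\<^sub>R (x - argmin_choice \<tau> x) else 0)"

lemma axis_deriv_hopf_lax:
  assumes \<tau>: "0 < \<tau>" "\<tau> \<le> T"
  shows "axis_deriv i (hopf_lax \<tau> u) (\<lambda>x. hl_grad \<tau> x $ i)"
  unfolding axis_deriv_def
proof (intro conjI allI)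
  show c: "continuous_on UNIV (hopf_lax \<tau> u)" using \<tau> by (intro continuous_hopf_lax) auto
  have d: "((\<lambda>s. hopf_lax \<tau> u (upd x i s)) has_real_derivative hl_grad \<tau> x $ i) (at (x $ i))" if "unique_min \<tau> x" for x
    using hopf_lax_axis_DERIV[OF \<tau> that, of i] that by (simp add: hl_grad_def)
  show "AE x in lborel. ((\<lambda>s. hopf_lax \<tau> u (upd x i s)) has_real_derivative hl_grad \<tau> x $ i) (at (x $ i))"
    using unique_min_AE(2)[OF \<tau>] by eventually_elim (rule d)
  show "\<exists>L. \<forall>x h. norm x \<le> R \<longrightarrow> \<bar>h\<bar> \<le> 1 \<longrightarrow> \<bar>hopf_lax \<tau> u (upd x i (x $ i + h)) - hopf_lax \<tau> u x\<bar> \<le> L * \<bar>h\<bar>" for R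
    using hopf_lax_axis_lipschitz[OF \<tau>] by blast
  have [measurable]: "hopf_lax \<tau> u \<in> borel_measurable borel" using c by (rule borel_measurable_continuous_onI)
  have [measurable]: "Measurable.pred borel (unique_min \<tau>)" using unique_min_AE(1)[OF \<tau>] by (simp add: pred_def)
  show "(\<lambda>x. hl_grad \<tau> x $ i) \<in> borel_measurable borel"
  proof (rule borel_measurable_LIMSEQ_real)
    fix x
    define h where "h = (\<lambda>n. inverse (real (Suc n)))"
    have h: "h \<longlonglongrightarrow> 0" unfolding h_def by (rule LIMSEQ_inverse_real_of_nat)
    show "(\<lambda>n. if unique_min \<tau> x then (hopf_lax \<tau> u (x + inverse (real (Suc n)) *\<^sub>R axis i 1) - hopf_lax \<tau> u x) / inverse (real (Suc n)) else 0) \<longlonglongrightarrow> hl_grad \<tau> x $ i"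
    proof (cases "unique_min \<tau> x")
      case True
      from d[OF True] have "((\<lambda>t. (hopf_lax \<tau> u (upd x i (x $ i + t)) - hopf_lax \<tau> u x) / t) \<longlongrightarrow> hl_grad \<tau> x $ i) (at 0)"
        by (simp add: DERIV_def)
      moreover have "filterlim h (at 0) sequentially" using h by (auto simp: filterlim_at h_def)
      ultimately have "(\<lambda>n. (hopf_lax \<tau> u (upd x i (x $ i + h n)) - hopf_lax \<tau> u x) / h n) \<longlonglongrightarrow> hl_grad \<tau> x $ i"
        by (rule filterlim_compose)
      then show ?thesis using True by (simp add: h_def add_axis_eq_upd)
    next
      case False then show ?thesis by (simp add: hl_grad_def)
    qed
  qed measurable
qed

lemma hl_grad_bound:
  assumes \<tau>: "0 < \<tau>" "\<tau> \<le> T" shows "(norm (hl_grad \<tau> x))\<^sup>2 \<le> 4 * growth x / \<tau>"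
proof (cases "unique_min \<tau> x")
  case True
  have "(norm (hl_grad \<tau> x))\<^sup>2 = (norm (x - argmin_choice \<tau> x))\<^sup>2 / \<tau>\<^sup>2"
    using True \<tau> by (simp add: hl_grad_def power_divide)
  also have "\<dots> \<le> (4 * \<tau> * growth x) / \<tau>\<^sup>2"
    by (intro divide_right_mono minimizer_bound[OF \<tau> argmin_choice[OF \<tau>]]) auto
  also have "\<dots> = 4 * growth x / \<tau>" using \<tau> by (simp add: power2_eq_square)
  finally show ?thesis .
qed (use \<tau> growth_nonneg in \<open>simp add: hl_grad_def\<close>)

lemma hopf_lax_time_increment:
  assumes \<tau>: "0 < \<tau>" "\<tau> \<le> T" and \<sigma>: "0 < \<sigma>" "\<sigma> \<le> T" and y: "y \<in> minimizers \<tau> x" and z: "z \<in> minimizers \<sigma> x"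
  shows "hopf_lax \<sigma> u x - hopf_lax \<tau> u x \<le> (norm (x - y))\<^sup>2 / 2 * (1 / \<sigma> - 1 / \<tau>)"
    "hopf_lax \<sigma> u x - hopf_lax \<tau> u x \<ge> (norm (x - z))\<^sup>2 / 2 * (1 / \<sigma> - 1 / \<tau>)"
  using hopf_lax_diff_le[OF \<tau>(1) \<sigma> y, of x] hopf_lax_diff_le[OF \<sigma>(1) \<tau> z, of x]
  by (simp_all add: right_diff_distrib)

lemma hopf_lax_time_lipschitz:
  assumes \<tau>: "0 < \<tau>" "\<tau> \<le> T" and \<sigma>: "0 < \<sigma>" "\<sigma> \<le> T"
  shows "\<bar>hopf_lax \<sigma> u x - hopf_lax \<tau> u x\<bar> \<le> 2 * growth x * (1 / \<sigma> + 1 / \<tau>) * \<bar>\<sigma> - \<tau>\<bar>"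
proof -
  define y where "y = argmin_choice \<tau> x"
  define z where "z = argmin_choice \<sigma> x"
  have y: "y \<in> minimizers \<tau> x" "z \<in> minimizers \<sigma> x" using argmin_choice \<tau> \<sigma> by (auto simp: y_def z_def)
  have a: "\<bar>1 / \<sigma> - 1 / \<tau>\<bar> = \<bar>\<sigma> - \<tau>\<bar> / (\<sigma> * \<tau>)"
  proof -
    have "1 / \<sigma> - 1 / \<tau> = (\<tau> - \<sigma>) / (\<sigma> * \<tau>)" using \<tau> \<sigma> by (simp add: field_simps)
    then show ?thesis using \<tau> \<sigma> by (simp add: abs_divide abs_minus_commute abs_mult)
  qed
  have b1: "\<bar>(norm (x - y))\<^sup>2 / 2 * (1 / \<sigma> - 1 / \<tau>)\<bar> \<le> 2 * growth x * (1 / \<sigma>) * \<bar>\<sigma> - \<tau>\<bar>"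
  proof -
    have "\<bar>(norm (x - y))\<^sup>2 / 2 * (1 / \<sigma> - 1 / \<tau>)\<bar> = (norm (x - y))\<^sup>2 / 2 * (\<bar>\<sigma> - \<tau>\<bar> / (\<sigma> * \<tau>))"
      by (simp only: abs_mult a) simp
    also have "\<dots> \<le> (4 * \<tau> * growth x) / 2 * (\<bar>\<sigma> - \<tau>\<bar> / (\<sigma> * \<tau>))"
      using minimizer_bound[OF \<tau> y(1)] \<tau> \<sigma> by (intro mult_right_mono divide_right_mono) auto
    also have "\<dots> = 2 * growth x * (1 / \<sigma>) * \<bar>\<sigma> - \<tau>\<bar>" using \<tau> by simp
    finally show ?thesis .
  qed
  have b2: "\<bar>(norm (x - z))\<^sup>2 / 2 * (1 / \<sigma> - 1 / \<tau>)\<bar> \<le> 2 * growth x * (1 / \<tau>) * \<bar>\<sigma> - \<tau>\<bar>"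
  proof -
    have "\<bar>(norm (x - z))\<^sup>2 / 2 * (1 / \<sigma> - 1 / \<tau>)\<bar> = (norm (x - z))\<^sup>2 / 2 * (\<bar>\<sigma> - \<tau>\<bar> / (\<sigma> * \<tau>))"
      by (simp only: abs_mult a) simp
    also have "\<dots> \<le> (4 * \<sigma> * growth x) / 2 * (\<bar>\<sigma> - \<tau>\<bar> / (\<sigma> * \<tau>))"
      using minimizer_bound[OF \<sigma> y(2)] \<tau> \<sigma> by (intro mult_right_mono divide_right_mono) auto
    also have "\<dots> = 2 * growth x * (1 / \<tau>) * \<bar>\<sigma> - \<tau>\<bar>" using \<sigma> by simp
    finally show ?thesis .
  qed
  have "2 * growth x * (1 / \<tau>) * \<bar>\<sigma> - \<tau>\<bar> \<ge> 0" "2 * growth x * (1 / \<sigma>) * \<bar>\<sigma> - \<tau>\<bar> \<ge> 0"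
    using growth_nonneg[of x] \<tau> \<sigma> by auto
  then show ?thesis
    using b1 b2 hopf_lax_time_increment[OF \<tau> \<sigma> y] by (simp add: distrib_left distrib_right abs_le_iff)
qed

text \<open>The Hamilton--Jacobi equation at points with a unique minimiser, by the same squeezing as in space.\<close>

lemma hopf_lax_time_DERIV:
  assumes \<tau>: "0 < \<tau>" "\<tau> \<le> T" and u: "unique_min \<tau> x"
    and t: "tn \<longlonglongrightarrow> \<tau>" "\<And>n. 0 < tn n" "\<And>n. tn n \<le> T" "\<And>n. tn n \<noteq> \<tau>"
  shows "(\<lambda>n. (hopf_lax (tn n) u x - hopf_lax \<tau> u x) / (tn n - \<tau>)) \<longlonglongrightarrow> - ((norm (hl_grad \<tau> x))\<^sup>2 / 2)"
proof -
  define y where "y = argmin_choice \<tau> x"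
  define yn where "yn = (\<lambda>n. argmin_choice (tn n) x)"
  have ym: "y \<in> minimizers \<tau> x" "\<And>n. yn n \<in> minimizers (tn n) x" using argmin_choice \<tau> t by (auto simp: y_def yn_def)
  have yl: "yn \<longlonglongrightarrow> y" unfolding yn_def y_def by (rule argmin_choice_tendsto[OF u]) (use t \<tau> in auto)
  define k where "k = (\<lambda>n. - (1 / (tn n * \<tau>)))"
  have kl: "k \<longlonglongrightarrow> - (1 / (\<tau> * \<tau>))" unfolding k_def using \<tau> by (intro tendsto_intros t) auto
  have ke: "(1 / tn n - 1 / \<tau>) = k n * (tn n - \<tau>)" for n
    using t(2)[of n] \<tau> by (simp add: k_def field_simps)
  define Dq where "Dq = (\<lambda>n. hopf_lax (tn n) u x - hopf_lax \<tau> u x)"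
  define A where "A = (\<lambda>n. (norm (x - y))\<^sup>2 / 2 * k n)"
  define B where "B = (\<lambda>n. (norm (x - yn n))\<^sup>2 / 2 * k n)"
  have Al: "A \<longlonglongrightarrow> (norm (x - y))\<^sup>2 / 2 * (- (1 / (\<tau> * \<tau>)))" unfolding A_def by (intro tendsto_intros kl)
  have Bl: "B \<longlonglongrightarrow> (norm (x - y))\<^sup>2 / 2 * (- (1 / (\<tau> * \<tau>)))" unfolding B_def by (intro tendsto_intros kl yl) auto
  have bd: "min (A n) (B n) \<le> Dq n / (tn n - \<tau>) \<and> Dq n / (tn n - \<tau>) \<le> max (A n) (B n)" for n
  proof -
    have 1: "Dq n \<le> A n * (tn n - \<tau>)" "Dq n \<ge> B n * (tn n - \<tau>)"
      using hopf_lax_time_increment[OF \<tau> t(2,3) ym(1) ym(2)[of n]]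
      by (simp_all add: Dq_def A_def B_def ke mult.assoc)
    show ?thesis
    proof (cases "tn n > \<tau>")
      case True
      then have "Dq n / (tn n - \<tau>) \<le> A n" "B n \<le> Dq n / (tn n - \<tau>)" using 1 by (auto simp: pos_divide_le_eq pos_le_divide_eq)
      then show ?thesis by auto
    next
      case False
      then have "tn n - \<tau> < 0" using t(4)[of n] by simp
      then have "A n \<le> Dq n / (tn n - \<tau>)" "Dq n / (tn n - \<tau>) \<le> B n" using 1 by (auto simp: neg_divide_le_eq neg_le_divide_eq)
      then show ?thesis by auto
    qed
  qed
  have lim: "(\<lambda>n. Dq n / (tn n - \<tau>)) \<longlonglongrightarrow> (norm (x - y))\<^sup>2 / 2 * (- (1 / (\<tau> * \<tau>)))"
  proof (rule tendsto_sandwich)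
    show "(\<lambda>n. min (A n) (B n)) \<longlonglongrightarrow> (norm (x - y))\<^sup>2 / 2 * (- (1 / (\<tau> * \<tau>)))"
      using tendsto_min[OF Al Bl] by simp
    show "(\<lambda>n. max (A n) (B n)) \<longlonglongrightarrow> (norm (x - y))\<^sup>2 / 2 * (- (1 / (\<tau> * \<tau>)))"
      using tendsto_max[OF Al Bl] by simp
  qed (use bd in auto)
  have eq: "(norm (x - y))\<^sup>2 / 2 * (- (1 / (\<tau> * \<tau>))) = - ((norm (hl_grad \<tau> x))\<^sup>2 / 2)"
    using u \<tau> by (simp add: hl_grad_def y_def power_divide power2_eq_square)
  show ?thesis using lim unfolding eq Dq_def .
qed

text \<open>Minimisers converge to \<open>x\<close>, and \<open>u\<close> at the minimiser is a lower bound for the semigroup.\<close>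

lemma hopf_lax_tendsto_0:
  assumes t: "tn \<longlonglongrightarrow> 0" "\<And>n. 0 < tn n" "\<And>n. tn n \<le> T"
  shows "(\<lambda>n. hopf_lax (tn n) u x) \<longlonglongrightarrow> u x"
proof -
  define yn where "yn = (\<lambda>n. argmin_choice (tn n) x)"
  have ym: "yn n \<in> minimizers (tn n) x" for n using argmin_choice t by (auto simp: yn_def)
  have "yn \<longlonglongrightarrow> x"
  proof (rule LIM_zero_cancel, rule tendsto_norm_zero_cancel, rule Lim_null_comparison)
    show "(\<lambda>n. sqrt (4 * tn n * growth x)) \<longlonglongrightarrow> 0"
      using tendsto_real_sqrt[OF tendsto_mult[OF tendsto_mult[OF tendsto_const[of 4] t(1)] tendsto_const[of "growth x"]]] by simp
    show "\<forall>\<^sub>F n in sequentially. norm (norm (yn n - x)) \<le> sqrt (4 * tn n * growth x)"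
      using minimizer_bound[OF t(2,3) ym] by (auto intro!: always_eventually real_le_rsqrt simp: norm_minus_commute)
  qed
  then have ul: "(\<lambda>n. u (yn n)) \<longlonglongrightarrow> u x" by (intro continuous_on_tendsto_compose[OF u_cont]) auto
  have "u (yn n) \<le> hopf_lax (tn n) u x" for n
    using hopf_lax_eq[OF t(2) ym, of n] t(2)[of n] by (simp add: cost_def)
  moreover have "hopf_lax (tn n) u x \<le> u x" for n using hopf_lax_le[OF t(2,3)] .
  ultimately show ?thesis by (intro tendsto_sandwich[OF _ _ ul tendsto_const]) auto
qed

lemma hl_grad_tendsto:
  assumes t: "tn \<longlonglongrightarrow> \<tau>" "\<tau> > 0" "\<tau> \<le> T" "\<And>n. 0 < tn n" "\<And>n. tn n \<le> T"
    and u: "unique_min \<tau> x" "\<And>n. unique_min (tn n) x"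
  shows "(\<lambda>n. hl_grad (tn n) x) \<longlonglongrightarrow> hl_grad \<tau> x"
proof -
  have "(\<lambda>n. argmin_choice (tn n) x) \<longlonglongrightarrow> argmin_choice \<tau> x" by (rule argmin_choice_tendsto[OF u(1)]) (use t in auto)
  then show ?thesis using u t(2) unfolding hl_grad_def by (auto intro!: tendsto_intros t(1))
qed

end

section \<open>The norm along the Hopf--Lax flow\<close>

lemma norm_sq_sum: "(norm x)\<^sup>2 = (\<Sum>j\<in>UNIV. (x $ j)\<^sup>2)" for x :: "real^'n::finite"
  unfolding power2_norm_eq_inner by (simp add: inner_vec_def power2_eq_square)

lemma gauss_dom_UNIV_I:
  fixes F :: "real^'n::finite \<Rightarrow> real"
  assumes "continuous_on UNIV F" "\<And>x. F x > 0" "a > 0" "\<And>x. F x \<le> K * exp (- a * (norm x)\<^sup>2)"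
  shows "gauss_dom UNIV F"
  unfolding gauss_dom_def using assms by (auto simp: norm_sq_sum)

lemma integrable_gaussian:
  assumes "a > 0" shows "integrable lborel (\<lambda>x::real^'n::finite. exp (- a * (norm x)\<^sup>2))"
proof -
  have "gauss_dom UNIV (\<lambda>x::real^'n. exp (- a * (norm x)\<^sup>2))"
    by (rule gauss_dom_UNIV_I[OF _ _ assms, of _ 1]) (auto intro!: continuous_intros)
  then show ?thesis using margs_UNIV(2) finite_distinct_list[of "UNIV :: 'n set"] by auto
qed

lemma exp_diff_le: "\<bar>exp a - exp b\<bar> \<le> max (exp a) (exp b) * \<bar>a - b\<bar>" for a b :: real
proof -
  have *: "exp a - exp b \<le> exp a * (a - b)" for a b :: real
  proof -
    have "1 + (b - a) \<le> exp (b - a)" by (rule exp_ge_add_one_self)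
    then have "exp a * (1 + (b - a)) \<le> exp a * exp (b - a)" by (intro mult_left_mono) auto
    then show ?thesis by (simp add: exp_add[symmetric] algebra_simps)
  qed
  show ?thesis
  proof (cases "a \<ge> b")
    case True
    then have "\<bar>exp a - exp b\<bar> = exp a - exp b" "max (exp a) (exp b) = exp a" "\<bar>a - b\<bar> = a - b" by auto
    then show ?thesis using *[of a b] by simp
  next
    case False
    then have "\<bar>exp a - exp b\<bar> = exp b - exp a" "max (exp a) (exp b) = exp b" "\<bar>a - b\<bar> = b - a" by auto
    then show ?thesis using *[of b a] by simp
  qed
qed

lemma exp_quotient_tendsto:
  fixes a d :: "nat \<Rightarrow> real"
  assumes q: "(\<lambda>n. (a n - b) / d n) \<longlonglongrightarrow> L" and a: "a \<longlonglongrightarrow> b"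
  shows "(\<lambda>n. (exp (a n) - exp b) / d n) \<longlonglongrightarrow> exp b * L"
proof -
  obtain g where g: "\<And>z. exp z - exp b = g z * (z - b)" "isCont g b" "g b = exp b"
    using DERIV_exp[of b] unfolding CARAT_DERIV by blast
  have "(\<lambda>n. g (a n)) \<longlonglongrightarrow> exp b" using isCont_tendsto_compose[OF g(2) a] g(3) by simp
  from tendsto_mult[OF this q] show ?thesis by (simp add: g(1))
qed

lemma C2_gaussian_lower:
  fixes V :: "real^'n::finite \<Rightarrow> real"
  assumes V: "Ck 2 V" and psd: "\<And>x. psd (hessian V x - c *\<^sub>R mat 1)" and c: "c > 0"
  obtains K where "K > 0" "\<And>x. exp (- V x) \<le> K * exp (- (c/4) * (norm x)\<^sup>2)"
proof -
  define g where "g = norm (grad V 0)"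
  have "exp (- V x) \<le> exp (- V 0 + g\<^sup>2 / c) * exp (- (c/4) * (norm x)\<^sup>2)" for x
  proof -
    have 1: "V x \<ge> V 0 + grad V 0 \<bullet> x + c/2 * (norm x)\<^sup>2"
      using strongly_convex_bound[OF V psd, of 0 x] by simp
    have 2: "grad V 0 \<bullet> x \<ge> - (g * norm x)"
      using Cauchy_Schwarz_ineq2[of "grad V 0" x] by (simp add: g_def)
    have 3: "g * norm x \<le> g\<^sup>2 / c + (c/4) * (norm x)\<^sup>2"
    proof -
      have "0 \<le> (g - c/2 * norm x)\<^sup>2 / c" using c by simp
      also have "\<dots> = g\<^sup>2 / c + (c/4) * (norm x)\<^sup>2 - g * norm x"
        using c by (simp add: power2_eq_square field_simps)
      finally show ?thesis by simp
    qed
    have "c/2 * (norm x)\<^sup>2 = (c/4) * (norm x)\<^sup>2 + (c/4) * (norm x)\<^sup>2" by simp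
    then have "- V x \<le> (- V 0 + g\<^sup>2 / c) + (- (c/4) * (norm x)\<^sup>2)" using 1 2 3 by linarith
    then show ?thesis unfolding exp_add[symmetric] by simp
  qed
  then show thesis by (intro that[of "exp (- V 0 + g\<^sup>2 / c)"]) auto
qed

text \<open>The last condition lets the Gaussian decay of \<open>exp (- V)\<close> dominate \<open>exp (q \<tau> Q\<^sub>\<tau>)\<close> for all times
  up to \<open>T\<close> at once.\<close>

locale hc_flow = hopf_lax_growth u T \<epsilon> C
  for u :: "real^'n::finite \<Rightarrow> real" and T \<epsilon> C :: real +
  fixes c :: real and V :: "real^'n \<Rightarrow> real" and q q' :: "real \<Rightarrow> real"
  assumes c_pos: "c > 0"
    and V_C2: "Ck 2 V"
    and V_convex: "\<And>x. psd (hessian V x - c *\<^sub>R mat 1)"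
    and mu_prob: "prob_space (mu V)"
    and q_pos: "\<And>\<tau>. \<tau> \<ge> 0 \<Longrightarrow> q \<tau> > 0"
    and q_mono: "mono_on {0..} q"
    and q_deriv: "\<And>\<tau>. \<tau> \<ge> 0 \<Longrightarrow> (q has_real_derivative q' \<tau>) (at \<tau> within {0..})"
    and q'_cont: "continuous_on {0..} q'"
    and q'_le: "\<And>\<tau>. \<tau> \<ge> 0 \<Longrightarrow> q' \<tau> \<le> c"
    and eps_q: "16 * q T * \<epsilon> \<le> c"
begin

text \<open>A single integrable majorant for all integrands that occur: an exponential factor times a
  quantity of at most quadratic growth.\<close>

definition dom :: "real^'n \<Rightarrow> real" where "dom x = (1 + (norm x)\<^sup>2) * exp (- (c/8) * (norm x)\<^sup>2)"

lemma integrable_dom: "integrable lborel dom"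
proof (rule Bochner_Integration.integrable_bound)
  show "integrable lborel (\<lambda>x::real^'n. (1 + 16/c) * exp (- (c/16) * (norm x)\<^sup>2))"
    by (intro integrable_mult_right integrable_gaussian) (use c_pos in auto)
  show "dom \<in> borel_measurable lborel" unfolding dom_def by measurable
  have "dom x \<le> (1 + 16/c) * exp (- (c/16) * (norm x)\<^sup>2)" for x
  proof -
    define r where "r = (norm x)\<^sup>2"
    have r: "r \<ge> 0" by (simp add: r_def)
    have "1 + c/16 * r \<le> exp (c/16 * r)" by (rule exp_ge_add_one_self)
    then have "c/16 * r \<le> exp (c/16 * r)" by linarith
    then have "r \<le> 16/c * exp (c/16 * r)" using c_pos by (simp add: field_simps)
    moreover have "1 \<le> exp (c/16 * r)" using r c_pos by simp
    ultimately have "1 + r \<le> (1 + 16/c) * exp (c/16 * r)" unfolding distrib_right mult_1 by linarith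
    then have "(1 + r) * exp (- (c/8) * r) \<le> ((1 + 16/c) * exp (c/16 * r)) * exp (- (c/8) * r)"
      by (intro mult_right_mono) auto
    also have "\<dots> = (1 + 16/c) * exp (- (c/16) * r)"
      by (simp add: mult.assoc exp_add[symmetric])
    finally show ?thesis by (simp add: dom_def r_def)
  qed
  moreover have "dom x \<ge> 0" for x by (simp add: dom_def)
  ultimately show "AE x in lborel. norm (dom x) \<le> norm ((1 + 16/c) * exp (- (c/16) * (norm x)\<^sup>2))"
    by (intro AE_I2) (metis abs_ge_self abs_of_nonneg order_trans real_norm_def)
qed

text \<open>The \<open>q \<tau>\<close>-th power of \<open>exp (Q\<^sub>\<tau>)\<close> times the Lebesgue density of \<open>mu V\<close>, so that all integrals along the
  flow are taken against Lebesgue measure.\<close>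

definition P :: "real \<Rightarrow> real^'n \<Rightarrow> real" where "P \<tau> x = exp (q \<tau> * hopf_lax \<tau> u x - V x)"

lemma q_le: "0 \<le> s \<Longrightarrow> s \<le> t \<Longrightarrow> q s \<le> q t" using q_mono by (auto simp: mono_on_def)

lemma P_pos: "P \<tau> x > 0" by (simp add: P_def)

lemma P_bound:
  obtains K where "K > 0" "\<And>\<tau> x. 0 \<le> \<tau> \<Longrightarrow> \<tau> \<le> T \<Longrightarrow> P \<tau> x \<le> K * exp (- (c/8) * (norm x)\<^sup>2)"
proof -
  obtain K where K: "K > 0" "\<And>x. exp (- V x) \<le> K * exp (- (c/4) * (norm x)\<^sup>2)"
    using C2_gaussian_lower[OF V_C2 V_convex c_pos] by blast
  have "P \<tau> x \<le> (K * exp (q T * C)) * exp (- (c/8) * (norm x)\<^sup>2)" if \<tau>: "0 \<le> \<tau>" "\<tau> \<le> T" for \<tau> x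
  proof -
    have nn: "C + 2 * \<epsilon> * (norm x)\<^sup>2 \<ge> 0" using C_nonneg eps_pos by simp
    have "q \<tau> * hopf_lax \<tau> u x \<le> q \<tau> * (C + 2 * \<epsilon> * (norm x)\<^sup>2)"
      using hopf_lax_bound[OF \<tau>, of x] q_pos[OF \<tau>(1)] by (intro mult_left_mono) auto
    also have "\<dots> \<le> q T * (C + 2 * \<epsilon> * (norm x)\<^sup>2)" using q_le[OF \<tau>] nn by (rule mult_right_mono)
    also have "\<dots> = q T * C + (16 * q T * \<epsilon>) / 8 * (norm x)\<^sup>2" by (simp add: algebra_simps)
    also have "\<dots> \<le> q T * C + c / 8 * (norm x)\<^sup>2"
      using eps_q by (intro add_left_mono mult_right_mono divide_right_mono) auto
    finally have "exp (q \<tau> * hopf_lax \<tau> u x) \<le> exp (q T * C + c / 8 * (norm x)\<^sup>2)" by simp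
    then have "P \<tau> x \<le> exp (q T * C + c / 8 * (norm x)\<^sup>2) * (K * exp (- (c/4) * (norm x)\<^sup>2))"
      unfolding P_def diff_conv_add_uminus exp_add[of "q \<tau> * _"] using K by (intro mult_mono) auto
    also have "\<dots> = (K * exp (q T * C)) * exp (- (c/8) * (norm x)\<^sup>2)"
    proof -
      have "exp (q T * C + c / 8 * (norm x)\<^sup>2) * exp (- (c/4) * (norm x)\<^sup>2) = exp (q T * C) * exp (- (c/8) * (norm x)\<^sup>2)"
        by (simp add: exp_add[symmetric])
      then show ?thesis by (simp add: mult_ac)
    qed
    finally show ?thesis .
  qed
  then show thesis by (intro that[of "K * exp (q T * C)"]) (use K in auto)
qed

lemma V_cont: "continuous_on UNIV V" by (rule C2_grad(3)[OF V_C2])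

lemma P_cont: "0 \<le> \<tau> \<Longrightarrow> \<tau> \<le> T \<Longrightarrow> continuous_on UNIV (P \<tau>)"
  unfolding P_def by (intro continuous_intros continuous_hopf_lax V_cont)

lemma P_meas: "0 \<le> \<tau> \<Longrightarrow> \<tau> \<le> T \<Longrightarrow> P \<tau> \<in> borel_measurable borel"
  using P_cont by (rule borel_measurable_continuous_onI)

lemma hl_meas: "0 \<le> \<tau> \<Longrightarrow> \<tau> \<le> T \<Longrightarrow> hopf_lax \<tau> u \<in> borel_measurable borel"
  using continuous_hopf_lax by (rule borel_measurable_continuous_onI)

lemma hl_grad_meas: "0 < \<tau> \<Longrightarrow> \<tau> \<le> T \<Longrightarrow> hl_grad \<tau> \<in> borel_measurable borel"
  by (subst borel_measurable_euclidean_space) (auto simp: Basis_vec_def inner_axis intro!: axis_derivD(2)[OF axis_deriv_hopf_lax])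

lemma P_gauss_dom:
  assumes "0 \<le> \<tau>" "\<tau> \<le> T" shows "gauss_dom UNIV (P \<tau>)"
proof -
  obtain K where "\<And>x. P \<tau> x \<le> K * exp (- (c/8) * (norm x)\<^sup>2)" using P_bound assms by metis
  then show ?thesis using c_pos by (intro gauss_dom_UNIV_I[of _ "c/8" K] P_cont P_pos assms) auto
qed

lemma integrable_le_dom:
  fixes f :: "real^'n \<Rightarrow> real"
  assumes "f \<in> borel_measurable borel" "\<And>x. \<bar>f x\<bar> \<le> M * dom x" shows "integrable lborel f"
proof (rule Bochner_Integration.integrable_bound)
  show "integrable lborel (\<lambda>x. M * dom x)" using integrable_dom by simp
  show "AE x in lborel. norm (f x) \<le> norm (M * dom x)"
    using assms(2) by (intro AE_I2) (metis abs_ge_self order_trans real_norm_def)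
qed (use assms(1) in simp)

lemma P_times_bound:
  obtains M where "M > 0" "\<And>\<tau> x. 0 \<le> \<tau> \<Longrightarrow> \<tau> \<le> T \<Longrightarrow> P \<tau> x \<le> M * dom x"
    "\<And>\<tau> x r B. 0 \<le> \<tau> \<Longrightarrow> \<tau> \<le> T \<Longrightarrow> \<bar>r\<bar> \<le> B * (1 + (norm x)\<^sup>2) \<Longrightarrow> \<bar>P \<tau> x * r\<bar> \<le> (M * B) * dom x"
proof -
  obtain K where K: "K > 0" "\<And>\<tau> x. 0 \<le> \<tau> \<Longrightarrow> \<tau> \<le> T \<Longrightarrow> P \<tau> x \<le> K * exp (- (c/8) * (norm x)\<^sup>2)"
    using P_bound by blast
  show thesis
  proof (rule that[OF K(1)])
    fix \<tau> x assume \<tau>: "0 \<le> \<tau>" "\<tau> \<le> T"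
    have "K * (1 * exp (- (c/8) * (norm x)\<^sup>2)) \<le> K * dom x"
      unfolding dom_def using K by (intro mult_left_mono mult_right_mono) auto
    then show "P \<tau> x \<le> K * dom x" using K(2)[OF \<tau>, of x] by simp
    fix r B assume r: "\<bar>r\<bar> \<le> B * (1 + (norm x)\<^sup>2)"
    have "\<bar>P \<tau> x * r\<bar> = P \<tau> x * \<bar>r\<bar>" using P_pos[of \<tau> x] by (simp add: abs_mult)
    also have "\<dots> \<le> (K * exp (- (c/8) * (norm x)\<^sup>2)) * (B * (1 + (norm x)\<^sup>2))"
      using K P_pos[of \<tau> x] \<tau> r by (intro mult_mono) auto
    finally show "\<bar>P \<tau> x * r\<bar> \<le> (K * B) * dom x" by (simp add: dom_def mult_ac)
  qed
qed

lemma hl_poly: "0 \<le> \<tau> \<Longrightarrow> \<tau> \<le> T \<Longrightarrow> \<bar>hopf_lax \<tau> u x\<bar> \<le> (C + 2 * \<epsilon>) * (1 + (norm x)\<^sup>2)"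
proof -
  assume "0 \<le> \<tau>" "\<tau> \<le> T"
  then have "\<bar>hopf_lax \<tau> u x\<bar> \<le> C + 2 * \<epsilon> * (norm x)\<^sup>2" by (rule hopf_lax_bound)
  moreover have "0 \<le> 2 * \<epsilon>" "0 \<le> C * (norm x)\<^sup>2" using eps_pos C_nonneg by auto
  ultimately show ?thesis by (simp add: algebra_simps)
qed

lemma growth_poly: "growth x \<le> (2 * C + 3 * \<epsilon>) * (1 + (norm x)\<^sup>2)"
proof -
  have "0 \<le> 3 * \<epsilon>" "0 \<le> 2 * C * (norm x)\<^sup>2" using eps_pos C_nonneg by auto
  then show ?thesis unfolding growth_def by (simp add: algebra_simps)
qed

lemma hl_grad_poly: "0 < a \<Longrightarrow> a \<le> \<tau> \<Longrightarrow> \<tau> \<le> T \<Longrightarrow> \<bar>(norm (hl_grad \<tau> x))\<^sup>2\<bar> \<le> (4 * (2 * C + 3 * \<epsilon>) / a) * (1 + (norm x)\<^sup>2)"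
proof -
  assume a: "0 < a" "a \<le> \<tau>" "\<tau> \<le> T"
  have "(norm (hl_grad \<tau> x))\<^sup>2 \<le> 4 * growth x / \<tau>" using a by (intro hl_grad_bound) auto
  also have "\<dots> \<le> 4 * growth x / a" using a growth_nonneg[of x] by (intro divide_left_mono) auto
  also have "\<dots> \<le> 4 * ((2 * C + 3 * \<epsilon>) * (1 + (norm x)\<^sup>2)) / a"
    using growth_poly[of x] a by (intro divide_right_mono mult_left_mono) auto
  also have "\<dots> = (4 * (2 * C + 3 * \<epsilon>) / a) * (1 + (norm x)\<^sup>2)"
    unfolding times_divide_eq_left mult.assoc ..
  finally show ?thesis unfolding abs_power2 .
qed

definition \<Phi> :: "real \<Rightarrow> real" where "\<Phi> \<tau> = (LINT x|lborel. P \<tau> x)"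
definition \<Psi> :: "real \<Rightarrow> real" where "\<Psi> \<tau> = (LINT x|lborel. P \<tau> x * (q \<tau> * hopf_lax \<tau> u x))"
definition \<Gamma> :: "real \<Rightarrow> real" where "\<Gamma> \<tau> = (LINT x|lborel. P \<tau> x * (norm (hl_grad \<tau> x))\<^sup>2)"

lemma P_integrable: "0 \<le> \<tau> \<Longrightarrow> \<tau> \<le> T \<Longrightarrow> integrable lborel (P \<tau>)"
  using margs_UNIV(2)[OF P_gauss_dom] finite_distinct_list[of "UNIV :: 'n set"] by auto

lemma PQ_integrable:
  assumes "0 \<le> \<tau>" "\<tau> \<le> T" shows "integrable lborel (\<lambda>x. P \<tau> x * hopf_lax \<tau> u x)"
proof -
  obtain M where M: "\<And>x r B. \<bar>r\<bar> \<le> B * (1 + (norm x)\<^sup>2) \<Longrightarrow> \<bar>P \<tau> x * r\<bar> \<le> (M * B) * dom x"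
    using P_times_bound assms by metis
  note [measurable] = P_meas[OF assms] hl_meas[OF assms]
  show ?thesis by (rule integrable_le_dom[OF _ M[OF hl_poly[OF assms]]]) measurable
qed

lemma PG_integrable:
  assumes "0 < \<tau>" "\<tau> \<le> T" shows "integrable lborel (\<lambda>x. P \<tau> x * (norm (hl_grad \<tau> x))\<^sup>2)"
proof -
  have a: "0 \<le> \<tau>" using assms by simp
  obtain M where M: "\<And>x r B. \<bar>r\<bar> \<le> B * (1 + (norm x)\<^sup>2) \<Longrightarrow> \<bar>P \<tau> x * r\<bar> \<le> (M * B) * dom x"
    using P_times_bound a assms(2) by metis
  note [measurable] = P_meas[OF a assms(2)] hl_grad_meas[OF assms]
  show ?thesis by (rule integrable_le_dom[OF _ M[OF hl_grad_poly[OF assms(1) order_refl assms(2)]]]) measurable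
qed

lemma \<Phi>_pos: assumes "0 \<le> \<tau>" "\<tau> \<le> T" shows "\<Phi> \<tau> > 0"
proof -
  obtain l where l: "set l = (UNIV :: 'n set)" "distinct l" using finite_distinct_list[of "UNIV :: 'n set"] by auto
  have "\<Phi> \<tau> = margs l (P \<tau>) 0" unfolding \<Phi>_def using margs_UNIV(1)[OF P_gauss_dom[OF assms] l(2,1)] by simp
  then show ?thesis using gauss_domD(2)[OF gauss_dom_margs[OF P_gauss_dom[OF assms] l(2)]] by simp
qed

lemma continuous_on_integral_dom:
  fixes f :: "real \<Rightarrow> real^'n \<Rightarrow> real"
  assumes m: "\<And>\<tau>. \<tau> \<in> S \<Longrightarrow> f \<tau> \<in> borel_measurable borel" and b: "\<And>\<tau> x. \<tau> \<in> S \<Longrightarrow> \<bar>f \<tau> x\<bar> \<le> M * dom x"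
    and l: "\<And>tn \<tau>. \<tau> \<in> S \<Longrightarrow> (\<And>n. tn n \<in> S) \<Longrightarrow> tn \<longlonglongrightarrow> \<tau> \<Longrightarrow> AE x in lborel. (\<lambda>n. f (tn n) x) \<longlonglongrightarrow> f \<tau> x"
  shows "continuous_on S (\<lambda>\<tau>. LINT x|lborel. f \<tau> x)"
  unfolding continuous_on_sequentially comp_def
proof (intro allI ballI impI)
  fix tn \<tau> assume a: "\<tau> \<in> S" "(\<forall>n. tn n \<in> S) \<and> tn \<longlonglongrightarrow> \<tau>"
  show "(\<lambda>n. LINT x|lborel. f (tn n) x) \<longlonglongrightarrow> (LINT x|lborel. f \<tau> x)"
  proof (rule integral_dominated_convergence)
    show "integrable lborel (\<lambda>x. M * dom x)" using integrable_dom by simp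
    show "AE x in lborel. (\<lambda>n. f (tn n) x) \<longlonglongrightarrow> f \<tau> x" using a by (intro l) auto
  qed (use a m b in auto)
qed

lemma q_tendsto: "\<tau> \<ge> 0 \<Longrightarrow> (\<And>n. tn n \<ge> 0) \<Longrightarrow> tn \<longlonglongrightarrow> \<tau> \<Longrightarrow> (\<lambda>n. q (tn n)) \<longlonglongrightarrow> q \<tau>"
proof -
  assume a: "\<tau> \<ge> 0" "\<And>n. tn n \<ge> 0" "tn \<longlonglongrightarrow> \<tau>"
  have "continuous_on {0..} q" using q_deriv by (intro continuous_on_eq_continuous_within[THEN iffD2] ballI) (auto intro: DERIV_continuous)
  then show ?thesis by (rule continuous_on_tendsto_compose[OF _ a(3)]) (use a in auto)
qed

lemma P_tendsto:
  assumes "0 \<le> \<tau>" "\<tau> \<le> T" "\<And>n. 0 < tn n" "\<And>n. tn n \<le> T" "tn \<longlonglongrightarrow> \<tau>"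
  shows "(\<lambda>n. hopf_lax (tn n) u x) \<longlonglongrightarrow> hopf_lax \<tau> u x" "(\<lambda>n. P (tn n) x) \<longlonglongrightarrow> P \<tau> x"
    "(\<lambda>n. q (tn n)) \<longlonglongrightarrow> q \<tau>"
proof -
  show h: "(\<lambda>n. hopf_lax (tn n) u x) \<longlonglongrightarrow> hopf_lax \<tau> u x"
  proof (cases "\<tau> = 0")
    case True
    then show ?thesis using hopf_lax_tendsto_0[of tn x] assms by (simp add: hopf_lax_def[of 0])
  next
    case False
    then show ?thesis using hopf_lax_tendsto[of tn \<tau> "\<lambda>_. x" x] assms by auto
  qed
  show ql: "(\<lambda>n. q (tn n)) \<longlonglongrightarrow> q \<tau>" using assms by (intro q_tendsto) (auto intro: less_imp_le)
  show "(\<lambda>n. P (tn n) x) \<longlonglongrightarrow> P \<tau> x" unfolding P_def by (intro tendsto_intros h ql)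
qed

text \<open>Continuity of \<open>\<Gamma>\<close> uses that minimisers at nearby times converge at points where they are unique; for a
  fixed sequence of times this covers almost every point.\<close>

lemma continuous_flow:
  assumes a: "a > 0"
  shows "continuous_on {a<..<T} \<Phi>" "continuous_on {a<..<T} \<Psi>" "continuous_on {a<..<T} \<Gamma>"
proof -
  obtain M where M: "M > 0" "\<And>\<tau> x. 0 \<le> \<tau> \<Longrightarrow> \<tau> \<le> T \<Longrightarrow> P \<tau> x \<le> M * dom x"
    "\<And>\<tau> x r B. 0 \<le> \<tau> \<Longrightarrow> \<tau> \<le> T \<Longrightarrow> \<bar>r\<bar> \<le> B * (1 + (norm x)\<^sup>2) \<Longrightarrow> \<bar>P \<tau> x * r\<bar> \<le> (M * B) * dom x"
    using P_times_bound by blast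
  have r: "0 \<le> \<tau>" "0 < \<tau>" "\<tau> \<le> T" "a \<le> \<tau>" if "\<tau> \<in> {a<..<T}" for \<tau> using that a by auto
  have meas: "P \<tau> \<in> borel_measurable borel" "hopf_lax \<tau> u \<in> borel_measurable borel" "hl_grad \<tau> \<in> borel_measurable borel" if "\<tau> \<in> {a<..<T}" for \<tau>
    using r[OF that] by (auto intro: P_meas hl_meas hl_grad_meas)
  have lim: "(\<lambda>n. hopf_lax (tn n) u x) \<longlonglongrightarrow> hopf_lax \<tau> u x" "(\<lambda>n. P (tn n) x) \<longlonglongrightarrow> P \<tau> x" "(\<lambda>n. q (tn n)) \<longlonglongrightarrow> q \<tau>"
    if "\<tau> \<in> {a<..<T}" "\<And>n. tn n \<in> {a<..<T}" "tn \<longlonglongrightarrow> \<tau>" for tn \<tau> x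
    using P_tendsto(1,2)[of \<tau> tn x] P_tendsto(3)[of \<tau> tn] r[OF that(1)] r[OF that(2)] that(3) by auto
  show "continuous_on {a<..<T} \<Phi>" unfolding \<Phi>_def
  proof (rule continuous_on_integral_dom[where M=M])
    show "\<bar>P \<tau> x\<bar> \<le> M * dom x" if "\<tau> \<in> {a<..<T}" for \<tau> x using M(2)[of \<tau> x] r[OF that] P_pos[of \<tau> x] by simp
  qed (use meas lim in auto)
  show "continuous_on {a<..<T} \<Psi>" unfolding \<Psi>_def
  proof (rule continuous_on_integral_dom[where M="M * (q T * (C + 2 * \<epsilon>))"])
    fix \<tau> assume t: "\<tau> \<in> {a<..<T}"
    note [measurable] = meas[OF t]
    show "(\<lambda>x. P \<tau> x * (q \<tau> * hopf_lax \<tau> u x)) \<in> borel_measurable borel" by measurable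
    show "\<bar>P \<tau> x * (q \<tau> * hopf_lax \<tau> u x)\<bar> \<le> M * (q T * (C + 2 * \<epsilon>)) * dom x" for x
    proof (rule M(3)[OF r(1,3)[OF t]])
      have "\<bar>q \<tau> * hopf_lax \<tau> u x\<bar> = q \<tau> * \<bar>hopf_lax \<tau> u x\<bar>" using q_pos[OF r(1)[OF t]] by (simp add: abs_mult)
      also have "\<dots> \<le> q T * ((C + 2 * \<epsilon>) * (1 + (norm x)\<^sup>2))"
        using q_pos[OF r(1)[OF t]] q_le[OF r(1,3)[OF t]] hl_poly[OF r(1,3)[OF t], of x] by (intro mult_mono) auto
      finally show "\<bar>q \<tau> * hopf_lax \<tau> u x\<bar> \<le> q T * (C + 2 * \<epsilon>) * (1 + (norm x)\<^sup>2)" by simp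
    qed
  next
    fix tn \<tau> assume t: "\<tau> \<in> {a<..<T}" "\<And>n. tn n \<in> {a<..<T}" "tn \<longlonglongrightarrow> \<tau>"
    show "AE x in lborel. (\<lambda>n. P (tn n) x * (q (tn n) * hopf_lax (tn n) u x)) \<longlonglongrightarrow> P \<tau> x * (q \<tau> * hopf_lax \<tau> u x)"
      by (intro AE_I2 tendsto_mult lim[OF t])
  qed
  show "continuous_on {a<..<T} \<Gamma>" unfolding \<Gamma>_def
  proof (rule continuous_on_integral_dom[where M="M * (4 * (2 * C + 3 * \<epsilon>) / a)"])
    fix \<tau> assume t: "\<tau> \<in> {a<..<T}"
    note [measurable] = meas[OF t]
    show "(\<lambda>x. P \<tau> x * (norm (hl_grad \<tau> x))\<^sup>2) \<in> borel_measurable borel" by measurable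
    show "\<bar>P \<tau> x * (norm (hl_grad \<tau> x))\<^sup>2\<bar> \<le> M * (4 * (2 * C + 3 * \<epsilon>) / a) * dom x" for x
      by (rule M(3)[OF r(1,3)[OF t] hl_grad_poly[OF a r(4,3)[OF t]]])
  next
    fix tn \<tau> assume t: "\<tau> \<in> {a<..<T}" "\<And>n. tn n \<in> {a<..<T}" "tn \<longlonglongrightarrow> \<tau>"
    \<comment> \<open>the exceptional set may depend on the sequence of times, which is countable\<close>
    have "AE x in lborel. \<forall>n. unique_min (tn n) x" unfolding AE_all_countable
      using unique_min_AE(2) r[OF t(2)] by blast
    moreover have "AE x in lborel. unique_min \<tau> x" using unique_min_AE(2) r[OF t(1)] by blast
    ultimately show "AE x in lborel. (\<lambda>n. P (tn n) x * (norm (hl_grad (tn n) x))\<^sup>2) \<longlonglongrightarrow> P \<tau> x * (norm (hl_grad \<tau> x))\<^sup>2"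
    proof eventually_elim
      case (elim x)
      have "(\<lambda>n. hl_grad (tn n) x) \<longlonglongrightarrow> hl_grad \<tau> x"
        by (rule hl_grad_tendsto[OF t(3)]) (use r[OF t(1)] r[OF t(2)] elim in auto)
      then show ?case by (intro tendsto_intros lim[OF t])
    qed
  qed
qed

lemma \<Phi>_tendsto_0: "(\<Phi> \<longlongrightarrow> \<Phi> 0) (at 0 within {0..T})"
proof (subst tendsto_at_iff_sequentially, intro allI impI)
  fix tn :: "nat \<Rightarrow> real" assume t: "\<forall>n. tn n \<in> {0..T} - {0}" "tn \<longlonglongrightarrow> 0"
  obtain M where M: "\<And>\<tau> x. 0 \<le> \<tau> \<Longrightarrow> \<tau> \<le> T \<Longrightarrow> P \<tau> x \<le> M * dom x" using P_times_bound by metis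
  have tn: "0 < tn n" "0 \<le> tn n" "tn n \<le> T" for n using t(1)[rule_format, of n] by auto
  show "(\<Phi> \<circ> tn) \<longlonglongrightarrow> \<Phi> 0" unfolding \<Phi>_def comp_def
  proof (rule integral_dominated_convergence)
    show "integrable lborel (\<lambda>x. M * dom x)" using integrable_dom by simp
    show "AE x in lborel. (\<lambda>n. P (tn n) x) \<longlonglongrightarrow> P 0 x"
      using P_tendsto(2)[of 0 tn] tn t(2) T_pos by auto
    show "AE x in lborel. norm (P (tn n) x) \<le> M * dom x" for n
      using M[OF tn(2,3)] P_pos by (auto simp: less_imp_le)
  qed (use P_meas tn T_pos in auto)
qed

lemma q_DERIV: assumes "\<tau> > 0" shows "(q has_real_derivative q' \<tau>) (at \<tau>)"
proof -
  have "(q has_real_derivative q' \<tau>) (at \<tau> within {0<..})"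
    by (rule has_field_derivative_subset[OF q_deriv]) (use assms in auto)
  moreover have "(at \<tau> within {0<..}) = at \<tau>" by (rule at_within_open) (use assms in auto)
  ultimately show ?thesis by simp
qed

lemma q_lipschitz:
  assumes "0 \<le> s" "s \<le> t" shows "0 \<le> q t - q s" "q t - q s \<le> c * (t - s)"
proof -
  show "0 \<le> q t - q s" using q_le[OF assms] by simp
  have "c * s - q s \<le> c * t - q t"
  proof (rule DERIV_nonneg_imp_increasing_open[OF assms(2)])
    fix x assume x: "s < x" "x < t"
    then have "(q has_real_derivative q' x) (at x)" using q_DERIV assms by simp
    then have "((\<lambda>x. c * x - q x) has_real_derivative (c - q' x)) (at x)" by (auto intro!: derivative_eq_intros)
    then show "\<exists>y. ((\<lambda>x. c * x - q x) has_real_derivative y) (at x) \<and> 0 \<le> y" using q'_le[of x] x assms by auto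
  next
    have "continuous_on {0..} q" using q_deriv by (intro continuous_on_eq_continuous_within[THEN iffD2] ballI) (auto intro: DERIV_continuous)
    then have "continuous_on {s..t} q" by (rule continuous_on_subset) (use assms in auto)
    then show "continuous_on {s..t} (\<lambda>x. c * x - q x)" by (intro continuous_intros)
  qed
  then show "q t - q s \<le> c * (t - s)" by (simp add: algebra_simps)
qed

lemma q_abs_lipschitz: "0 \<le> s \<Longrightarrow> 0 \<le> t \<Longrightarrow> \<bar>q t - q s\<bar> \<le> c * \<bar>t - s\<bar>"
  using q_lipschitz[of s t] q_lipschitz[of t s] by (cases "s \<le> t") auto

text \<open>Differentiation under the integral sign. The difference quotients in \<open>\<tau>\<close> converge pointwise by the
  Hamilton--Jacobi equation, and the Lipschitz bounds in time of \<open>q\<close> and of the semigroup dominate them.\<close>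

lemma \<Phi>_DERIV:
  assumes \<tau>: "0 < \<tau>" "\<tau> < T"
  shows "(\<Phi> has_real_derivative (q' \<tau> / q \<tau> * \<Psi> \<tau> - q \<tau> / 2 * \<Gamma> \<tau>)) (at \<tau>)"
proof -
  define S where "S = {\<tau>/2<..<T}"
  have \<tau>S: "\<tau> \<in> S" using \<tau> by (auto simp: S_def)
  have "(at \<tau> within S) = at \<tau>" by (rule at_within_open[OF \<tau>S]) (simp add: S_def)
  moreover have "(\<Phi> has_real_derivative (q' \<tau> / q \<tau> * \<Psi> \<tau> - q \<tau> / 2 * \<Gamma> \<tau>)) (at \<tau> within S)"
    unfolding has_field_derivative_iff
  proof (subst tendsto_at_iff_sequentially, intro allI impI)
    fix tn :: "nat \<Rightarrow> real" assume t: "\<forall>n. tn n \<in> S - {\<tau>}" "tn \<longlonglongrightarrow> \<tau>"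
    have tn: "0 < tn n" "0 \<le> tn n" "tn n \<le> T" "tn n \<noteq> \<tau>" "\<tau>/2 < tn n" for n
      using t(1)[rule_format, of n] \<tau> by (auto simp: S_def)
    have \<tau>': "0 \<le> \<tau>" "\<tau> \<le> T" using \<tau> by auto
    obtain M where M: "M > 0" "\<And>\<tau> x r B. 0 \<le> \<tau> \<Longrightarrow> \<tau> \<le> T \<Longrightarrow> \<bar>r\<bar> \<le> B * (1 + (norm x)\<^sup>2) \<Longrightarrow> \<bar>P \<tau> x * r\<bar> \<le> (M * B) * dom x"
      using P_times_bound by metis
    define B where "B = q T * (2 * (2 * C + 3 * \<epsilon>) * (3 / \<tau>)) + c * (C + 2 * \<epsilon>)"
    define \<alpha> where "\<alpha> = (\<lambda>s x. q s * hopf_lax s u x)"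
    have PE: "P s x = exp (\<alpha> s x - V x)" for s x by (simp add: P_def \<alpha>_def)
    have ab: "\<bar>\<alpha> (tn n) x - \<alpha> \<tau> x\<bar> \<le> (B * (1 + (norm x)\<^sup>2)) * \<bar>tn n - \<tau>\<bar>" for n x
    proof -
      have "\<alpha> (tn n) x - \<alpha> \<tau> x = q (tn n) * (hopf_lax (tn n) u x - hopf_lax \<tau> u x) + (q (tn n) - q \<tau>) * hopf_lax \<tau> u x"
        by (simp add: \<alpha>_def algebra_simps)
      then have "\<bar>\<alpha> (tn n) x - \<alpha> \<tau> x\<bar> \<le> \<bar>q (tn n)\<bar> * \<bar>hopf_lax (tn n) u x - hopf_lax \<tau> u x\<bar> + \<bar>q (tn n) - q \<tau>\<bar> * \<bar>hopf_lax \<tau> u x\<bar>"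
        by (metis abs_mult abs_triangle_ineq)
      also have "\<dots> \<le> q T * ((2 * ((2 * C + 3 * \<epsilon>) * (1 + (norm x)\<^sup>2)) * (3 / \<tau>)) * \<bar>tn n - \<tau>\<bar>)
          + (c * \<bar>tn n - \<tau>\<bar>) * ((C + 2 * \<epsilon>) * (1 + (norm x)\<^sup>2))"
      proof (intro add_mono mult_mono)
        show "\<bar>q (tn n)\<bar> \<le> q T" using q_pos[OF tn(2)] q_le[OF tn(2,3)] by (simp add: less_imp_le)
        show "\<bar>q (tn n) - q \<tau>\<bar> \<le> c * \<bar>tn n - \<tau>\<bar>" by (rule q_abs_lipschitz[OF \<tau>'(1) tn(2)])
        show "\<bar>hopf_lax \<tau> u x\<bar> \<le> (C + 2 * \<epsilon>) * (1 + (norm x)\<^sup>2)" by (rule hl_poly[OF \<tau>'])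
        have "\<bar>hopf_lax (tn n) u x - hopf_lax \<tau> u x\<bar> \<le> 2 * growth x * (1 / tn n + 1 / \<tau>) * \<bar>tn n - \<tau>\<bar>"
          by (rule hopf_lax_time_lipschitz[OF \<tau>(1) \<tau>'(2) tn(1,3)])
        also have "\<dots> \<le> 2 * ((2 * C + 3 * \<epsilon>) * (1 + (norm x)\<^sup>2)) * (3 / \<tau>) * \<bar>tn n - \<tau>\<bar>"
        proof (intro mult_right_mono mult_mono mult_left_mono growth_poly)
          have "1 / tn n \<le> 1 / (\<tau> / 2)" using tn(5)[of n] \<tau> by (intro divide_left_mono) auto
          then show "1 / tn n + 1 / \<tau> \<le> 3 / \<tau>" by simp
          show "0 \<le> 1 / tn n + 1 / \<tau>" using tn(1)[of n] \<tau> by simp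
          show "0 \<le> 2 * ((2 * C + 3 * \<epsilon>) * (1 + (norm x)\<^sup>2))" using C_nonneg eps_pos by simp
        qed (auto simp: growth_nonneg)
        finally show "\<bar>hopf_lax (tn n) u x - hopf_lax \<tau> u x\<bar> \<le> 2 * ((2 * C + 3 * \<epsilon>) * (1 + (norm x)\<^sup>2)) * (3 / \<tau>) * \<bar>tn n - \<tau>\<bar>" .
        show "0 \<le> q T" using q_pos[of T] T_pos by simp
        show "0 \<le> c * \<bar>tn n - \<tau>\<bar>" using c_pos by simp
      qed auto
      also have "\<dots> = (B * (1 + (norm x)\<^sup>2)) * \<bar>tn n - \<tau>\<bar>" unfolding B_def by (simp add: algebra_simps add_divide_distrib)
      finally show ?thesis .
    qed
    have dom: "\<bar>(P (tn n) x - P \<tau> x) / (tn n - \<tau>)\<bar> \<le> (M * B) * dom x" for n x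
    proof -
      have pos: "\<bar>tn n - \<tau>\<bar> > 0" using tn(4) by simp
      have "\<bar>P (tn n) x - P \<tau> x\<bar> \<le> max (P (tn n) x) (P \<tau> x) * \<bar>\<alpha> (tn n) x - \<alpha> \<tau> x\<bar>"
        unfolding PE using exp_diff_le[of "\<alpha> (tn n) x - V x" "\<alpha> \<tau> x - V x"] by simp
      also have "\<dots> \<le> max (P (tn n) x) (P \<tau> x) * ((B * (1 + (norm x)\<^sup>2)) * \<bar>tn n - \<tau>\<bar>)"
        using ab[of n x] P_pos[of \<tau> x] by (intro mult_left_mono) (auto simp: le_max_iff_disj less_imp_le)
      finally have 1: "\<bar>P (tn n) x - P \<tau> x\<bar> / \<bar>tn n - \<tau>\<bar> \<le> max (P (tn n) x) (P \<tau> x) * (B * (1 + (norm x)\<^sup>2))"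
        using pos by (simp add: pos_divide_le_eq mult.assoc)
      have "B * (1 + (norm x)\<^sup>2) \<ge> 0"
        using ab[of n x] pos by (smt (verit) abs_ge_zero zero_le_mult_iff)
      then have "\<bar>B * (1 + (norm x)\<^sup>2)\<bar> \<le> B * (1 + (norm x)\<^sup>2)" by simp
      then have "P s x * (B * (1 + (norm x)\<^sup>2)) \<le> (M * B) * dom x" if "0 \<le> s" "s \<le> T" for s
        using M(2)[OF that, of "B * (1 + (norm x)\<^sup>2)" B x] by simp
      from this[OF tn(2,3), of n] this[OF \<tau>'] have "max (P (tn n) x) (P \<tau> x) * (B * (1 + (norm x)\<^sup>2)) \<le> (M * B) * dom x"
        by (simp add: max_def)
      with 1 show ?thesis by (simp add: abs_divide)
    qed
    have "(\<lambda>n. LINT x|lborel. (P (tn n) x - P \<tau> x) / (tn n - \<tau>)) \<longlonglongrightarrow> (LINT x|lborel. P \<tau> x * (q' \<tau> * hopf_lax \<tau> u x - q \<tau> / 2 * (norm (hl_grad \<tau> x))\<^sup>2))"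
    proof (rule integral_dominated_convergence)
      show "integrable lborel (\<lambda>x. (M * B) * dom x)" using integrable_dom by simp
      show "AE x in lborel. norm ((P (tn n) x - P \<tau> x) / (tn n - \<tau>)) \<le> (M * B) * dom x" for n using dom by simp
      show "AE x in lborel. (\<lambda>n. (P (tn n) x - P \<tau> x) / (tn n - \<tau>)) \<longlonglongrightarrow> P \<tau> x * (q' \<tau> * hopf_lax \<tau> u x - q \<tau> / 2 * (norm (hl_grad \<tau> x))\<^sup>2)"
        using unique_min_AE(2)[OF \<tau>(1) \<tau>'(2)]
      proof eventually_elim
        case (elim x)
        note lims = P_tendsto(1,2)[OF \<tau>' tn(1,3) t(2), of x] P_tendsto(3)[OF \<tau>' tn(1,3) t(2)]
        have h: "(\<lambda>n. (hopf_lax (tn n) u x - hopf_lax \<tau> u x) / (tn n - \<tau>)) \<longlonglongrightarrow> - ((norm (hl_grad \<tau> x))\<^sup>2 / 2)"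
          by (rule hopf_lax_time_DERIV[OF \<tau>(1) \<tau>'(2) elim t(2) tn(1,3,4)])
        have "((\<lambda>y. (q y - q \<tau>) / (y - \<tau>)) \<longlongrightarrow> q' \<tau>) (at \<tau>)" using q_DERIV[OF \<tau>(1)] by (simp add: has_field_derivative_iff)
        then have qd: "(\<lambda>n. (q (tn n) - q \<tau>) / (tn n - \<tau>)) \<longlonglongrightarrow> q' \<tau>"
          by (rule filterlim_compose) (use t(2) tn(4) in \<open>auto simp: filterlim_at\<close>)
        have "(\<lambda>n. q (tn n) * ((hopf_lax (tn n) u x - hopf_lax \<tau> u x) / (tn n - \<tau>)) + (q (tn n) - q \<tau>) / (tn n - \<tau>) * hopf_lax \<tau> u x)
            \<longlonglongrightarrow> q \<tau> * (- ((norm (hl_grad \<tau> x))\<^sup>2 / 2)) + q' \<tau> * hopf_lax \<tau> u x"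
          by (intro tendsto_intros h qd lims)
        moreover have "q (tn n) * ((hopf_lax (tn n) u x - hopf_lax \<tau> u x) / (tn n - \<tau>)) + (q (tn n) - q \<tau>) / (tn n - \<tau>) * hopf_lax \<tau> u x
            = ((\<alpha> (tn n) x - V x) - (\<alpha> \<tau> x - V x)) / (tn n - \<tau>)" for n
          by (simp add: \<alpha>_def diff_divide_distrib algebra_simps)
        ultimately have "(\<lambda>n. ((\<alpha> (tn n) x - V x) - (\<alpha> \<tau> x - V x)) / (tn n - \<tau>)) \<longlonglongrightarrow> q \<tau> * (- ((norm (hl_grad \<tau> x))\<^sup>2 / 2)) + q' \<tau> * hopf_lax \<tau> u x"
          by simp
        moreover have "(\<lambda>n. \<alpha> (tn n) x - V x) \<longlonglongrightarrow> \<alpha> \<tau> x - V x" unfolding \<alpha>_def by (intro tendsto_intros lims)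
        ultimately have "(\<lambda>n. (exp (\<alpha> (tn n) x - V x) - exp (\<alpha> \<tau> x - V x)) / (tn n - \<tau>)) \<longlonglongrightarrow> exp (\<alpha> \<tau> x - V x) * (q \<tau> * (- ((norm (hl_grad \<tau> x))\<^sup>2 / 2)) + q' \<tau> * hopf_lax \<tau> u x)"
          by (rule exp_quotient_tendsto)
        then show ?case unfolding PE by (simp add: algebra_simps)
      qed
      note [measurable] = P_meas[OF \<tau>'] P_meas[OF tn(2,3)] hl_meas[OF \<tau>'] hl_grad_meas[OF \<tau>(1) \<tau>'(2)]
      show "(\<lambda>x. P \<tau> x * (q' \<tau> * hopf_lax \<tau> u x - q \<tau> / 2 * (norm (hl_grad \<tau> x))\<^sup>2)) \<in> borel_measurable lborel" by measurable
      show "(\<lambda>x. (P (tn n) x - P \<tau> x) / (tn n - \<tau>)) \<in> borel_measurable lborel" for n by measurable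
    qed
    moreover have "(LINT x|lborel. (P (tn n) x - P \<tau> x) / (tn n - \<tau>)) = (\<Phi> (tn n) - \<Phi> \<tau>) / (tn n - \<tau>)" for n
      unfolding \<Phi>_def using P_integrable[OF \<tau>'] P_integrable[OF tn(2,3)] by simp
    moreover have "(LINT x|lborel. P \<tau> x * (q' \<tau> * hopf_lax \<tau> u x - q \<tau> / 2 * (norm (hl_grad \<tau> x))\<^sup>2)) = q' \<tau> / q \<tau> * \<Psi> \<tau> - q \<tau> / 2 * \<Gamma> \<tau>"
    proof -
      have "(LINT x|lborel. P \<tau> x * (q' \<tau> * hopf_lax \<tau> u x - q \<tau> / 2 * (norm (hl_grad \<tau> x))\<^sup>2))
          = (LINT x|lborel. q' \<tau> * (P \<tau> x * hopf_lax \<tau> u x) - q \<tau> / 2 * (P \<tau> x * (norm (hl_grad \<tau> x))\<^sup>2))"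
        by (intro Bochner_Integration.integral_cong) (auto simp: algebra_simps)
      also have "\<dots> = q' \<tau> * (LINT x|lborel. P \<tau> x * hopf_lax \<tau> u x) - q \<tau> / 2 * \<Gamma> \<tau>"
        unfolding \<Gamma>_def using PQ_integrable[OF \<tau>'] PG_integrable[OF \<tau>(1) \<tau>'(2)] by simp
      also have "\<Psi> \<tau> = q \<tau> * (LINT x|lborel. P \<tau> x * hopf_lax \<tau> u x)"
        unfolding \<Psi>_def by (simp add: mult.left_commute)
      then have "q' \<tau> * (LINT x|lborel. P \<tau> x * hopf_lax \<tau> u x) = q' \<tau> / q \<tau> * \<Psi> \<tau>"
        using q_pos[OF \<tau>'(1)] by simp
      finally show ?thesis .
    qed
    ultimately show "((\<lambda>y. (\<Phi> y - \<Phi> \<tau>) / (y - \<tau>)) \<circ> tn) \<longlonglongrightarrow> q' \<tau> / q \<tau> * \<Psi> \<tau> - q \<tau> / 2 * \<Gamma> \<tau>"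
      by (simp only: o_def)
  qed
  ultimately show ?thesis by simp
qed

end

section \<open>The derivative of the logarithmic norm\<close>

context hc_flow
begin

text \<open>The entropy of \<open>exp (q \<tau> Q\<^sub>\<tau>)\<close> with respect to \<open>mu V\<close>, divided by its integral.\<close>

definition ent_ratio :: "real \<Rightarrow> real" where "ent_ratio \<tau> = \<Psi> \<tau> / \<Phi> \<tau> - ln (\<Phi> \<tau>)"

text \<open>The log-Sobolev deficit of \<open>exp (q \<tau> Q\<^sub>\<tau> / 2)\<close>, written in terms of the flow (see \<open>W12_flow\<close>).\<close>

definition \<delta> :: "real \<Rightarrow> real" where "\<delta> \<tau> = (q \<tau>)\<^sup>2 / (2 * c) * (\<Gamma> \<tau> / \<Phi> \<tau>) - ent_ratio \<tau>"

definition log_norm :: "real \<Rightarrow> real" where "log_norm \<tau> = ln (\<Phi> \<tau>) / q \<tau>"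
definition dissipation :: "real \<Rightarrow> real" where "dissipation \<tau> = ((c - q' \<tau>) * ent_ratio \<tau> + c * \<delta> \<tau>) / (q \<tau>)\<^sup>2"

lemma V_meas[measurable]: "V \<in> borel_measurable borel"
  using V_cont by (rule borel_measurable_continuous_onI)

lemma integral_mu:
  fixes f :: "real^'n \<Rightarrow> real" assumes "f \<in> borel_measurable borel"
  shows "(LINT x|mu V. f x) = (LINT x|lborel. exp (- V x) * f x)"
    "integrable (mu V) f \<longleftrightarrow> integrable lborel (\<lambda>x. exp (- V x) * f x)"
  unfolding mu_def using assms by (simp_all add: integral_density integrable_density)

lemma exp_V_integrable: "integrable lborel (\<lambda>x. exp (- V x))" "(LINT x|lborel. exp (- V x)) = 1"
proof -
  have sp: "space (mu V) = UNIV" by (simp add: mu_def)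
  have "emeasure (mu V) (space (mu V)) = 1" using mu_prob by (rule prob_space.emeasure_space_1)
  then have n: "(\<integral>\<^sup>+x. ennreal (exp (- V x)) \<partial>lborel) = ennreal 1"
    unfolding sp by (simp add: mu_def emeasure_density)
  show "integrable lborel (\<lambda>x. exp (- V x))"
    by (rule integrableI_nn_integral_finite[OF _ _ n]) auto
  show "(LINT x|lborel. exp (- V x)) = 1"
    using n by (subst integral_eq_nn_integral) auto
qed

lemma \<Psi>_alt: assumes "0 \<le> \<tau>" "\<tau> \<le> T" shows "integrable lborel (\<lambda>x. P \<tau> x * (q \<tau> * hopf_lax \<tau> u x))"
  using integrable_mult_right[OF PQ_integrable[OF assms], of "q \<tau>"] by (simp add: mult.left_commute)

text \<open>Nonnegativity of relative entropy, by integrating the tangent line inequality for the exponential.\<close>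

lemma ent_ratio_nonneg:
  assumes \<tau>: "0 \<le> \<tau>" "\<tau> \<le> T" shows "ent_ratio \<tau> \<ge> 0"
proof -
  define m where "m = \<Phi> \<tau>"
  have m: "m > 0" using \<Phi>_pos[OF \<tau>] by (simp add: m_def)
  have "P \<tau> x - m * exp (- V x) \<le> P \<tau> x * (q \<tau> * hopf_lax \<tau> u x) - ln m * P \<tau> x" for x
  proof -
    define a where "a = q \<tau> * hopf_lax \<tau> u x"
    have "1 + (ln m - a) \<le> exp (ln m - a)" by (rule exp_ge_add_one_self)
    then have "P \<tau> x * (1 + (ln m - a)) \<le> P \<tau> x * exp (ln m - a)" using P_pos[of \<tau> x] by (intro mult_left_mono) auto
    also have "\<dots> = m * exp (- V x)"
    proof -
      have "P \<tau> x * exp (ln m - a) = exp (ln m + - V x)" by (simp add: P_def a_def exp_add[symmetric])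
      then show ?thesis using m by (simp add: exp_diff exp_minus divide_inverse)
    qed
    finally show ?thesis by (simp add: a_def algebra_simps)
  qed
  then have "(LINT x|lborel. P \<tau> x - m * exp (- V x)) \<le> (LINT x|lborel. P \<tau> x * (q \<tau> * hopf_lax \<tau> u x) - ln m * P \<tau> x)"
    by (intro integral_mono Bochner_Integration.integrable_diff integrable_mult_right P_integrable[OF \<tau>] exp_V_integrable \<Psi>_alt[OF \<tau>])
  then have "0 \<le> \<Psi> \<tau> - ln m * m"
    using P_integrable[OF \<tau>] exp_V_integrable \<Psi>_alt[OF \<tau>] by (simp add: \<Psi>_def \<Phi>_def m_def)
  then have "ln m \<le> \<Psi> \<tau> / m" using m by (simp add: field_simps)
  then show ?thesis by (simp add: ent_ratio_def m_def)
qed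

text \<open>The transport inequality for \<open>g = q \<tau> Q\<^sub>\<tau> - ln (\<Phi> \<tau>)\<close>, normalised so that \<open>exp (g - V)\<close> and \<open>exp (- V)\<close>
  have the same mass.\<close>

lemma lsi_flow:
  assumes \<tau>: "0 < \<tau>" "\<tau> \<le> T"
  shows "\<delta> \<tau> \<ge> 0" "\<delta> \<tau> = 0 \<Longrightarrow> \<exists>b\<in>Ker_hessian V c. \<exists>a. \<forall>x. hopf_lax \<tau> u x = b \<bullet> x + a"
proof -
  have \<tau>': "0 \<le> \<tau>" using \<tau> by simp
  define m where "m = \<Phi> \<tau>"
  have m: "m > 0" using \<Phi>_pos[OF \<tau>' \<tau>(2)] by (simp add: m_def)
  have q0: "q \<tau> > 0" using q_pos[OF \<tau>'] .
  define g where "g = (\<lambda>x. q \<tau> * hopf_lax \<tau> u x + (- ln m))"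
  define G where "G = (\<lambda>x. q \<tau> *\<^sub>R hl_grad \<tau> x)"
  have Pg: "exp (g x - V x) = P \<tau> x / m" for x
  proof -
    have "exp (g x - V x) = exp ((q \<tau> * hopf_lax \<tau> u x - V x) - ln m)" by (simp add: g_def)
    then show ?thesis using m by (simp add: P_def exp_diff)
  qed
  have a: "axis_deriv i g (\<lambda>x. G x $ i)" for i
  proof -
    have c: "axis_deriv i (\<lambda>_. k) (\<lambda>_. 0)" for k :: real by (intro axis_deriv_C1) auto
    have "axis_deriv i g (\<lambda>x. (0 * hopf_lax \<tau> u x + q \<tau> * hl_grad \<tau> x $ i) + 0)"
      unfolding g_def by (intro axis_deriv_add axis_deriv_mult c axis_deriv_hopf_lax \<tau>)
    then show ?thesis by (simp add: G_def)
  qed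
  have V1: "axis_deriv i V (\<lambda>x. grad V x $ i)" for i
  proof -
    have "Ck 1 V" using V_C2 Ck_Suc_imp[of 1 V] by (simp add: numeral_2_eq_2)
    from axis_deriv_grad[OF this, of i] show ?thesis by (simp add: grad_def)
  qed
  have g1: "gauss_dom UNIV (\<lambda>x. exp (g x - V x))"
  proof -
    obtain K where K: "\<And>x. P \<tau> x \<le> K * exp (- (c/8) * (norm x)\<^sup>2)" using P_bound \<tau>' \<tau>(2) by metis
    have "P \<tau> x / m \<le> (K / m) * exp (- (c/8) * (norm x)\<^sup>2)" for x
      using divide_right_mono[OF K[of x], of m] m by simp
    moreover have "continuous_on UNIV (\<lambda>x. P \<tau> x / m)" by (intro continuous_intros P_cont \<tau>' \<tau>) (use m in auto)
    ultimately show ?thesis unfolding Pg using c_pos m P_pos by (intro gauss_dom_UNIV_I[of _ "c/8" "K / m"]) auto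
  qed
  have g2: "gauss_dom UNIV (\<lambda>x. exp (- V x))"
  proof -
    obtain K where K: "\<And>x. exp (- V x) \<le> K * exp (- (c/4) * (norm x)\<^sup>2)" using C2_gaussian_lower[OF V_C2 V_convex c_pos] by metis
    show ?thesis using c_pos K by (intro gauss_dom_UNIV_I[of _ "c/4" K] continuous_intros V_cont) auto
  qed
  have eq: "(LINT x|lborel. exp (g x - V x)) = (LINT x|lborel. exp (- V x))"
    unfolding Pg exp_V_integrable(2) using m P_integrable[OF \<tau>' \<tau>(2)] by (simp add: m_def \<Phi>_def)
  have i0: "integrable lborel (\<lambda>x. P \<tau> x * (q \<tau> * hopf_lax \<tau> u x))" by (rule \<Psi>_alt[OF \<tau>' \<tau>(2)])
  have "integrable lborel (\<lambda>x. (1/m) * (P \<tau> x * (q \<tau> * hopf_lax \<tau> u x)) - (ln m / m) * P \<tau> x)"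
    by (intro Bochner_Integration.integrable_diff integrable_mult_right i0 P_integrable \<tau>' \<tau>)
  then have i1: "integrable lborel (\<lambda>x. exp (g x - V x) * g x)"
    unfolding Pg by (simp add: g_def algebra_simps add_divide_distrib diff_divide_distrib)
  have nG: "(norm (G x))\<^sup>2 = (q \<tau>)\<^sup>2 * (norm (hl_grad \<tau> x))\<^sup>2" for x by (simp add: G_def power_mult_distrib)
  have "integrable lborel (\<lambda>x. ((q \<tau>)\<^sup>2 / m) * (P \<tau> x * (norm (hl_grad \<tau> x))\<^sup>2))"
    by (intro integrable_mult_right PG_integrable \<tau>)
  then have i2: "integrable lborel (\<lambda>x. exp (g x - V x) * (norm (G x))\<^sup>2)"
    unfolding Pg nG by (simp add: mult_ac)
  have d: "(LINT x|lborel. exp (g x - V x) * ((norm (G x))\<^sup>2 / (2*c) - g x)) = \<delta> \<tau>"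
  proof -
    have "(LINT x|lborel. exp (g x - V x) * ((norm (G x))\<^sup>2 / (2*c) - g x))
      = (LINT x|lborel. ((q \<tau>)\<^sup>2 / (2*c) / m) * (P \<tau> x * (norm (hl_grad \<tau> x))\<^sup>2) - (1/m) * (P \<tau> x * (q \<tau> * hopf_lax \<tau> u x)) + (ln m / m) * P \<tau> x)"
      unfolding Pg nG by (intro Bochner_Integration.integral_cong) (auto simp: g_def algebra_simps add_divide_distrib diff_divide_distrib)
    also have "\<dots> = ((q \<tau>)\<^sup>2 / (2*c) / m) * \<Gamma> \<tau> - (1/m) * \<Psi> \<tau> + (ln m / m) * m"
      unfolding \<Gamma>_def \<Psi>_def using i0 P_integrable[OF \<tau>' \<tau>(2)] PG_integrable[OF \<tau>] by (simp add: m_def \<Phi>_def)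
    also have "\<dots> = \<delta> \<tau>" using m by (simp add: \<delta>_def ent_ratio_def m_def[symmetric])
    finally show ?thesis .
  qed
  note lsi = log_sobolev_knothe[OF c_pos V_cont C2_grad(4)[OF V_C2] V1 strongly_convex_bound[OF V_C2 V_convex] a g1 g2 eq i1 i2, unfolded d]
  show "\<delta> \<tau> \<ge> 0" by (rule lsi(1))
  assume "\<delta> \<tau> = 0"
  from lsi(2)[OF this] obtain \<theta> where th: "\<And>x. g x = g 0 - c * (\<theta> \<bullet> x)" "\<And>x. V (x + \<theta>) = V x + grad V x \<bullet> \<theta> + c/2 * (norm \<theta>)\<^sup>2"
    by blast
  have k: "\<theta> \<in> Ker_hessian V c" by (rule equality_imp_kernel[OF V_C2 V_convex th(2)])
  define b where "b = (- (c / q \<tau>)) *\<^sub>R \<theta>"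
  have "b \<in> Ker_hessian V c" using k unfolding b_def Ker_hessian_def by (simp add: matrix_vector_mult_scaleR del: scaleR_minus_left)
  moreover have "hopf_lax \<tau> u x = b \<bullet> x + hopf_lax \<tau> u 0" for x
  proof -
    have "q \<tau> * hopf_lax \<tau> u x = q \<tau> * hopf_lax \<tau> u 0 - c * (\<theta> \<bullet> x)" using th(1)[of x] by (simp add: g_def)
    then have "hopf_lax \<tau> u x = (q \<tau> * hopf_lax \<tau> u 0 - c * (\<theta> \<bullet> x)) / q \<tau>" using q0 by (simp add: eq_divide_eq mult.commute)
    then show ?thesis using q0 by (simp add: b_def diff_divide_distrib)
  qed
  ultimately show "\<exists>b\<in>Ker_hessian V c. \<exists>a. \<forall>x. hopf_lax \<tau> u x = b \<bullet> x + a" by blast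
qed

text \<open>The terms with \<open>\<Gamma>\<close> combine because the gradient of \<open>exp (q Q / 2)\<close> carries the factor \<open>q / 2\<close>; what
  remains of the entropy has the coefficient \<open>c - q'\<close>.\<close>

lemma log_norm_DERIV:
  assumes \<tau>: "0 < \<tau>" "\<tau> < T" shows "(log_norm has_real_derivative - dissipation \<tau>) (at \<tau>)"
proof -
  have \<tau>': "0 \<le> \<tau>" "\<tau> \<le> T" using \<tau> by auto
  have p: "\<Phi> \<tau> > 0" "q \<tau> > 0" using \<Phi>_pos[OF \<tau>'] q_pos[OF \<tau>'(1)] by auto
  define A B L where "A = \<Psi> \<tau> / \<Phi> \<tau>" and "B = \<Gamma> \<tau> / \<Phi> \<tau>" and "L = ln (\<Phi> \<tau>)"
  have r: "1 / \<Phi> \<tau> * (q' \<tau> / q \<tau> * \<Psi> \<tau> - q \<tau> / 2 * \<Gamma> \<tau>) = q' \<tau> / q \<tau> * A - q \<tau> / 2 * B"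
    by (simp add: A_def B_def diff_divide_distrib)
  have "((\<lambda>t. ln (\<Phi> t)) has_real_derivative (1 / \<Phi> \<tau> * (q' \<tau> / q \<tau> * \<Psi> \<tau> - q \<tau> / 2 * \<Gamma> \<tau>))) (at \<tau>)"
    by (rule DERIV_chain2[OF _ \<Phi>_DERIV[OF \<tau>]]) (use DERIV_ln_divide[OF p(1)] in simp)
  then have "((\<lambda>t. ln (\<Phi> t)) has_real_derivative (q' \<tau> / q \<tau> * A - q \<tau> / 2 * B)) (at \<tau>)"
    unfolding r .
  from DERIV_divide[OF this q_DERIV[OF \<tau>(1)]] p(2)
  have "(log_norm has_real_derivative (((q' \<tau> / q \<tau> * A - q \<tau> / 2 * B) * q \<tau> - L * q' \<tau>) / (q \<tau> * q \<tau>))) (at \<tau>)"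
    by (simp add: log_norm_def[abs_def] L_def)
  also have "((q' \<tau> / q \<tau> * A - q \<tau> / 2 * B) * q \<tau> - L * q' \<tau>) / (q \<tau> * q \<tau>) = - dissipation \<tau>"
  proof -
    have "(q' \<tau> / q \<tau> * A - q \<tau> / 2 * B) * q \<tau> - L * q' \<tau> = - ((c - q' \<tau>) * (A - L) + c * ((q \<tau>)\<^sup>2 / (2 * c) * B - (A - L)))"
      using p(2) c_pos by (simp add: algebra_simps power2_eq_square)
    then show ?thesis by (simp add: dissipation_def \<delta>_def ent_ratio_def A_def B_def L_def power2_eq_square minus_divide_left)
  qed
  finally show ?thesis .
qed

lemma continuous_dissipation_\<delta>:
  assumes \<tau>: "0 < \<tau>" "\<tau> < T" shows "isCont dissipation \<tau>" "isCont \<delta> \<tau>"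
proof -
  have cq: "isCont q \<tau>" using q_DERIV[OF \<tau>(1)] by (rule DERIV_isCont)
  have cq': "isCont q' \<tau>"
  proof -
    have "continuous_on {0<..} q'" by (rule continuous_on_subset[OF q'_cont]) auto
    then show ?thesis using \<tau> by (simp add: continuous_on_eq_continuous_at)
  qed
  have "isCont f \<tau>" if "continuous_on {\<tau>/2<..<T} f" for f :: "real \<Rightarrow> real"
    using that \<tau> by (simp add: continuous_on_eq_continuous_at)
  then have cf: "isCont \<Phi> \<tau>" "isCont \<Psi> \<tau>" "isCont \<Gamma> \<tau>" using continuous_flow[of "\<tau>/2"] \<tau> by auto
  have p: "\<Phi> \<tau> \<noteq> 0" "q \<tau> \<noteq> 0" "\<Phi> \<tau> > 0" using \<Phi>_pos[of \<tau>] q_pos[of \<tau>] \<tau> by auto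
  have cE: "isCont ent_ratio \<tau>" unfolding ent_ratio_def using p by (intro continuous_intros cf) auto
  show cd: "isCont \<delta> \<tau>" unfolding \<delta>_def using p c_pos by (intro continuous_intros cf cE cq) auto
  show "isCont dissipation \<tau>" unfolding dissipation_def using p by (intro continuous_intros cE cd cq cq') auto
qed

lemma dissipation_nonneg:
  assumes \<tau>: "0 < \<tau>" "\<tau> \<le> T"
  shows "dissipation \<tau> \<ge> 0" "c * (1 / (q \<tau>)\<^sup>2 * \<delta> \<tau>) \<le> dissipation \<tau>" "dissipation \<tau> = 0 \<Longrightarrow> \<delta> \<tau> = 0"
proof -
  have 1: "(c - q' \<tau>) * ent_ratio \<tau> \<ge> 0" using q'_le[of \<tau>] ent_ratio_nonneg[of \<tau>] \<tau> by simp
  have 2: "c * \<delta> \<tau> \<ge> 0" using lsi_flow(1)[OF \<tau>] c_pos by simp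
  have q: "q \<tau> > 0" using q_pos[of \<tau>] \<tau> by simp
  show "dissipation \<tau> \<ge> 0" unfolding dissipation_def using 1 2 by simp
  have "c * \<delta> \<tau> / (q \<tau>)\<^sup>2 \<le> dissipation \<tau>" unfolding dissipation_def using 1 by (intro divide_right_mono) auto
  then show "c * (1 / (q \<tau>)\<^sup>2 * \<delta> \<tau>) \<le> dissipation \<tau>" by simp
  assume "dissipation \<tau> = 0"
  then have "(c - q' \<tau>) * ent_ratio \<tau> + c * \<delta> \<tau> = 0" using q by (simp add: dissipation_def)
  then have "c * \<delta> \<tau> = 0" using 1 2 by linarith
  then show "\<delta> \<tau> = 0" using c_pos by simp
qed

lemma log_norm_tendsto_0: "(log_norm \<longlongrightarrow> log_norm 0) (at_right 0)"
proof -
  have le: "at_right 0 \<le> (at 0 within {0..T})"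
  proof -
    have "at_right (0::real) = at 0 within {0<..<T}" using T_pos by (intro at_within_nhd[of _ "{..<T}"]) auto
    also have "\<dots> \<le> at 0 within {0..T}" by (rule at_le) auto
    finally show ?thesis .
  qed
  have "(\<Phi> \<longlongrightarrow> \<Phi> 0) (at_right 0)" by (rule filterlim_mono[OF \<Phi>_tendsto_0 order_refl le])
  moreover have "(q \<longlongrightarrow> q 0) (at_right 0)"
  proof -
    have "(q \<longlongrightarrow> q 0) (at 0 within {0..})" using DERIV_continuous[OF q_deriv[of 0]] by (simp add: continuous_within)
    then show ?thesis by (rule filterlim_mono[OF _ order_refl]) (rule at_le, auto)
  qed
  ultimately show ?thesis unfolding log_norm_def using \<Phi>_pos[of 0] q_pos[of 0] T_pos by (intro tendsto_intros) auto
qed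

text \<open>The gradient term may blow up as \<open>\<tau> \<rightarrow> 0\<close>; its integrability up to \<open>0\<close> follows from nonnegativity of
  the dissipation and convergence of the logarithmic norm.\<close>

lemma log_norm_flow:
  assumes t: "0 < t" "t < T"
  shows "set_integrable lborel {0<..<t} dissipation" "(LINT \<tau>:{0<..<t}|lborel. dissipation \<tau>) = log_norm 0 - log_norm t"
proof -
  have D: "DERIV (\<lambda>s. - log_norm s) x :> dissipation x" if "ereal 0 < ereal x" "ereal x < ereal t" for x
    using DERIV_minus[OF log_norm_DERIV[of x]] that t by auto
  have A: "(((\<lambda>s. - log_norm s) \<circ> real_of_ereal) \<longlongrightarrow> - log_norm 0) (at_right (ereal 0))"
    by (simp add: ereal_tendsto_simps1) (rule tendsto_minus[OF log_norm_tendsto_0])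
  have B: "(((\<lambda>s. - log_norm s) \<circ> real_of_ereal) \<longlongrightarrow> - log_norm t) (at_left (ereal t))"
  proof -
    have "isCont log_norm t" using log_norm_DERIV[OF t] by (rule DERIV_isCont)
    then have "(log_norm \<longlongrightarrow> log_norm t) (at_left t)" by (simp add: isCont_def filterlim_at_split)
    then show ?thesis by (simp add: ereal_tendsto_simps1 tendsto_minus)
  qed
  have nn: "AE x in lborel. ereal 0 < ereal x \<longrightarrow> ereal x < ereal t \<longrightarrow> 0 \<le> dissipation x" using dissipation_nonneg(1) t by auto
  have cJ: "isCont dissipation x" if "ereal 0 < ereal x" "ereal x < ereal t" for x using continuous_dissipation_\<delta>(1)[of x] that t by auto
  have lt: "ereal 0 < ereal t" using t by simp
  note F = interval_integral_FTC_nonneg[OF lt D cJ nn A B]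
  have e: "einterval (ereal 0) (ereal t) = {0<..<t}" by (auto simp: einterval_def)
  show "set_integrable lborel {0<..<t} dissipation" using F(1) by (simp add: e)
  show "(LINT \<tau>:{0<..<t}|lborel. dissipation \<tau>) = log_norm 0 - log_norm t" using F(2) t by (simp add: interval_lebesgue_integral_def e)
qed

lemma \<delta>_flow:
  assumes t: "0 < t" "t < T"
  shows "set_integrable lborel {0<..<t} (\<lambda>\<tau>. 1 / (q \<tau>)\<^sup>2 * \<delta> \<tau>)"
    "c * (LINT \<tau>:{0<..<t}|lborel. 1 / (q \<tau>)\<^sup>2 * \<delta> \<tau>) \<le> log_norm 0 - log_norm t"
proof -
  have m: "(\<lambda>\<tau>. indicator {0<..<t} \<tau> *\<^sub>R (1 / (q \<tau>)\<^sup>2 * \<delta> \<tau>)) \<in> borel_measurable borel"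
  proof (rule borel_measurable_continuous_on_indicator)
    have "continuous_on {0<..<t} \<delta>" using continuous_dissipation_\<delta>(2) t by (intro continuous_at_imp_continuous_on) auto
    moreover have "continuous_on {0<..<t} q" by (intro continuous_at_imp_continuous_on ballI DERIV_isCont[OF q_DERIV]) auto
    moreover have "q \<tau> \<noteq> 0" if "\<tau> \<in> {0<..<t}" for \<tau> using q_pos[of \<tau>] that by auto
    ultimately show "continuous_on {0<..<t} (\<lambda>\<tau>. 1 / (q \<tau>)\<^sup>2 * \<delta> \<tau>)" by (intro continuous_intros) auto
  qed auto
  have b: "0 \<le> 1 / (q \<tau>)\<^sup>2 * \<delta> \<tau>" "1 / (q \<tau>)\<^sup>2 * \<delta> \<tau> \<le> dissipation \<tau> / c" if "\<tau> \<in> {0<..<t}" for \<tau>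
  proof -
    show "0 \<le> 1 / (q \<tau>)\<^sup>2 * \<delta> \<tau>" using lsi_flow(1)[of \<tau>] that t by auto
    show "1 / (q \<tau>)\<^sup>2 * \<delta> \<tau> \<le> dissipation \<tau> / c" using dissipation_nonneg(2)[of \<tau>] that t c_pos by (auto simp: pos_le_divide_eq mult.commute)
  qed
  have iJ: "integrable lborel (\<lambda>\<tau>. indicator {0<..<t} \<tau> *\<^sub>R (dissipation \<tau> / c))"
    using integrable_divide[OF log_norm_flow(1)[OF t, unfolded set_integrable_def], of c] by simp
  show i: "set_integrable lborel {0<..<t} (\<lambda>\<tau>. 1 / (q \<tau>)\<^sup>2 * \<delta> \<tau>)"
    unfolding set_integrable_def
  proof (rule Bochner_Integration.integrable_bound[OF iJ])
    show "AE \<tau> in lborel. norm (indicator {0<..<t} \<tau> *\<^sub>R (1 / (q \<tau>)\<^sup>2 * \<delta> \<tau>)) \<le> norm (indicator {0<..<t} \<tau> *\<^sub>R (dissipation \<tau> / c))"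
    proof (rule AE_I2)
      fix \<tau>
      show "norm (indicator {0<..<t} \<tau> *\<^sub>R (1 / (q \<tau>)\<^sup>2 * \<delta> \<tau>)) \<le> norm (indicator {0<..<t} \<tau> *\<^sub>R (dissipation \<tau> / c))"
      proof (cases "\<tau> \<in> {0<..<t}")
        case True
        from b[OF this] True show ?thesis by (simp only: indicator_simps scaleR_one real_norm_def)
      next
        case False
        then show ?thesis by simp
      qed
    qed
  qed (use m in simp)
  have "c * (LINT \<tau>:{0<..<t}|lborel. 1 / (q \<tau>)\<^sup>2 * \<delta> \<tau>) = (LINT \<tau>:{0<..<t}|lborel. c * (1 / (q \<tau>)\<^sup>2 * \<delta> \<tau>))"
    by (rule set_integral_mult_right[symmetric])
  also have "\<dots> \<le> (LINT \<tau>:{0<..<t}|lborel. dissipation \<tau>)"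
  proof (rule set_integral_mono)
    show "set_integrable lborel {0<..<t} (\<lambda>\<tau>. c * (1 / (q \<tau>)\<^sup>2 * \<delta> \<tau>))" using i by (rule set_integrable_mult_right)
    show "c * (1 / (q \<tau>)\<^sup>2 * \<delta> \<tau>) \<le> dissipation \<tau>" if "\<tau> \<in> {0<..<t}" for \<tau> using dissipation_nonneg(2)[of \<tau>] that t by auto
  qed (rule log_norm_flow(1)[OF t])
  finally show "c * (LINT \<tau>:{0<..<t}|lborel. 1 / (q \<tau>)\<^sup>2 * \<delta> \<tau>) \<le> log_norm 0 - log_norm t" using log_norm_flow(2)[OF t] by simp
qed

lemma log_norm_antimono:
  assumes t: "0 < s" "s \<le> t" "t < T" shows "log_norm t \<le> log_norm s" "log_norm s \<le> log_norm 0"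
proof -
  have *: "log_norm t \<le> log_norm s" if "0 < s" "s \<le> t" "t < T" for s t
  proof -
    have "- log_norm s \<le> - log_norm t"
    proof (rule DERIV_nonneg_imp_nondecreasing[OF that(2)])
      fix x assume "s \<le> x" "x \<le> t"
      then show "\<exists>y. ((\<lambda>s. - log_norm s) has_real_derivative y) (at x) \<and> 0 \<le> y"
        using DERIV_minus[OF log_norm_DERIV[of x]] dissipation_nonneg(1)[of x] that by (intro exI[of _ "dissipation x"]) auto
    qed
    then show ?thesis by simp
  qed
  show "log_norm t \<le> log_norm s" using * t by blast
  show "log_norm s \<le> log_norm 0"
  proof (rule tendsto_lowerbound[OF log_norm_tendsto_0])
    have "\<forall>\<^sub>F x in at_right 0. x \<in> {0<..<s}" using t by (intro eventually_at_right_real) simp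
    then show "\<forall>\<^sub>F x in at_right 0. log_norm s \<le> log_norm x" by eventually_elim (use * t in auto)
  qed simp
qed

text \<open>A non-increasing function with equal end values is constant, so the dissipation vanishes.\<close>

lemma equality_imp_\<delta>_zero:
  assumes t: "0 < t" "t < T" and eq: "log_norm t = log_norm 0" and s: "0 < s" "s < t" shows "\<delta> s = 0"
proof -
  have c: "log_norm x = log_norm 0" if "x \<in> {0<..<t}" for x
    using log_norm_antimono[of x t] log_norm_antimono(2)[of x x] that t eq by (intro antisym) auto
  have "((\<lambda>_. log_norm 0) has_real_derivative - dissipation s) (at s)"
    by (rule has_field_derivative_transform_within_open[OF log_norm_DERIV, where S="{0<..<t}"]) (use s t c in auto)
  then have "- dissipation s = 0" using DERIV_unique[OF DERIV_const] by metis
  then show ?thesis using dissipation_nonneg(3)[of s] s t by auto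
qed

lemma Lp_norm_flow:
  assumes \<tau>: "0 \<le> \<tau>" "\<tau> \<le> T"
  shows "Lp_norm (mu V) (q \<tau>) (\<lambda>x. exp (hopf_lax \<tau> u x)) = exp (log_norm \<tau>)"
    "(\<lambda>x. exp (hopf_lax \<tau> u x)) \<in> Lp_space (mu V) (q \<tau>)"
proof -
  note [measurable] = hl_meas[OF \<tau>]
  have e: "\<bar>exp (hopf_lax \<tau> u x)\<bar> powr q \<tau> = exp (q \<tau> * hopf_lax \<tau> u x)" for x by (simp add: powr_def)
  have Pe: "exp (- V x) * exp (q \<tau> * hopf_lax \<tau> u x) = P \<tau> x" for x by (simp add: P_def exp_add[symmetric])
  have "(LINT x|mu V. \<bar>exp (hopf_lax \<tau> u x)\<bar> powr q \<tau>) = \<Phi> \<tau>"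
    unfolding e by (subst integral_mu(1)) (simp_all add: Pe \<Phi>_def)
  then show "Lp_norm (mu V) (q \<tau>) (\<lambda>x. exp (hopf_lax \<tau> u x)) = exp (log_norm \<tau>)"
    unfolding Lp_norm_def using \<Phi>_pos[OF \<tau>] by (simp add: powr_def log_norm_def)
  have "integrable (mu V) (\<lambda>x. \<bar>exp (hopf_lax \<tau> u x)\<bar> powr q \<tau>)"
    unfolding e by (subst integral_mu(2)) (simp_all add: Pe P_integrable[OF \<tau>])
  then show "(\<lambda>x. exp (hopf_lax \<tau> u x)) \<in> Lp_space (mu V) (q \<tau>)"
    unfolding Lp_space_def by (simp add: mu_def)
qed

text \<open>The weak gradient of \<open>exp (q \<tau> Q\<^sub>\<tau> / 2)\<close> is its gradient along the axes, which the chain rule expresses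
  through \<open>hl_grad \<tau>\<close>.\<close>

lemma W12_flow:
  assumes \<tau>: "0 < \<tau>" "\<tau> \<le> T"
  shows "(\<lambda>x. exp (q \<tau> / 2 * hopf_lax \<tau> u x)) \<in> W12 (mu V)"
    "LSI_deficit c (mu V) (\<lambda>x. exp (q \<tau> / 2 * hopf_lax \<tau> u x)) = \<delta> \<tau>"
proof -
  have \<tau>': "0 \<le> \<tau>" using \<tau> by simp
  note [measurable] = hl_meas[OF \<tau>' \<tau>(2)] hl_grad_meas[OF \<tau>]
  define f where "f = (\<lambda>x. exp (q \<tau> / 2 * hopf_lax \<tau> u x))"
  have fm[measurable]: "f \<in> borel_measurable borel" unfolding f_def by measurable
  define F where "F = (\<lambda>x. (f x * (q \<tau> / 2)) *\<^sub>R hl_grad \<tau> x)"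
  have f2: "(f x)\<^sup>2 = exp (q \<tau> * hopf_lax \<tau> u x)" for x by (simp add: f_def power2_eq_square exp_add[symmetric])
  have Pf: "exp (- V x) * (f x)\<^sup>2 = P \<tau> x" for x unfolding f2 by (simp add: P_def exp_add[symmetric])
  have d: "axis_deriv i f (\<lambda>x. F x $ i)" for i
  proof -
    have c: "axis_deriv i (\<lambda>_. q \<tau> / 2) (\<lambda>_. 0)" by (intro axis_deriv_C1) auto
    have "axis_deriv i f (\<lambda>x. exp (q \<tau> / 2 * hopf_lax \<tau> u x) * (0 * hopf_lax \<tau> u x + q \<tau> / 2 * hl_grad \<tau> x $ i))"
      unfolding f_def by (intro axis_deriv_exp axis_deriv_mult c axis_deriv_hopf_lax \<tau>)
    then show ?thesis by (simp add: F_def f_def mult.assoc)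
  qed
  note w = weak_grad_axis_deriv[OF d]
  note [measurable] = w(2)
  have Fn: "exp (- V x) * (norm (F x))\<^sup>2 = (q \<tau>)\<^sup>2 / 4 * (P \<tau> x * (norm (hl_grad \<tau> x))\<^sup>2)" for x
    unfolding Pf[symmetric] by (simp add: F_def power_mult_distrib power_divide mult_ac)
  have Fm: "(\<lambda>x. exp (- V x) * (norm (F x))\<^sup>2) \<in> borel_measurable borel" unfolding F_def by measurable
  have wi: "integrable lborel (\<lambda>x. exp (- V x) * (norm (weak_grad f x))\<^sup>2)"
    "(LINT x|lborel. exp (- V x) * (norm (weak_grad f x))\<^sup>2) = (q \<tau>)\<^sup>2 / 4 * \<Gamma> \<tau>"
  proof -
    have ae: "AE x in lborel. exp (- V x) * (norm (weak_grad f x))\<^sup>2 = exp (- V x) * (norm (F x))\<^sup>2"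
      using w(1) by eventually_elim simp
    have "integrable lborel (\<lambda>x. exp (- V x) * (norm (F x))\<^sup>2)" unfolding Fn by (intro integrable_mult_right PG_integrable \<tau>)
    then show "integrable lborel (\<lambda>x. exp (- V x) * (norm (weak_grad f x))\<^sup>2)"
      by (subst integrable_cong_AE[OF _ _ ae]) (use Fm in auto)
    have "(LINT x|lborel. exp (- V x) * (norm (weak_grad f x))\<^sup>2) = (LINT x|lborel. exp (- V x) * (norm (F x))\<^sup>2)"
      by (rule integral_cong_AE[OF _ _ ae]) (use Fm in auto)
    then show "(LINT x|lborel. exp (- V x) * (norm (weak_grad f x))\<^sup>2) = (q \<tau>)\<^sup>2 / 4 * \<Gamma> \<tau>" unfolding Fn by (simp add: \<Gamma>_def)
  qed
  have p2: "\<bar>y\<bar> powr 2 = y\<^sup>2" for y :: real by (cases "y = 0") (simp_all add: powr_numeral)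
  have "integrable (mu V) (\<lambda>x. \<bar>f x\<bar> powr 2)"
    unfolding p2 by (subst integral_mu(2)) (simp_all add: Pf P_integrable[OF \<tau>' \<tau>(2)])
  moreover have "integrable (mu V) (\<lambda>x. \<bar>norm (weak_grad f x)\<bar> powr 2)"
    unfolding p2 by (subst integral_mu(2)) (simp_all add: wi)
  ultimately have "f \<in> W12 (mu V)"
    unfolding W12_def Lp_space_def using w(3) by (auto simp: mu_def)
  then show "(\<lambda>x. exp (q \<tau> / 2 * hopf_lax \<tau> u x)) \<in> W12 (mu V)" by (simp add: f_def)
  have I1: "(LINT x|mu V. (norm (weak_grad f x))\<^sup>2) = (q \<tau>)\<^sup>2 / 4 * \<Gamma> \<tau>"
    by (subst integral_mu(1)) (simp_all add: wi)
  have I2: "(LINT x|mu V. (f x)\<^sup>2) = \<Phi> \<tau>"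
    by (subst integral_mu(1)) (simp_all add: Pf \<Phi>_def)
  have I3: "(LINT x|mu V. (f x)\<^sup>2 * ln ((f x)\<^sup>2)) = \<Psi> \<tau>"
  proof -
    have "(LINT x|mu V. (f x)\<^sup>2 * ln ((f x)\<^sup>2)) = (LINT x|lborel. (exp (- V x) * (f x)\<^sup>2) * ln ((f x)\<^sup>2))"
      by (subst integral_mu(1)) (simp_all add: mult.assoc)
    then show ?thesis unfolding Pf unfolding f2 by (simp add: \<Psi>_def)
  qed
  have "LSI_deficit c (mu V) f = \<delta> \<tau>"
    unfolding LSI_deficit_def Ent_def I1 I2 I3 \<delta>_def ent_ratio_def using \<Phi>_pos[OF \<tau>' \<tau>(2)] c_pos
    by (simp add: field_simps)
  then show "LSI_deficit c (mu V) (\<lambda>x. exp (q \<tau> / 2 * hopf_lax \<tau> u x)) = \<delta> \<tau>" by (simp add: f_def)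
qed

end

section \<open>Affine data and the hypercontractivity theorem\<close>

text \<open>Beyond the radius \<open>R\<close> the power \<open>C2 |x|\<^sup>\<theta>\<close> is at most \<open>\<epsilon> |x|\<^sup>2\<close>.\<close>

lemma subquadratic_growth:
  fixes u :: "real^'n::finite \<Rightarrow> real"
  assumes th: "0 < \<theta>" "\<theta> < 2" and C2: "C2 > 0" and b: "\<And>x. \<bar>u x\<bar> \<le> C1 + C2 * norm x powr \<theta>" and e: "\<epsilon> > 0"
  obtains C where "C \<ge> 0" "\<And>x. \<bar>u x\<bar> \<le> C + \<epsilon> * (norm x)\<^sup>2"
proof -
  \<comment> \<open>the radius at which \<open>C2 |x|\<^sup>\<theta>\<close> and \<open>\<epsilon> |x|\<^sup>2\<close> agree\<close>
  define R where "R = (\<epsilon> / C2) powr (1 / (\<theta> - 2))"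
  have R: "R > 0" "R powr (\<theta> - 2) = \<epsilon> / C2" using th e C2 by (simp_all add: R_def powr_powr)
  define C where "C = C1 + C2 * R powr \<theta>"
  have le: "\<bar>u x\<bar> \<le> C + \<epsilon> * (norm x)\<^sup>2" for x
  proof (cases "norm x \<le> R")
    case True
    then have "norm x powr \<theta> \<le> R powr \<theta>" using th by (intro powr_mono2) auto
    then have "C2 * norm x powr \<theta> \<le> C2 * R powr \<theta>" using C2 by simp
    moreover have "\<epsilon> * (norm x)\<^sup>2 \<ge> 0" using e by simp
    ultimately show ?thesis using b[of x] unfolding C_def by linarith
  next
    case False
    then have n: "norm x > R" "norm x > 0" using R by auto
    have "norm x powr (\<theta> - 2) \<le> R powr (\<theta> - 2)" using n R th by (intro powr_mono2') auto
    then have "C2 * norm x powr (\<theta> - 2) \<le> \<epsilon>" using R(2) C2 by (simp add: field_simps)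
    then have "C2 * norm x powr (\<theta> - 2) * (norm x)\<^sup>2 \<le> \<epsilon> * (norm x)\<^sup>2" by (intro mult_right_mono) auto
    moreover have "norm x powr (\<theta> - 2) * (norm x)\<^sup>2 = norm x powr \<theta>"
      using n powr_add[of "norm x" "\<theta> - 2" 2] by simp
    moreover have "C2 * R powr \<theta> \<ge> 0" using C2 by simp
    ultimately show ?thesis using b[of x] unfolding C_def by (simp add: mult.assoc)
  qed
  have "C \<ge> 0" using le[of 0] by simp
  then show thesis using le by (rule that)
qed

context hopf_lax_growth
begin

text \<open>Completing the square in the cost.\<close>

lemma hopf_lax_affine:
  assumes u: "\<And>x. u x = x0 \<bullet> x + c0" and \<tau>: "0 \<le> \<tau>"
  shows "hopf_lax \<tau> u x = x0 \<bullet> x + c0 - \<tau> / 2 * (x0 \<bullet> x0)"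
proof (cases "\<tau> = 0")
  case True then show ?thesis by (simp add: hopf_lax_def u)
next
  case False
  then have t: "\<tau> > 0" using \<tau> by simp
  have c: "cost \<tau> x y = x0 \<bullet> x + c0 - \<tau> / 2 * (x0 \<bullet> x0) + (norm (x - y - \<tau> *\<^sub>R x0))\<^sup>2 / (2 * \<tau>)" for y
  proof -
    have "(norm (x - y - \<tau> *\<^sub>R x0))\<^sup>2 = (norm (x - y))\<^sup>2 - 2 * \<tau> * (x0 \<bullet> (x - y)) + \<tau>\<^sup>2 * (x0 \<bullet> x0)"
      unfolding power2_norm_eq_inner
      by (simp add: inner_diff_left inner_diff_right inner_commute power2_eq_square algebra_simps)
    then have "(norm (x - y - \<tau> *\<^sub>R x0))\<^sup>2 / (2 * \<tau>) = (norm (x - y))\<^sup>2 / (2 * \<tau>) - x0 \<bullet> (x - y) + \<tau> / 2 * (x0 \<bullet> x0)"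
      using t by (simp add: add_divide_distrib diff_divide_distrib power2_eq_square)
    then show ?thesis by (simp add: cost_def u inner_diff_right)
  qed
  have "x - \<tau> *\<^sub>R x0 \<in> minimizers \<tau> x" unfolding minimizers_def c using t by simp
  from hopf_lax_eq[OF t this] show ?thesis by (simp add: c)
qed

end

lemma affine_limit:
  fixes u :: "real^'n::finite \<Rightarrow> real"
  assumes l: "\<And>x. (\<lambda>k. b k \<bullet> x + a k) \<longlonglongrightarrow> u x" and b: "\<And>k. b k \<in> Ker_hessian V c"
  shows "\<exists>x0\<in>Ker_hessian V c. \<exists>c0. \<forall>x. u x = x0 \<bullet> x + c0"
proof -
  have bl: "(\<lambda>k. b k $ i) \<longlonglongrightarrow> u (axis i 1) - u 0" for i
    using tendsto_diff[OF l[of "axis i 1"] l[of 0]] by (simp add: inner_axis)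
  define x0 :: "real^'n" where "x0 = (\<chi> i. u (axis i 1) - u 0)"
  have b0: "b \<longlonglongrightarrow> x0" using bl by (intro vec_tendstoI) (simp add: x0_def)
  have al: "a \<longlonglongrightarrow> u 0" using l[of 0] by simp
  have "u x = x0 \<bullet> x + u 0" for x
    by (rule LIMSEQ_unique[OF l]) (intro tendsto_intros b0 al)
  moreover have "x0 \<in> Ker_hessian V c"
    unfolding Ker_hessian_def
  proof (intro INT_I CollectI)
    fix x
    have "(\<lambda>k. (hessian V x - c *\<^sub>R mat 1) *v b k) \<longlonglongrightarrow> (hessian V x - c *\<^sub>R mat 1) *v x0"
      by (rule isCont_tendsto_compose[OF _ b0]) (rule linear_continuous_at, rule matrix_vector_mul_bounded_linear)
    moreover have "(hessian V x - c *\<^sub>R mat 1) *v b k = 0" for k using b[of k] by (auto simp: Ker_hessian_def)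
    ultimately show "(hessian V x - c *\<^sub>R mat 1) *v x0 = 0" by (simp add: LIMSEQ_const_iff)
  qed
  ultimately show ?thesis by blast
qed

context hc_flow
begin

text \<open>Translating the integration variable by \<open>(q \<tau> / c) x0\<close> turns \<open>P \<tau>\<close> into a multiple of \<open>exp (- V)\<close>, since
  \<open>V\<close> is exactly quadratic in the direction \<open>x0\<close>.\<close>

lemma affine_log_norm:
  assumes u: "\<And>x. u x = x0 \<bullet> x + c0" and k: "x0 \<in> Ker_hessian V c"
  obtains m where "\<And>\<tau>. 0 \<le> \<tau> \<Longrightarrow> \<tau> \<le> T \<Longrightarrow> log_norm \<tau> = (q \<tau> / (2 * c) - \<tau> / 2) * (x0 \<bullet> x0) + c0 - m"
proof -
  obtain m where m: "\<And>x s. V (x + s *\<^sub>R x0) = V x + s * (c * (x0 \<bullet> x) + m) + c/2 * s\<^sup>2 * (x0 \<bullet> x0)"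
    using kernel_imp_affine[OF V_C2 V_convex k] by blast
  have "log_norm \<tau> = (q \<tau> / (2 * c) - \<tau> / 2) * (x0 \<bullet> x0) + c0 - m / c" if \<tau>: "0 \<le> \<tau>" "\<tau> \<le> T" for \<tau>
  proof -
    define r where "r = q \<tau> * ((q \<tau> / (2 * c) - \<tau> / 2) * (x0 \<bullet> x0) + c0 - m / c)"
    define s where "s = q \<tau> / c"
    have sc: "q \<tau> = s * c" using c_pos by (simp add: s_def)
    have q0: "q \<tau> > 0" using q_pos[OF \<tau>(1)] .
    have "P \<tau> (x + s *\<^sub>R x0) = exp r * exp (- V x)" for x
    proof -
      have "q \<tau> * hopf_lax \<tau> u (x + s *\<^sub>R x0) - V (x + s *\<^sub>R x0) = r + - V x"
        unfolding hopf_lax_affine[OF u \<tau>(1)] m r_def sc using c_pos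
        by (simp add: inner_add_right field_simps power2_eq_square)
      then show ?thesis unfolding P_def by (simp only: exp_add)
    qed
    then have "\<Phi> \<tau> = (LINT x|lborel. exp r * exp (- V x))"
      unfolding \<Phi>_def using lborel_translate_integral(2)[OF P_integrable[OF \<tau>], of "s *\<^sub>R x0"] by simp
    then have "\<Phi> \<tau> = exp r" using exp_V_integrable by simp
    then show ?thesis using q0 by (simp add: log_norm_def r_def)
  qed
  then show thesis by (rule that)
qed

lemma hc_equality_iff:
  assumes t: "0 < t" "t < T"
  shows "log_norm t = log_norm 0 \<longleftrightarrow> (\<exists>x\<^sub>0 \<in> Ker_hessian V c. \<exists>c\<^sub>0. (\<forall>x. u x = x\<^sub>0 \<bullet> x + c\<^sub>0) \<and>
            (x\<^sub>0 \<noteq> 0 \<longrightarrow> (\<exists>a>0. \<forall>\<tau>. 0 \<le> \<tau> \<and> \<tau> < t \<longrightarrow> q \<tau> = a + c * \<tau>)))"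
proof
  assume eq: "log_norm t = log_norm 0"
  \<comment> \<open>any sequence of times in \<open>(0, t)\<close> that tends to zero\<close>
  define s where "s = (\<lambda>k. t * inverse (real (Suc (Suc k))))"
  have s: "0 < s k" "s k < t" for k
  proof -
    have i: "0 < inverse (real (Suc (Suc k)))" "inverse (real (Suc (Suc k))) < 1" by (simp_all add: inverse_less_1_iff)
    show "0 < s k" unfolding s_def using t(1) i(1) by (rule mult_pos_pos)
    show "s k < t" unfolding s_def using mult_strict_left_mono[OF i(2) t(1)] by simp
  qed
  have "(\<lambda>k. t * inverse (real (Suc (Suc k)))) \<longlonglongrightarrow> t * 0"
    by (intro tendsto_intros LIMSEQ_Suc[OF LIMSEQ_inverse_real_of_nat])
  then have s0: "s \<longlonglongrightarrow> 0" by (simp add: s_def)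
  have "\<exists>b a. b \<in> Ker_hessian V c \<and> (\<forall>x. hopf_lax (s k) u x = b \<bullet> x + a)" for k
    using lsi_flow(2)[of "s k"] equality_imp_\<delta>_zero[OF t eq s(1,2)] s[of k] t by fastforce
  then obtain b a where ba: "\<And>k. b k \<in> Ker_hessian V c" "\<And>k x. hopf_lax (s k) u x = b k \<bullet> x + a k" by metis
  have "(\<lambda>k. b k \<bullet> x + a k) \<longlonglongrightarrow> u x" for x
    unfolding ba(2)[symmetric] by (rule hopf_lax_tendsto_0[OF s0 s(1)]) (use s t less_imp_le order.strict_trans in metis)
  from affine_limit[OF this ba(1)] obtain x0 c0 where x0: "x0 \<in> Ker_hessian V c" "\<And>x. u x = x0 \<bullet> x + c0" by blast
  obtain m where m: "\<And>\<tau>. 0 \<le> \<tau> \<Longrightarrow> \<tau> \<le> T \<Longrightarrow> log_norm \<tau> = (q \<tau> / (2 * c) - \<tau> / 2) * (x0 \<bullet> x0) + c0 - m"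
    using affine_log_norm[OF x0(2,1)] by blast
  have "\<exists>a>0. \<forall>\<tau>. 0 \<le> \<tau> \<and> \<tau> < t \<longrightarrow> q \<tau> = a + c * \<tau>" if nz: "x0 \<noteq> 0"
  proof -
    have eqA: "(q t / (2 * c) - t / 2) * (x0 \<bullet> x0) = (q 0 / (2 * c) - 0 / 2) * (x0 \<bullet> x0)"
      using eq m[of t] m[of 0] t by simp
    have "x0 \<bullet> x0 \<noteq> 0" using nz by simp
    then have "q t / (2 * c) - t / 2 = q 0 / (2 * c) - 0 / 2" using eqA by (rule mult_right_cancel[THEN iffD1])
    then have "q t / (2 * c) - t / 2 = q 0 / (2 * c)" by simp
    then have qt: "q t = q 0 + c * t" using c_pos by (simp add: field_simps)
    have line: "q \<tau> = q 0 + c * \<tau>" if "0 \<le> \<tau> \<and> \<tau> < t" for \<tau>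
    proof -
      have 1: "q \<tau> - q 0 \<le> c * (\<tau> - 0)" by (rule q_lipschitz(2)) (use that in auto)
      have 2: "q t - q \<tau> \<le> c * (t - \<tau>)" by (rule q_lipschitz(2)) (use that in auto)
      show ?thesis using 1[unfolded right_diff_distrib] 2[unfolded right_diff_distrib] qt by linarith
    qed
    show ?thesis
    proof (intro exI[of _ "q 0"] conjI allI impI)
      show "0 < q 0" by (rule q_pos) simp
      show "q \<tau> = q 0 + c * \<tau>" if "0 \<le> \<tau> \<and> \<tau> < t" for \<tau> using that by (rule line)
    qed
  qed
  with x0 show "\<exists>x\<^sub>0 \<in> Ker_hessian V c. \<exists>c\<^sub>0. (\<forall>x. u x = x\<^sub>0 \<bullet> x + c\<^sub>0) \<and>
            (x\<^sub>0 \<noteq> 0 \<longrightarrow> (\<exists>a>0. \<forall>\<tau>. 0 \<le> \<tau> \<and> \<tau> < t \<longrightarrow> q \<tau> = a + c * \<tau>))" by blast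
next
  assume "\<exists>x\<^sub>0 \<in> Ker_hessian V c. \<exists>c\<^sub>0. (\<forall>x. u x = x\<^sub>0 \<bullet> x + c\<^sub>0) \<and>
            (x\<^sub>0 \<noteq> 0 \<longrightarrow> (\<exists>a>0. \<forall>\<tau>. 0 \<le> \<tau> \<and> \<tau> < t \<longrightarrow> q \<tau> = a + c * \<tau>))"
  then obtain x0 c0 where x0: "x0 \<in> Ker_hessian V c" "\<And>x. u x = x0 \<bullet> x + c0"
    and a: "x0 \<noteq> 0 \<Longrightarrow> \<exists>a>0. \<forall>\<tau>. 0 \<le> \<tau> \<and> \<tau> < t \<longrightarrow> q \<tau> = a + c * \<tau>" by blast
  obtain m where m: "\<And>\<tau>. 0 \<le> \<tau> \<Longrightarrow> \<tau> \<le> T \<Longrightarrow> log_norm \<tau> = (q \<tau> / (2 * c) - \<tau> / 2) * (x0 \<bullet> x0) + c0 - m"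
    using affine_log_norm[OF x0(2,1)] by blast
  show "log_norm t = log_norm 0"
  proof (cases "x0 = 0")
    case True
    then show ?thesis using m[of t] m[of 0] t by simp
  next
    case False
    then obtain a where a: "\<And>\<tau>. 0 \<le> \<tau> \<Longrightarrow> \<tau> < t \<Longrightarrow> q \<tau> = a + c * \<tau>" using a by blast
    have q0: "q 0 = a" using a[of 0] t by simp
    have "q 0 + c * t \<le> q t"
    proof (rule field_le_epsilon)
      fix e :: real assume e: "e > 0"
      define \<tau> where "\<tau> = max 0 (t - e / c)"
      have \<tau>: "0 \<le> \<tau>" "\<tau> < t" "c * t \<le> c * \<tau> + e"
      proof -
        show "0 \<le> \<tau>" "\<tau> < t" using t e c_pos by (auto simp: \<tau>_def)
        have "c * (t - e / c) \<le> c * \<tau>" using c_pos by (intro mult_left_mono) (auto simp: \<tau>_def)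
        then show "c * t \<le> c * \<tau> + e" using c_pos by (simp add: right_diff_distrib)
      qed
      show "q 0 + c * t \<le> q t + e" using a[OF \<tau>(1,2)] q_lipschitz(1)[of \<tau> t] \<tau> q0 by linarith
    qed
    moreover have "q t \<le> q 0 + c * t" using q_lipschitz(2)[of 0 t] t by simp
    ultimately have "q t = q 0 + c * t" by simp
    then have "q t / (2 * c) - t / 2 = q 0 / (2 * c)" using c_pos by (simp add: field_simps)
    then show ?thesis using m[of t] m[of 0] t by simp
  qed
qed

text \<open>Off the end points, which form a null set, the integrand is the deficit computed in \<open>W12_flow\<close>.\<close>

lemma hc_main:
  assumes t: "0 < t" "t < T"
  defines "D \<equiv> \<lambda>\<tau>. 1 / (q \<tau>)\<^sup>2 * LSI_deficit c (mu V) (\<lambda>x. exp (q \<tau> / 2 * hopf_lax \<tau> u x))"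
  shows "set_integrable lborel {0..t} D" "HC_deficit (mu V) q t u \<ge> c * (LINT \<tau>:{0..t}|lborel. D \<tau>)"
proof -
  define h where "h = (\<lambda>\<tau>. indicator {0<..<t} \<tau> *\<^sub>R (1 / (q \<tau>)\<^sup>2 * \<delta> \<tau>))"
  define f where "f = (\<lambda>\<tau>. indicator {0..t} \<tau> *\<^sub>R D \<tau>)"
  have hi: "integrable lborel h" using \<delta>_flow(1)[OF t] by (simp only: set_integrable_def h_def)
  have hm[measurable]: "h \<in> borel_measurable borel" using borel_measurable_integrable[OF hi] by simp
  have fh: "f \<tau> = h \<tau>" if "\<tau> \<noteq> 0" "\<tau> \<noteq> t" for \<tau>
  proof (cases "\<tau> \<in> {0<..<t}")
    case True
    then show ?thesis using W12_flow(2)[of \<tau>] t by (simp add: f_def h_def D_def)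
  next
    case False
    then have "\<tau> \<notin> {0..t}" using that by auto
    then show ?thesis using False by (simp add: f_def h_def)
  qed
  have fe: "f = (\<lambda>\<tau>. if \<tau> \<in> {0} then f 0 else if \<tau> \<in> {t} then f t else h \<tau>)" using fh by (auto simp: fun_eq_iff)
  have fm: "f \<in> borel_measurable borel" by (subst fe) measurable
  have ae: "AE \<tau> in lborel. f \<tau> = h \<tau>"
    using AE_lborel_singleton[of 0] AE_lborel_singleton[of t] by eventually_elim (rule fh)
  have fi: "integrable lborel f" by (subst integrable_cong_AE[OF _ _ ae]) (use fm hm hi in auto)
  then show "set_integrable lborel {0..t} D" by (simp only: set_integrable_def f_def)
  have "(LINT \<tau>:{0..t}|lborel. D \<tau>) = (LINT \<tau>|lborel. h \<tau>)"
    unfolding set_lebesgue_integral_def f_def[symmetric] by (rule integral_cong_AE[OF _ _ ae]) (use fm hm in auto)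
  also have "\<dots> = (LINT \<tau>:{0<..<t}|lborel. 1 / (q \<tau>)\<^sup>2 * \<delta> \<tau>)" unfolding set_lebesgue_integral_def h_def ..
  finally have "c * (LINT \<tau>:{0..t}|lborel. D \<tau>) \<le> log_norm 0 - log_norm t" using \<delta>_flow(2)[OF t] by simp
  moreover have "HC_deficit (mu V) q t u = log_norm 0 - log_norm t"
  proof -
    have u0: "hopf_lax 0 u = u" by (simp add: hopf_lax_def fun_eq_iff)
    have "Lp_norm (mu V) (q 0) (\<lambda>x. exp (u x)) = exp (log_norm 0)" using Lp_norm_flow(1)[of 0] T_pos by (simp add: u0)
    moreover have "Lp_norm (mu V) (q t) (\<lambda>x. exp (hopf_lax t u x)) = exp (log_norm t)" using Lp_norm_flow(1)[of t] t by simp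
    ultimately show ?thesis by (simp add: HC_deficit_def exp_diff[symmetric])
  qed
  ultimately show "HC_deficit (mu V) q t u \<ge> c * (LINT \<tau>:{0..t}|lborel. D \<tau>)" by simp
qed

lemma hopf_lax_0: "hopf_lax 0 u = u" by (simp add: hopf_lax_def fun_eq_iff)

lemma deficit_inequality:
  assumes t: "0 < t" "t < T"
  shows "(\<lambda>x. exp (u x)) \<in> Lp_space (mu V) (q 0) \<and>
        (\<lambda>x. exp (hopf_lax t u x)) \<in> Lp_space (mu V) (q t) \<and>
        (\<forall>\<tau>. 0 < \<tau> \<and> \<tau> \<le> t \<longrightarrow> (\<lambda>x. exp (q \<tau> / 2 * hopf_lax \<tau> u x)) \<in> W12 (mu V)) \<and>
        set_integrable lborel {0..t}
          (\<lambda>\<tau>. 1 / (q \<tau>)\<^sup>2 * LSI_deficit c (mu V) (\<lambda>x. exp (q \<tau> / 2 * hopf_lax \<tau> u x))) \<and>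
        HC_deficit (mu V) q t u \<ge>
          c * (LINT \<tau>:{0..t}|lborel.
                 1 / (q \<tau>)\<^sup>2 * LSI_deficit c (mu V) (\<lambda>x. exp (q \<tau> / 2 * hopf_lax \<tau> u x)))"
proof (intro conjI)
  show "(\<lambda>x. exp (u x)) \<in> Lp_space (mu V) (q 0)" using Lp_norm_flow(2)[of 0] T_pos by (simp add: hopf_lax_0)
  show "(\<lambda>x. exp (hopf_lax t u x)) \<in> Lp_space (mu V) (q t)" using Lp_norm_flow(2)[of t] t by simp
  show "\<forall>\<tau>. 0 < \<tau> \<and> \<tau> \<le> t \<longrightarrow> (\<lambda>x. exp (q \<tau> / 2 * hopf_lax \<tau> u x)) \<in> W12 (mu V)"
  proof (intro allI impI)
    fix \<tau> assume "0 < \<tau> \<and> \<tau> \<le> t"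
    then show "(\<lambda>x. exp (q \<tau> / 2 * hopf_lax \<tau> u x)) \<in> W12 (mu V)" using t by (intro W12_flow(1)) auto
  qed
qed (rule hc_main[OF t])+

lemma hypercontractivity_with_equality:
  assumes t: "0 < t" "t < T"
  shows "Lp_norm (mu V) (q t) (\<lambda>x. exp (hopf_lax t u x)) \<le> Lp_norm (mu V) (q 0) (\<lambda>x. exp (u x)) \<and>
        (Lp_norm (mu V) (q t) (\<lambda>x. exp (hopf_lax t u x)) = Lp_norm (mu V) (q 0) (\<lambda>x. exp (u x)) \<longleftrightarrow>
         (\<exists>x\<^sub>0 \<in> Ker_hessian V c. \<exists>c\<^sub>0. (\<forall>x. u x = x\<^sub>0 \<bullet> x + c\<^sub>0) \<and>
            (x\<^sub>0 \<noteq> 0 \<longrightarrow> (\<exists>a>0. \<forall>\<tau>. 0 \<le> \<tau> \<and> \<tau> < t \<longrightarrow> q \<tau> = a + c * \<tau>))))"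
proof -
  have nt: "Lp_norm (mu V) (q t) (\<lambda>x. exp (hopf_lax t u x)) = exp (log_norm t)" using Lp_norm_flow(1)[of t] t by simp
  have n0: "Lp_norm (mu V) (q 0) (\<lambda>x. exp (u x)) = exp (log_norm 0)"
    using Lp_norm_flow(1)[of 0] T_pos unfolding hopf_lax_0 by simp
  show ?thesis unfolding nt n0 exp_inj_iff exp_le_cancel_iff
    using log_norm_antimono(2)[of t t] hc_equality_iff[OF t] t by (intro conjI) auto
qed

end

text \<open>For a given time horizon \<open>\<epsilon>\<close> is chosen first, and the growth of \<open>u\<close> then provides \<open>C\<close>.\<close>

lemma hc_flow_exists:
  fixes c :: real and V u :: "real^'n::finite \<Rightarrow> real" and q q' :: "real \<Rightarrow> real"
  assumes V: "c > 0" "Ck 2 V" "\<And>x. psd (hessian V x - c *\<^sub>R mat 1)" "prob_space (mu V)"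
    and q: "\<And>\<tau>. \<tau> \<ge> 0 \<Longrightarrow> q \<tau> > 0" "mono_on {0..} q"
      "\<And>\<tau>. \<tau> \<ge> 0 \<Longrightarrow> (q has_real_derivative q' \<tau>) (at \<tau> within {0..})" "continuous_on {0..} q'" "\<And>\<tau>. \<tau> \<ge> 0 \<Longrightarrow> q' \<tau> \<le> c"
    and u: "smooth u" "\<exists>C1>0. \<exists>C2>0. \<exists>\<theta>. 0 < \<theta> \<and> \<theta> < 2 \<and> (\<forall>x. \<bar>u x\<bar> \<le> C1 + C2 * norm x powr \<theta>)" and T: "T > 0"
  obtains \<epsilon> C where "hc_flow u T \<epsilon> C c V q q'"
proof -
  define \<epsilon> where "\<epsilon> = min (1 / (8 * T)) (c / (16 * q T))"
  have qT: "q T > 0" using q(1)[of T] T by simp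
  have e: "\<epsilon> > 0" using T V(1) qT by (simp add: \<epsilon>_def)
  have "\<epsilon> \<le> 1 / (8 * T)" "\<epsilon> \<le> c / (16 * q T)" by (simp_all add: \<epsilon>_def)
  then have e2: "8 * \<epsilon> * T \<le> 1" "16 * q T * \<epsilon> \<le> c" using T qT by (simp_all add: pos_le_divide_eq mult_ac)
  obtain C1 C2 \<theta> where b: "C2 > 0" "0 < \<theta>" "\<theta> < 2" "\<And>x. \<bar>u x\<bar> \<le> C1 + C2 * norm x powr \<theta>" using u(2) by blast
  obtain C where C: "C \<ge> 0" "\<And>x. \<bar>u x\<bar> \<le> C + \<epsilon> * (norm x)\<^sup>2" using subquadratic_growth[OF b(2,3,1,4) e] by blast
  have "continuous_on UNIV u" using u(1) Ck_continuous[of 0 u] unfolding smooth_def by blast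
  then have "hc_flow u T \<epsilon> C c V q q'"
    using e e2 C T V q by (intro hc_flow.intro hopf_lax_growth.intro hc_flow_axioms.intro)
  then show thesis by (rule that)
qed

theorem theorem1p5:
  fixes c :: real and V :: "real^'n::finite \<Rightarrow> real" and q q' :: "real \<Rightarrow> real"
  assumes c_pos: "c > 0"
    and V_C2: "Ck 2 V"
    and V_convex: "\<And>x. psd (hessian V x - c *\<^sub>R mat 1)"
    and mu_prob: "prob_space (mu V)"
    and q_pos: "\<And>\<tau>. \<tau> \<ge> 0 \<Longrightarrow> q \<tau> > 0"
    and q_mono: "mono_on {0..} q"
    and q_deriv: "\<And>\<tau>. \<tau> \<ge> 0 \<Longrightarrow> (q has_real_derivative q' \<tau>) (at \<tau> within {0..})"
    and q'_cont: "continuous_on {0..} q'"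
    and q'_le: "\<And>\<tau>. \<tau> \<ge> 0 \<Longrightarrow> q' \<tau> \<le> c"
  shows
    "(\<forall>t>0. \<forall>u::real^'n \<Rightarrow> real. smooth u \<longrightarrow>
        (\<exists>C1>0. \<exists>C2>0. \<exists>\<theta>. 0 < \<theta> \<and> \<theta> < 2 \<and> (\<forall>x. \<bar>u x\<bar> \<le> C1 + C2 * norm x powr \<theta>)) \<longrightarrow>
        (\<lambda>x. exp (u x)) \<in> Lp_space (mu V) (q 0) \<and>
        (\<lambda>x. exp (hopf_lax t u x)) \<in> Lp_space (mu V) (q t) \<and>
        (\<forall>\<tau>. 0 < \<tau> \<and> \<tau> \<le> t \<longrightarrow> (\<lambda>x. exp (q \<tau> / 2 * hopf_lax \<tau> u x)) \<in> W12 (mu V)) \<and>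
        set_integrable lborel {0..t}
          (\<lambda>\<tau>. 1 / (q \<tau>)\<^sup>2 * LSI_deficit c (mu V) (\<lambda>x. exp (q \<tau> / 2 * hopf_lax \<tau> u x))) \<and>
        HC_deficit (mu V) q t u \<ge>
          c * (LINT \<tau>:{0..t}|lborel.
                 1 / (q \<tau>)\<^sup>2 * LSI_deficit c (mu V) (\<lambda>x. exp (q \<tau> / 2 * hopf_lax \<tau> u x))))
     \<and>
     (\<forall>t>0. \<forall>u::real^'n \<Rightarrow> real. smooth u \<longrightarrow>
        (\<exists>C1>0. \<exists>C2>0. \<exists>\<theta>. 0 < \<theta> \<and> \<theta> < 2 \<and> (\<forall>x. \<bar>u x\<bar> \<le> C1 + C2 * norm x powr \<theta>)) \<longrightarrow>
        Lp_norm (mu V) (q t) (\<lambda>x. exp (hopf_lax t u x)) \<le> Lp_norm (mu V) (q 0) (\<lambda>x. exp (u x)) \<and>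
        (Lp_norm (mu V) (q t) (\<lambda>x. exp (hopf_lax t u x)) = Lp_norm (mu V) (q 0) (\<lambda>x. exp (u x)) \<longleftrightarrow>
         (\<exists>x\<^sub>0 \<in> Ker_hessian V c. \<exists>c\<^sub>0. (\<forall>x. u x = x\<^sub>0 \<bullet> x + c\<^sub>0) \<and>
            (x\<^sub>0 \<noteq> 0 \<longrightarrow> (\<exists>a>0. \<forall>\<tau>. 0 \<le> \<tau> \<and> \<tau> < t \<longrightarrow> q \<tau> = a + c * \<tau>)))))"
proof (rule conjI)
  \<comment> \<open>a time horizon beyond \<open>t\<close>, so that derivatives at \<open>t\<close> are two-sided\<close>
  have flow: "\<exists>\<epsilon> C. hc_flow u (t + 1) \<epsilon> C c V q q'"
    if asm: "0 < t" "smooth u" "\<exists>C1>0. \<exists>C2>0. \<exists>\<theta>. 0 < \<theta> \<and> \<theta> < 2 \<and> (\<forall>x. \<bar>u x\<bar> \<le> C1 + C2 * norm x powr \<theta>)"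
    for t :: real and u :: "real^'n \<Rightarrow> real"
  proof -
    have t1: "t + 1 > 0" using asm(1) by simp
    obtain \<epsilon> C where "hc_flow u (t + 1) \<epsilon> C c V q q'"
      by (rule hc_flow_exists[OF c_pos V_C2 V_convex mu_prob q_pos q_mono q_deriv q'_cont q'_le asm(2,3) t1])
    then show ?thesis by (intro exI)
  qed
  have lt: "t < t + 1" for t :: real by simp
  show "(\<forall>t>0. \<forall>u::real^'n \<Rightarrow> real. smooth u \<longrightarrow>
        (\<exists>C1>0. \<exists>C2>0. \<exists>\<theta>. 0 < \<theta> \<and> \<theta> < 2 \<and> (\<forall>x. \<bar>u x\<bar> \<le> C1 + C2 * norm x powr \<theta>)) \<longrightarrow>
        (\<lambda>x. exp (u x)) \<in> Lp_space (mu V) (q 0) \<and>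
        (\<lambda>x. exp (hopf_lax t u x)) \<in> Lp_space (mu V) (q t) \<and>
        (\<forall>\<tau>. 0 < \<tau> \<and> \<tau> \<le> t \<longrightarrow> (\<lambda>x. exp (q \<tau> / 2 * hopf_lax \<tau> u x)) \<in> W12 (mu V)) \<and>
        set_integrable lborel {0..t}
          (\<lambda>\<tau>. 1 / (q \<tau>)\<^sup>2 * LSI_deficit c (mu V) (\<lambda>x. exp (q \<tau> / 2 * hopf_lax \<tau> u x))) \<and>
        HC_deficit (mu V) q t u \<ge>
          c * (LINT \<tau>:{0..t}|lborel.
                 1 / (q \<tau>)\<^sup>2 * LSI_deficit c (mu V) (\<lambda>x. exp (q \<tau> / 2 * hopf_lax \<tau> u x))))"
  proof (intro allI impI)
    fix t :: real and u :: "real^'n \<Rightarrow> real"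
    assume a: "0 < t" "smooth u" "\<exists>C1>0. \<exists>C2>0. \<exists>\<theta>. 0 < \<theta> \<and> \<theta> < 2 \<and> (\<forall>x. \<bar>u x\<bar> \<le> C1 + C2 * norm x powr \<theta>)"
    obtain \<epsilon> C where h: "hc_flow u (t + 1) \<epsilon> C c V q q'" using flow[OF a] by blast
    show "(\<lambda>x. exp (u x)) \<in> Lp_space (mu V) (q 0) \<and>
        (\<lambda>x. exp (hopf_lax t u x)) \<in> Lp_space (mu V) (q t) \<and>
        (\<forall>\<tau>. 0 < \<tau> \<and> \<tau> \<le> t \<longrightarrow> (\<lambda>x. exp (q \<tau> / 2 * hopf_lax \<tau> u x)) \<in> W12 (mu V)) \<and>
        set_integrable lborel {0..t}
          (\<lambda>\<tau>. 1 / (q \<tau>)\<^sup>2 * LSI_deficit c (mu V) (\<lambda>x. exp (q \<tau> / 2 * hopf_lax \<tau> u x))) \<and>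
        HC_deficit (mu V) q t u \<ge>
          c * (LINT \<tau>:{0..t}|lborel.
                 1 / (q \<tau>)\<^sup>2 * LSI_deficit c (mu V) (\<lambda>x. exp (q \<tau> / 2 * hopf_lax \<tau> u x)))"
      by (rule hc_flow.deficit_inequality[OF h a(1) lt])
  qed
  show "(\<forall>t>0. \<forall>u::real^'n \<Rightarrow> real. smooth u \<longrightarrow>
        (\<exists>C1>0. \<exists>C2>0. \<exists>\<theta>. 0 < \<theta> \<and> \<theta> < 2 \<and> (\<forall>x. \<bar>u x\<bar> \<le> C1 + C2 * norm x powr \<theta>)) \<longrightarrow>
        Lp_norm (mu V) (q t) (\<lambda>x. exp (hopf_lax t u x)) \<le> Lp_norm (mu V) (q 0) (\<lambda>x. exp (u x)) \<and>
        (Lp_norm (mu V) (q t) (\<lambda>x. exp (hopf_lax t u x)) = Lp_norm (mu V) (q 0) (\<lambda>x. exp (u x)) \<longleftrightarrow>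
         (\<exists>x\<^sub>0 \<in> Ker_hessian V c. \<exists>c\<^sub>0. (\<forall>x. u x = x\<^sub>0 \<bullet> x + c\<^sub>0) \<and>
            (x\<^sub>0 \<noteq> 0 \<longrightarrow> (\<exists>a>0. \<forall>\<tau>. 0 \<le> \<tau> \<and> \<tau> < t \<longrightarrow> q \<tau> = a + c * \<tau>)))))"
  proof (intro allI impI)
    fix t :: real and u :: "real^'n \<Rightarrow> real"
    assume a: "0 < t" "smooth u" "\<exists>C1>0. \<exists>C2>0. \<exists>\<theta>. 0 < \<theta> \<and> \<theta> < 2 \<and> (\<forall>x. \<bar>u x\<bar> \<le> C1 + C2 * norm x powr \<theta>)"
    obtain \<epsilon> C where h: "hc_flow u (t + 1) \<epsilon> C c V q q'" using flow[OF a] by blast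
    show "Lp_norm (mu V) (q t) (\<lambda>x. exp (hopf_lax t u x)) \<le> Lp_norm (mu V) (q 0) (\<lambda>x. exp (u x)) \<and>
        (Lp_norm (mu V) (q t) (\<lambda>x. exp (hopf_lax t u x)) = Lp_norm (mu V) (q 0) (\<lambda>x. exp (u x)) \<longleftrightarrow>
         (\<exists>x\<^sub>0 \<in> Ker_hessian V c. \<exists>c\<^sub>0. (\<forall>x. u x = x\<^sub>0 \<bullet> x + c\<^sub>0) \<and>
            (x\<^sub>0 \<noteq> 0 \<longrightarrow> (\<exists>a>0. \<forall>\<tau>. 0 \<le> \<tau> \<and> \<tau> < t \<longrightarrow> q \<tau> = a + c * \<tau>))))"
      by (rule hc_flow.hypercontractivity_with_equality[OF h a(1) lt])
  qed
qed

end
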